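(* Let $0<s<1$, $n\ge 1$ and $\mathbf{e}=\mathbf{e_n}=(0,\dots,0,1)$. Let $u\in\mathcal{L}_s(\mathbb{R}^n)\cap C^{1,1}_{loc}(\mathbb{R}^n_+)$ be a nonnegative nontrivial bounded solution of $$\begin{cases}-\mathbf{F_s}u(x)=f(u(x)), & \forall\,x\in\mathbb{R}^n_+,\\ u(x)=0, & \forall\,x\in\mathbb{R}^n\setminus\mathbb{R}^n_+.\end{cases}$$ Assume that $f(\cdot)$ is Lipschitz in the range of $u$ and satisfies either $f(0)\ne 0$ or the following condition: $f(t)\ge c_0t$ on $[0,\delta_0]$ for some small $c_0>0$ and $\delta_0>0$. Then $u$ is strictly monotone increasing in the $x_n$ direction and hence $u>0$ in $\mathbb{R}^n_+$.
   Context: Let $0<\theta\le\Theta<\infty$. $\mathcal{L}_s(\mathbb{R}^n)$ is the set of functions $u:\mathbb{R}^n\to\mathbb{R}$ with $\int_{\mathbb{R}^n}\frac{|u(x)|}{1+|x|^{n+2s}}\,dx<+\infty$. $\mathbb{R}^n_+=\{x\in\mathbb{R}^n : x_n>0\}$. $C^{1,1}_{loc}(\mathbb{R}^n_+)$ denotes functions that are $C^1$ with locally Lipschitz gradient in $\mathbb{R}^n_+$. For the unit vector $\mathbf{e}$ and $u\in\mathcal{L}_s(\mathbb{R}^n)$ that is $C^{1,1}$ near $x$, $$\mathbf{F_s}u(x):=\inf\left\{P.V.\int_{\mathbb{R}^n}\frac{u(y)-u(x)}{|A^{-1}(y-x)|^{n+2s}}\,dy \;:\; A \text{ a real symmetric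 } n\times n \text{ matrix},\ \theta I\le A\le\Theta I,\ \mathbf{e} \text{ is an eigenvector of } A\right\}.$$ P.V. denotes the Cauchy principal value. *)

theory Defs
  imports "HOL-Analysis.Analysis"
begin

text \<open>
  Euclidean space of dimension $n$ is \<open>real ^ 'n\<close> with a linearly ordered finite index type;
  the last coordinate $x_n$ is the one with the largest index.
\<close>

definition e_last :: "real ^ 'n::{finite,linorder}" where
  "e_last = axis (Max UNIV) 1"

definition upper_half_space :: "(real ^ 'n::{finite,linorder}) set" where
  "upper_half_space = {x. x $ Max UNIV > 0}"

text \<open>
  Measurability of \<open>u\<close> itself is required separately, since the integrand only involves
  \<open>\<bar>u x\<bar>\<close>.
\<close>

definition L_space :: "real \<Rightarrow> (real ^ 'n \<Rightarrow> real) set" where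
  "L_space s = {u. u \<in> borel_measurable lebesgue \<and>
     integrable lebesgue (\<lambda>x. \<bar>u x\<bar> / (1 + norm x powr (real CARD('n) + 2 * s)))}"

definition C11_loc :: "'a::euclidean_space set \<Rightarrow> ('a \<Rightarrow> real) set" where
  "C11_loc S = {u. \<exists>g. (\<forall>x\<in>S. GDERIV u x :> g x) \<and> continuous_on S g \<and>
     (\<forall>x\<in>S. \<exists>r>0. \<exists>L. L-lipschitz_on (ball x r \<inter> S) g)}"

definition loewner_le :: "real ^ 'n ^ 'n \<Rightarrow> real ^ 'n ^ 'n \<Rightarrow> bool" where
  "loewner_le A B \<longleftrightarrow> (\<forall>v. v \<bullet> (A *v v) \<le> v \<bullet> (B *v v))"

definition is_eigenvector :: "real ^ 'n ^ 'n \<Rightarrow> real ^ 'n \<Rightarrow> bool" where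
  "is_eigenvector A v \<longleftrightarrow> v \<noteq> 0 \<and> (\<exists>c. A *v v = c *\<^sub>R v)"

definition admissible_matrices ::
    "real \<Rightarrow> real \<Rightarrow> real ^ 'n \<Rightarrow> (real ^ 'n ^ 'n) set" where
  "admissible_matrices \<theta> \<Theta> e =
     {A. transpose A = A \<and> loewner_le (mat \<theta>) A \<and> loewner_le A (mat \<Theta>) \<and> is_eigenvector A e}"

definition principal_value :: "('a::euclidean_space \<Rightarrow> real) \<Rightarrow> 'a \<Rightarrow> real" where
  "principal_value g x = Lim (at_right 0) (\<lambda>\<epsilon>. LINT y:- ball x \<epsilon>|lebesgue. g y)"

text \<open>
  For \<open>u \<in> L_space s\<close> that is $C^{1,1}$ near \<open>x\<close>, with \<open>0 < s < 1\<close> and \<open>0 < \<theta> \<le> \<Theta>\<close>, all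
  principal values below exist as finite limits and are bounded uniformly in \<open>A\<close>, so the limit
  and the real infimum have their usual meaning. For other arguments the value is unspecified.
\<close>

definition F_op ::
    "real \<Rightarrow> real \<Rightarrow> real ^ 'n \<Rightarrow> real \<Rightarrow> (real ^ 'n \<Rightarrow> real) \<Rightarrow> real ^ 'n \<Rightarrow> real" where
  "F_op \<theta> \<Theta> e s u x =
     (INF A \<in> admissible_matrices \<theta> \<Theta> e.
        principal_value
          (\<lambda>y. (u y - u x) / norm (matrix_inv A *v (y - x)) powr (real CARD('n) + 2 * s)) x)"

end

theory Submission
  imports Defs
begin

text \<open>
  Since \<open>e\<^sub>n\<close> is an eigenvector of every admissible \<open>A\<close>, each kernel $|A^{-1}h|^{-(n+2s)}$ is even
  in \<open>h\<^sub>n\<close> and decreases under reflection away from a point, so moving planes apply to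
  $w_l(y) = u(y^l) - u(y)$, where \<open>y\<^sup>l\<close> is the mirror image of \<open>y\<close> in $\{y_n = l\}$; the infimum is
  handled by proving all estimates uniformly over a class of kernels.
  If $-m < 0$ is the infimum of \<open>w\<^sub>l\<close> below the plane, perturbing \<open>w\<^sub>l\<close> by a small bump yields a
  true minimum, and the equation there gives three facts. The minimum stays at a distance $d_0$ from both
  $\{y_n = 0\}$ and $\{y_n = l\}$, because near them the kernel integral gains $d^{-2s} m$. Next, $m$
  controls the integral of \<open>w\<^sub>l\<close> over a ball in $\{y_n < 0\}$, where \<open>w\<^sub>l\<close> is the reflection of \<open>u\<close>; as
  \<open>u\<close> has integral bounded below over large balls (this is where the condition on \<open>f\<close> enters), $m$ is
  bounded below. Finally the average of \<open>w\<^sub>l\<close> over a small ball is at most $-m/2$.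

  If now \<open>w\<^sub>k\<close> is nonnegative for some \<open>k\<close> slightly less than \<open>l\<close>, that average is almost nonnegative, because
  the averages of \<open>w\<^sub>k\<close> and \<open>w\<^sub>l\<close> differ only by those of the bounded function \<open>u\<close> over two balls
  that nearly coincide. Hence no Hoelder estimate, no continuity of \<open>u\<close> at the
  boundary and no compactness argument is needed, and the plane moves by steps of uniform length, starting
  from \<open>l = 0\<close> where nothing has to be shown.
\<close>

section \<open>Measure-preserving maps and radial kernels\<close>

text \<open>Two obstacles shape the argument. The operator is an infimum, and different kernels may
  be nearly optimal at a point and at its mirror image, so \<open>W l\<close> satisfies no linear
  equation. What survives is a one-sided statement: if all kernels give at least B at x, then B is
  at most L |W l x|. Every estimate must therefore exhibit a gain that minorises the integrand for
  all kernels at once; this is the function \<tau>, independent of K, that runs through the lemmas.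
  Second, f is merely Lipschitz and the strip below the plane may be wide, so a negative minimum of
  \<open>W l\<close> is by itself compatible with the equation. The equation yields only
  quantitative facts about such a minimum, and the contradiction comes from the neighbouring plane.
  The infimum may also fail to be attained. A bump of height \<epsilon> m and radius r creates a
  minimum at a cost proportional to \<epsilon> m r^(-2s). Gains from balls of radius comparable to r
  scale in the same way, so \<epsilon> can be chosen independently of r, and small r then beats
  L.\<close>

definition mirror :: "'a::euclidean_space \<Rightarrow> real \<Rightarrow> 'a \<Rightarrow> 'a" where
  "mirror e l y = y + (2 * (l - y \<bullet> e)) *\<^sub>R e"

text \<open>The change of variables formula for diagonal affine maps has as density the product of
  the |c j|, which is 1 here. Reflections, translations and the antipodal map are all of this
  form.\<close>

lemma lebesgue_sign_affine:
  fixes t :: "'a::euclidean_space"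
  assumes "\<And>j. j \<in> Basis \<Longrightarrow> \<bar>c j\<bar> = 1"
    and T: "\<And>x. T x = t + (\<Sum>j\<in>Basis. (c j * (x \<bullet> j)) *\<^sub>R j)"
  shows "T \<in> lebesgue \<rightarrow>\<^sub>M lebesgue" "distr lebesgue lebesgue T = lebesgue"
proof -
  have c: "\<And>j. j \<in> Basis \<Longrightarrow> c j \<noteq> 0" using assms(1) by fastforce
  have T': "T = (\<lambda>x. t + (\<Sum>j\<in>Basis. (c j * (x \<bullet> j)) *\<^sub>R j))" using T by auto
  show "T \<in> lebesgue \<rightarrow>\<^sub>M lebesgue"
    unfolding T' by (rule lebesgue_affine_measurable[OF c])
  have "lebesgue = density (distr lebesgue lebesgue T) (\<lambda>_. (\<Prod>j\<in>Basis. ennreal \<bar>c j\<bar>))"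
    unfolding T' using lebesgue_affine_euclidean[of c t] c
    by (simp add: prod_ennreal)
  also have "(\<Prod>j\<in>Basis. ennreal \<bar>c j\<bar>) = 1"
    using assms(1) by simp
  finally show "distr lebesgue lebesgue T = lebesgue" by (simp add: density_1)
qed

lemma
  fixes f :: "'a::euclidean_space \<Rightarrow> real"
  assumes T: "T \<in> lebesgue \<rightarrow>\<^sub>M lebesgue" "distr lebesgue lebesgue T = lebesgue"
    and f: "f \<in> borel_measurable lebesgue"
  shows integrable_preserving: "integrable lebesgue (\<lambda>x. f (T x)) \<longleftrightarrow> integrable lebesgue f"
    and integral_preserving: "(\<integral>x. f (T x) \<partial>lebesgue) = (\<integral>x. f x \<partial>lebesgue)"
    and measurable_preserving: "(\<lambda>x. f (T x)) \<in> borel_measurable lebesgue"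
  using integrable_distr_eq[OF T(1) f] integral_distr[OF T(1) f] measurable_compose[OF T(1) f]
  unfolding T(2) by auto

lemma euclidean_sum_except:
  fixes x e :: "'a::euclidean_space"
  assumes "e \<in> Basis"
  shows "(\<Sum>j\<in>Basis. ((if j = e then -1 else 1) * (x \<bullet> j)) *\<^sub>R j) = x - (2 * (x \<bullet> e)) *\<^sub>R e"
proof -
  have "(\<Sum>j\<in>Basis. ((if j = e then -1 else 1) * (x \<bullet> j)) *\<^sub>R j)
      = (\<Sum>j\<in>Basis. (x \<bullet> j) *\<^sub>R j - (if j = e then (2 * (x \<bullet> e)) *\<^sub>R e else 0))"
    by (intro sum.cong) (auto simp: algebra_simps simp flip: scaleR_2)
  also have "\<dots> = x - (2 * (x \<bullet> e)) *\<^sub>R e"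
    using assms by (simp add: sum_subtractf euclidean_representation)
  finally show ?thesis .
qed

lemma mirror_preserving:
  assumes "e \<in> Basis"
  shows "mirror e l \<in> lebesgue \<rightarrow>\<^sub>M lebesgue" "distr lebesgue lebesgue (mirror e l) = lebesgue"
proof -
  have *: "mirror e l x = (2 * l) *\<^sub>R e + (\<Sum>j\<in>Basis. ((if j = e then -1 else 1) * (x \<bullet> j)) *\<^sub>R j)" for x
    unfolding euclidean_sum_except[OF assms] mirror_def by (simp add: algebra_simps)
  show "mirror e l \<in> lebesgue \<rightarrow>\<^sub>M lebesgue" "distr lebesgue lebesgue (mirror e l) = lebesgue"
    by (rule lebesgue_sign_affine[OF _ *]; simp)+
qed

lemma translation_preserving:
  fixes t :: "'a::euclidean_space"
  shows "(\<lambda>x. t + x) \<in> lebesgue \<rightarrow>\<^sub>M lebesgue" "distr lebesgue lebesgue (\<lambda>x. t + x) = lebesgue"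
  by (rule lebesgue_sign_affine[of "\<lambda>_. 1" _ t]; simp add: euclidean_representation)+

lemma uminus_preserving:
  "(uminus :: 'a::euclidean_space \<Rightarrow> 'a) \<in> lebesgue \<rightarrow>\<^sub>M lebesgue"
  "distr lebesgue lebesgue (uminus :: 'a::euclidean_space \<Rightarrow> 'a) = lebesgue"
  by (rule lebesgue_sign_affine[of "\<lambda>_. -1" _ 0]; simp add: euclidean_representation sum_negf)+

text \<open>Common majorant, at scale r, of a second order remainder times a kernel: the squared
  factor tames the singularity at 0, and beyond radius r only boundedness of the remainder is
  used.\<close>

definition radial_kernel :: "real \<Rightarrow> real \<Rightarrow> 'a::euclidean_space \<Rightarrow> real" where
  "radial_kernel s r h = (min 1 (norm h / r))\<^sup>2 * norm h powr - (real DIM('a) + 2 * s)"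

lemma radial_kernel_nonneg: "0 \<le> radial_kernel s r h"
  by (simp add: radial_kernel_def)

lemma radial_kernel_measurable [measurable]: "radial_kernel s r \<in> borel_measurable borel"
  unfolding radial_kernel_def by measurable

lemma measure_ball_scale:
  fixes c :: "'a::euclidean_space"
  assumes "r \<ge> 0"
  shows "measure lebesgue (ball c r) = r ^ DIM('a) * measure lebesgue (ball (0::'a) 1)"
  using content_ball_conv_unit_ball[OF assms, of c] by simp

lemma unit_ball_measure_pos: "measure lebesgue (ball (0::'a::euclidean_space) 1) > 0"
  using content_ball_pos[of 1 "0::'a"] by simp

lemma emeasure_lebesgue_ball:
  fixes c :: "'a::euclidean_space"
  shows "emeasure lebesgue (ball c r) = ennreal (measure lebesgue (ball c r))"
  using emeasure_lborel_ball_finite[of c r]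
  by (subst emeasure_eq_ennreal_measure) auto

lemma dyadic_shell:
  fixes t r :: real
  assumes "0 < r" "0 < t"
  shows "(r \<le> t \<longrightarrow> (\<exists>k::nat. r * 2 ^ k \<le> t \<and> t < r * 2 ^ (k + 1))) \<and>
         (t < r \<longrightarrow> (\<exists>k::nat. r / 2 ^ (k + 1) \<le> t \<and> t < r / 2 ^ k))"
proof (intro conjI impI)
  assume "r \<le> t"
  obtain N :: nat where N: "t / r < 2 ^ N" using real_arch_pow[of 2 "t / r"] by auto
  define k where "k = (LEAST k::nat. t < r * 2 ^ k)"
  have ex: "t < r * 2 ^ N" using N assms by (simp add: field_simps)
  have k: "t < r * 2 ^ k" unfolding k_def by (rule LeastI[of _ N]) (rule ex)
  have "k \<noteq> 0" using k \<open>r \<le> t\<close> by (cases k) auto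
  then obtain j where j: "k = Suc j" by (cases k) auto
  have "\<not> t < r * 2 ^ j" using not_less_Least[of j "\<lambda>k. t < r * 2 ^ k"] j k_def by auto
  then show "\<exists>k::nat. r * 2 ^ k \<le> t \<and> t < r * 2 ^ (k + 1)" using k j by (intro exI[of _ j]) auto
next
  assume "t < r"
  obtain N :: nat where N: "r / t < 2 ^ N" using real_arch_pow[of 2 "r / t"] by auto
  define k where "k = (LEAST k::nat. r / 2 ^ k \<le> t)"
  have ex: "r / 2 ^ N \<le> t" using N assms by (simp add: field_simps)
  have k: "r / 2 ^ k \<le> t" unfolding k_def by (rule LeastI[of _ N]) (rule ex)
  have "k \<noteq> 0" using k \<open>t < r\<close> by (cases k) auto
  then obtain j where j: "k = Suc j" by (cases k) auto
  have "\<not> r / 2 ^ j \<le> t" using not_less_Least[of j "\<lambda>k. r / 2 ^ k \<le> t"] j k_def by auto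
  then show "\<exists>k::nat. r / 2 ^ (k + 1) \<le> t \<and> t < r / 2 ^ k" using k j by (intro exI[of _ j]) auto
qed

text \<open>Stands in for polar coordinates: a function dominated by weighted ball indicators has
  its mass controlled by a geometric series.\<close>

lemma nn_integral_ball_series:
  fixes a \<rho> :: "nat \<Rightarrow> real"
  assumes a: "\<And>k. 0 \<le> a k" and \<rho>: "\<And>k. 0 \<le> \<rho> k"
    and q: "0 \<le> q" "q < 1" and eq: "\<And>k. a k * \<rho> k ^ DIM('a) = C * q ^ k" and C: "0 \<le> C"
  shows "(\<integral>\<^sup>+h. (\<Sum>k. ennreal (a k) * indicator (ball (0::'a::euclidean_space) (\<rho> k)) h) \<partial>lebesgue)
    = ennreal (C * measure lebesgue (ball (0::'a) 1) / (1 - q))"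
proof -
  let ?w = "measure lebesgue (ball (0::'a) 1)"
  have "(\<integral>\<^sup>+h. (\<Sum>k. ennreal (a k) * indicator (ball (0::'a) (\<rho> k)) h) \<partial>lebesgue)
      = (\<Sum>k. \<integral>\<^sup>+h. ennreal (a k) * indicator (ball (0::'a) (\<rho> k)) h \<partial>lebesgue)"
    by (intro nn_integral_suminf borel_measurable_times_ennreal borel_measurable_indicator) auto
  also have "\<dots> = (\<Sum>k. ennreal (C * ?w * q ^ k))"
  proof (intro suminf_cong)
    fix k
    have "(\<integral>\<^sup>+h. ennreal (a k) * indicator (ball (0::'a) (\<rho> k)) h \<partial>lebesgue)
        = ennreal (a k) * emeasure lebesgue (ball (0::'a) (\<rho> k))"
      by (simp add: nn_integral_cmult_indicator)
    also have "\<dots> = ennreal (a k * (\<rho> k ^ DIM('a) * ?w))"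
      unfolding emeasure_lebesgue_ball measure_ball_scale[OF \<rho>] by (simp add: ennreal_mult'' \<rho>)
    also have "a k * (\<rho> k ^ DIM('a) * ?w) = C * ?w * q ^ k" using eq[of k] by (simp add: algebra_simps)
    finally show "(\<integral>\<^sup>+h. ennreal (a k) * indicator (ball (0::'a) (\<rho> k)) h \<partial>lebesgue) = ennreal (C * ?w * q ^ k)" .
  qed
  also have "\<dots> = ennreal (\<Sum>k. C * ?w * q ^ k)"
    using C q by (intro suminf_ennreal2) (auto intro!: summable_mult summable_geometric)
  also have "(\<Sum>k. C * ?w * q ^ k) = C * ?w / (1 - q)"
    using q by (simp add: suminf_mult summable_geometric suminf_geometric)
  finally show ?thesis .
qed

text \<open>The dyadic shells outside and inside radius r contribute geometric series with ratios
  2^(-2s) and 2^(2s-2), both less than 1 because 0 < s < 1. Scaling extracts r^(-2s), so S depends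
  only on s and the dimension.\<close>

lemma radial_kernel_integral:
  assumes s: "0 < s" "s < 1"
  obtains S where "S > 0" and
    "\<And>r. 0 < r \<Longrightarrow> integrable lebesgue (radial_kernel s r :: 'a::euclidean_space \<Rightarrow> real)"
    "\<And>r. 0 < r \<Longrightarrow> (\<integral>h. radial_kernel s r (h::'a) \<partial>lebesgue) \<le> S * r powr (- 2 * s)"
proof -
  let ?n = "DIM('a)"
  let ?w = "measure lebesgue (ball (0::'a) 1)"
  define p where "p = real ?n + 2 * s"
  define S where "S = 2 ^ ?n * ?w / (1 - 2 powr (- 2 * s)) + 2 powr p * ?w / (1 - 2 powr (2 * s - 2))"
  have q1: "2 powr (- 2 * s) < 1" "2 powr (2 * s - 2) < 1"
    using s powr_less_mono[of "- 2 * s" 0 "2::real"] powr_less_mono[of "2 * s - 2" 0 "2::real"] by auto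
  have Spos: "S > 0" unfolding S_def using q1 unit_ball_measure_pos[where 'a='a]
    by (intro add_pos_pos divide_pos_pos mult_pos_pos) auto
  have p: "p > 0" using s by (simp add: p_def add_nonneg_pos)
  have two: "(2::real) ^ k = 2 powr real k" for k by (simp add: powr_realpow)
  have pk: "((2::real) powr a) ^ k = 2 powr (a * real k)" for a k
    by (simp add: powr_realpow[symmetric] powr_powr)
  have main: "(\<integral>\<^sup>+h. ennreal (radial_kernel s r (h::'a)) \<partial>lebesgue) \<le> ennreal (S * r powr (- 2 * s))"
    if r: "0 < r" for r
  proof -
    \<comment> \<open>Upper bounds of the kernel on the shells, each paired with the full ball
      containing its shell; the overlap of the balls costs only a constant.\<close>
    define a1 where "a1 k = (r * 2 ^ k) powr - p" for k :: nat
    define \<rho>1 where "\<rho>1 k = r * 2 ^ (k + 1)" for k :: nat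
    define a2 where "a2 k = (1 / 2 ^ k)\<^sup>2 * (r / 2 ^ (k + 1)) powr - p" for k :: nat
    define \<rho>2 where "\<rho>2 k = r / 2 ^ k" for k :: nat
    let ?F1 = "\<lambda>h::'a. (\<Sum>k. ennreal (a1 k) * indicator (ball 0 (\<rho>1 k)) h)"
    let ?F2 = "\<lambda>h::'a. (\<Sum>k. ennreal (a2 k) * indicator (ball 0 (\<rho>2 k)) h)"
    have pw: "ennreal (radial_kernel s r h) \<le> ?F1 h + ?F2 h" for h :: 'a
    proof (cases "h = 0")
      case True
      then show ?thesis by (simp add: radial_kernel_def)
    next
      case False
      then have h: "norm h > 0" by simp
      have trm: "ennreal (a k) * indicator (ball 0 (\<rho> k)) h \<le> (\<Sum>k. ennreal (a k) * indicator (ball 0 (\<rho> k)) h)"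
        for k and a \<rho> :: "nat \<Rightarrow> real"
      proof -
        define F where "F k = ennreal (a k) * indicator (ball 0 (\<rho> k)) h" for k
        have "F k \<le> suminf F" using sum_le_suminf[of F "{k}"] by simp
        then show ?thesis unfolding F_def .
      qed
      show ?thesis
      proof (cases "r \<le> norm h")
        case True
        then obtain k where k: "r * 2 ^ k \<le> norm h" "norm h < r * 2 ^ (k + 1)"
          using dyadic_shell[OF r h] by blast
        have "radial_kernel s r h \<le> a1 k"
          using True r k(1) p h unfolding radial_kernel_def a1_def
          by (simp add: p_def[symmetric] min_def powr_mono2')
        then have "ennreal (radial_kernel s r h) \<le> ennreal (a1 k) * indicator (ball 0 (\<rho>1 k)) h"
          using k(2) by (simp add: \<rho>1_def ennreal_leI)
        then show ?thesis using trm[of a1 k \<rho>1] by (meson add_increasing2 order_trans zero_le)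
      next
        case False
        then obtain k where k: "r / 2 ^ (k + 1) \<le> norm h" "norm h < r / 2 ^ k"
          using dyadic_shell[OF r h] by (meson not_le)
        have "norm h / r \<le> 1 / 2 ^ k" using k(2) r by (simp add: field_simps)
        then have "min 1 (norm h / r) \<le> 1 / 2 ^ k" by simp
        then have "(min 1 (norm h / r))\<^sup>2 \<le> (1 / 2 ^ k)\<^sup>2" using r by (intro power_mono) auto
        moreover have "norm h powr - p \<le> (r / 2 ^ (k + 1)) powr - p"
          using k(1) r p by (intro powr_mono2') auto
        ultimately have "radial_kernel s r h \<le> a2 k"
          unfolding radial_kernel_def a2_def p_def[symmetric] by (intro mult_mono) auto
        then have "ennreal (radial_kernel s r h) \<le> ennreal (a2 k) * indicator (ball 0 (\<rho>2 k)) h"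
          using k(2) by (simp add: \<rho>2_def ennreal_leI)
        then show ?thesis using trm[of a2 k \<rho>2] by (meson add_increasing order_trans zero_le)
      qed
    qed
    have rp: "r ^ ?n = r powr ?n" using r by (simp add: powr_realpow)
    have e1: "a1 k * \<rho>1 k ^ ?n = (r powr (- 2 * s) * 2 ^ ?n) * (2 powr (- 2 * s)) ^ k" for k
    proof -
      have "a1 k * \<rho>1 k ^ ?n = r powr - p * r powr ?n * (2 powr (- p * k) * 2 powr ((k + 1) * real ?n))"
        unfolding a1_def \<rho>1_def power_mult_distrib rp two using r
        by (simp add: powr_mult powr_powr powr_power algebra_simps)
      also have "\<dots> = r powr (- p + ?n) * 2 powr (- p * k + (k + 1) * real ?n)"
        by (simp only: powr_add)
      also have "- p * k + (k + 1) * real ?n = real ?n + (- 2 * s) * k" by (simp add: p_def algebra_simps)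
      also have "- p + ?n = - 2 * s" by (simp add: p_def)
      also have "2 powr (real ?n + (- 2 * s) * k) = 2 ^ ?n * (2 powr (- 2 * s)) ^ k"
        by (simp only: powr_add two pk)
      finally show ?thesis by simp
    qed
    have e2: "a2 k * \<rho>2 k ^ ?n = (r powr (- 2 * s) * 2 powr p) * (2 powr (2 * s - 2)) ^ k" for k
    proof -
      have "a2 k * \<rho>2 k ^ ?n = 2 powr (- 2 * real k) * (r powr - p * 2 powr (p * (k + 1))) * (r powr ?n * 2 powr (- real k * ?n))"
        unfolding a2_def \<rho>2_def power_divide rp two using r
        by (simp add: powr_divide powr_powr powr_power algebra_simps powr_minus_divide)
      also have "\<dots> = r powr (- p + ?n) * 2 powr (- 2 * real k + p * (k + 1) + - real k * ?n)"
        by (simp only: powr_add mult.assoc mult.left_commute)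
      also have "- 2 * real k + p * (k + 1) + - real k * ?n = p + (2 * s - 2) * k" by (simp add: p_def algebra_simps)
      also have "- p + ?n = - 2 * s" by (simp add: p_def)
      also have "2 powr (p + (2 * s - 2) * k) = 2 powr p * (2 powr (2 * s - 2)) ^ k"
        by (simp only: powr_add pk)
      finally show ?thesis by simp
    qed
    have "(\<integral>\<^sup>+h. ennreal (radial_kernel s r (h::'a)) \<partial>lebesgue) \<le> (\<integral>\<^sup>+h. ?F1 h + ?F2 h \<partial>lebesgue)"
      by (intro nn_integral_mono pw)
    also have "\<dots> = (\<integral>\<^sup>+h. ?F1 h \<partial>lebesgue) + (\<integral>\<^sup>+h. ?F2 h \<partial>lebesgue)"
      by (intro nn_integral_add borel_measurable_suminf_order borel_measurable_times_ennreal borel_measurable_indicator) auto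
    also have "(\<integral>\<^sup>+h. ?F1 h \<partial>lebesgue) = ennreal ((r powr (- 2 * s) * 2 ^ ?n) * ?w / (1 - 2 powr (- 2 * s)))"
      by (rule nn_integral_ball_series[OF _ _ _ _ e1]) (use r q1 in \<open>auto simp: a1_def \<rho>1_def\<close>)
    also have "(\<integral>\<^sup>+h. ?F2 h \<partial>lebesgue) = ennreal ((r powr (- 2 * s) * 2 powr p) * ?w / (1 - 2 powr (2 * s - 2)))"
      by (rule nn_integral_ball_series[OF _ _ _ _ e2]) (use r q1 in \<open>auto simp: a2_def \<rho>2_def\<close>)
    also have "ennreal ((r powr (- 2 * s) * 2 ^ ?n) * ?w / (1 - 2 powr (- 2 * s))) +
        ennreal ((r powr (- 2 * s) * 2 powr p) * ?w / (1 - 2 powr (2 * s - 2))) = ennreal (S * r powr (- 2 * s))"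
      using q1 by (subst ennreal_plus[symmetric]) (auto simp: S_def algebra_simps)
    finally show ?thesis .
  qed
  have meas: "(radial_kernel s r :: 'a \<Rightarrow> real) \<in> borel_measurable lebesgue" for r
    by (rule measurable_completion) (simp add: radial_kernel_measurable)
  show ?thesis
  proof (rule that[OF Spos])
    fix r :: real assume r: "0 < r"
    show int: "integrable lebesgue (radial_kernel s r :: 'a \<Rightarrow> real)"
      using main[OF r] by (intro integrableI_nonneg meas) (auto simp: radial_kernel_nonneg intro: le_less_trans)
    have "ennreal (\<integral>h. radial_kernel s r (h::'a) \<partial>lebesgue) \<le> ennreal (S * r powr (- 2 * s))"
      using main[OF r] nn_integral_eq_integral[OF int] by (simp add: radial_kernel_nonneg)
    then show "(\<integral>h. radial_kernel s r (h::'a) \<partial>lebesgue) \<le> S * r powr (- 2 * s)"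
      using Spos by (simp add: ennreal_le_iff)
  qed
qed

section \<open>Second order remainders and principal values\<close>

definition remainder :: "('a::euclidean_space \<Rightarrow> real) \<Rightarrow> 'a \<Rightarrow> 'a \<Rightarrow> real \<Rightarrow> 'a \<Rightarrow> real" where
  "remainder w x g r h = w (x + h) - w x - (if norm h < r then g \<bullet> h else 0)"

text \<open>A second order expansion at the single point \<open>x\<close> plus global boundedness.
  Away from \<open>x\<close> the function may jump, as \<open>u\<close> may on the boundary of the
  half-space.\<close>

definition regular_at :: "('a::euclidean_space \<Rightarrow> real) \<Rightarrow> 'a \<Rightarrow> 'a \<Rightarrow> bool" where
  "regular_at w x g \<longleftrightarrow> w \<in> borel_measurable lebesgue \<and> (\<exists>M. \<forall>y. \<bar>w y\<bar> \<le> M) \<and>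
     (\<exists>r>0. \<exists>C. \<forall>h. norm h < r \<longrightarrow> \<bar>w (x + h) - w x - g \<bullet> h\<bar> \<le> C * (norm h)\<^sup>2)"

text \<open>
  The cut-off gradient term makes the integral absolutely convergent; since kernels are even, it does not
  contribute to the principal value (see \<open>principal_value_lap\<close>).
\<close>

definition lap :: "('a::euclidean_space \<Rightarrow> real) \<Rightarrow> ('a \<Rightarrow> real) \<Rightarrow> 'a \<Rightarrow> 'a \<Rightarrow> real" where
  "lap K w x g = (\<integral>h. remainder w x g 1 h * K h \<partial>lebesgue)"

lemma regular_at_measurable: "regular_at w x g \<Longrightarrow> w \<in> borel_measurable lebesgue"
  by (simp add: regular_at_def)

lemma measurable_translation:
  fixes w :: "'a::euclidean_space \<Rightarrow> real"
  shows "w \<in> borel_measurable lebesgue \<Longrightarrow> (\<lambda>h. w (x + h)) \<in> borel_measurable lebesgue"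
  using measurable_preserving[OF translation_preserving] .

lemma borel_lebesgue_measurable:
  fixes w :: "'a::euclidean_space \<Rightarrow> real"
  shows "w \<in> borel_measurable borel \<Longrightarrow> w \<in> borel_measurable lebesgue"
  by (rule measurable_completion) simp

lemma remainder_measurable:
  assumes "regular_at w x g"
  shows "remainder w x g r \<in> borel_measurable lebesgue"
proof -
  have [measurable]: "(\<lambda>h. w (x + h)) \<in> borel_measurable lebesgue"
    by (rule measurable_translation[OF regular_at_measurable[OF assms]])
  have [measurable]: "(\<lambda>h. if norm h < r then g \<bullet> h else 0) \<in> borel_measurable lebesgue"
    by (rule borel_lebesgue_measurable) measurable
  show ?thesis unfolding remainder_def[abs_def] by measurable
qed

lemma remainder_bound:
  fixes w :: "'a::euclidean_space \<Rightarrow> real"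
  assumes "regular_at w x g" "0 < r"
  obtains C :: real where "C \<ge> 0" "\<And>h::'a. \<bar>remainder w x g r h\<bar> \<le> C * (min 1 (norm h / r))\<^sup>2"
proof -
  from assms obtain M r0 C0 where M: "\<And>y. \<bar>w y\<bar> \<le> M" and r0: "r0 > 0"
    and C0: "\<And>h. norm h < r0 \<Longrightarrow> \<bar>w (x + h) - w x - g \<bullet> h\<bar> \<le> C0 * (norm h)\<^sup>2"
    unfolding regular_at_def by auto
  have M0: "M \<ge> 0" using M[of x] by linarith
  \<comment> \<open>The first summand serves where the expansion is available. The second combines
    the crude bound with the factor 1 for \<open>norm h >= r\<close> and with
    \<open>(r / r0)^2\<close> for the intermediate range between r0 and r.\<close>
  define C where "C = \<bar>C0\<bar> * r\<^sup>2 + (2 * M + norm g * r) * (1 + (r / r0)\<^sup>2)"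
  have Cnn: "C \<ge> 0" using M0 assms(2) by (simp add: C_def)
  have bd: "\<bar>w (x + h) - w x\<bar> \<le> 2 * M" for h
    using M[of "x + h"] M[of x] by linarith
  show ?thesis
  proof (rule that[OF Cnn])
    fix h :: 'a
    let ?B = "2 * M + norm g * r"
    have B0: "?B \<ge> 0" using M0 assms(2) by simp
    consider "norm h \<ge> r" | "norm h < r" "norm h < r0" | "norm h < r" "norm h \<ge> r0" by linarith
    then show "\<bar>remainder w x g r h\<bar> \<le> C * (min 1 (norm h / r))\<^sup>2"
    proof cases
      case 1
      then have "\<bar>remainder w x g r h\<bar> \<le> 2 * M" using bd[of h] by (simp add: remainder_def)
      also have "\<dots> \<le> ?B * 1" using assms(2) by simp
      also have "\<dots> \<le> ?B * (1 + (r / r0)\<^sup>2)" using B0 by (intro mult_left_mono) auto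
      also have "\<dots> \<le> C" by (simp add: C_def)
      finally show ?thesis using 1 assms(2) by (simp add: min_def)
    next
      case 2
      have "\<bar>remainder w x g r h\<bar> \<le> C0 * (norm h)\<^sup>2" using C0[OF 2(2)] 2 by (simp add: remainder_def)
      also have "\<dots> \<le> \<bar>C0\<bar> * (norm h)\<^sup>2" by (intro mult_right_mono) auto
      also have "\<dots> = (\<bar>C0\<bar> * r\<^sup>2) * (norm h / r)\<^sup>2" using assms(2) by (simp add: field_simps power2_eq_square)
      also have "\<dots> \<le> C * (norm h / r)\<^sup>2" unfolding C_def using B0 by (intro mult_right_mono) auto
      finally show ?thesis using 2 assms(2) by (simp add: min_def)
    next
      case 3
      have "\<bar>g \<bullet> h\<bar> \<le> norm g * r"
        using Cauchy_Schwarz_ineq2[of g h] 3 by (meson mult_left_mono norm_ge_zero order_trans less_imp_le)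
      then have "\<bar>remainder w x g r h\<bar> \<le> ?B" using bd[of h] 3 by (simp add: remainder_def)
      also have "\<dots> \<le> ?B * (r / r0)\<^sup>2 * (norm h / r)\<^sup>2"
      proof -
        have "1 \<le> (norm h / r0)\<^sup>2" using 3 r0 by (simp add: power2_eq_square mult_mono' field_simps)
        also have "(norm h / r0)\<^sup>2 = (r / r0)\<^sup>2 * (norm h / r)\<^sup>2" using assms(2) by (simp add: field_simps power2_eq_square)
        finally have "?B * 1 \<le> ?B * ((r / r0)\<^sup>2 * (norm h / r)\<^sup>2)" by (rule mult_left_mono[OF _ B0])
        then show ?thesis by (simp only: mult.assoc mult_1_right)
      qed
      also have "\<dots> \<le> C * (norm h / r)\<^sup>2"
      proof (intro mult_right_mono)
        show "?B * (r / r0)\<^sup>2 \<le> C" using B0 unfolding C_def by (simp add: ring_distribs)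
      qed auto
      finally show ?thesis using 3 assms(2) by (simp add: min_def)
    qed
  qed
qed

text \<open>Touching from one side suffices: along h = - t (g - v) the two linear parts differ by t
  |g - v|^2, whereas the quadratic terms are of order t^2. At each contact point this identifies the
  gradient of the solution with that of the test function.\<close>

lemma regular_at_gradient_unique:
  fixes w :: "'a::euclidean_space \<Rightarrow> real"
  assumes "regular_at w x g" "0 < r" "\<And>h. norm h < r \<Longrightarrow> v \<bullet> h - C * (norm h)\<^sup>2 \<le> w (x + h) - w x"
  shows "g = v"
proof (rule ccontr)
  assume "g \<noteq> v"
  define d where "d = g - v"
  have d: "norm d > 0" using \<open>g \<noteq> v\<close> by (simp add: d_def)
  from assms(1) obtain r0 C0 where r0: "r0 > 0"
    and C0: "\<And>h. norm h < r0 \<Longrightarrow> \<bar>w (x + h) - w x - g \<bullet> h\<bar> \<le> C0 * (norm h)\<^sup>2"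
    unfolding regular_at_def by auto
  define D where "D = \<bar>C0\<bar> + \<bar>C\<bar> + 1"
  \<comment> \<open>The first entry stays inside both neighbourhoods; the second gives D t <= 1/2,
    against the inequality 1 <= D t derived below.\<close>
  define t where "t = min (min r r0 / (2 * norm d)) (1 / (2 * D))"
  have D: "D > 0" by (simp add: D_def add_nonneg_pos)
  have t: "t > 0" using assms(2) r0 d D by (simp add: t_def)
  have "t * norm d \<le> min r r0 / 2"
    using d by (simp add: t_def min_def field_simps split: if_splits)
  then have nt: "norm (- t *\<^sub>R d) < r" "norm (- t *\<^sub>R d) < r0" using t assms(2) r0 by auto
  have "v \<bullet> (- t *\<^sub>R d) - C * (norm (- t *\<^sub>R d))\<^sup>2 \<le> g \<bullet> (- t *\<^sub>R d) + C0 * (norm (- t *\<^sub>R d))\<^sup>2"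
    using assms(3)[OF nt(1)] C0[OF nt(2)] by linarith
  moreover have "v \<bullet> (- t *\<^sub>R d) = g \<bullet> (- t *\<^sub>R d) + t * (d \<bullet> d)"
    by (simp add: d_def inner_diff_left inner_diff_right algebra_simps)
  moreover have "norm (- t *\<^sub>R d) = t * norm d" using t by simp
  ultimately have "t * (d \<bullet> d) \<le> (C0 + C) * (t * norm d)\<^sup>2"
    by (simp only: ring_distribs)
  also have "\<dots> \<le> D * (t * norm d)\<^sup>2" by (intro mult_right_mono) (auto simp: D_def)
  also have "\<dots> = (D * t) * (t * (d \<bullet> d))" by (simp add: power2_eq_square power2_norm_eq_inner[symmetric])
  finally have "1 \<le> D * t" using t d by (simp add: power2_norm_eq_inner[symmetric])
  moreover have "D * t \<le> 1 / 2" using D by (simp add: t_def min_def field_simps split: if_splits)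
  ultimately show False by simp
qed

section \<open>The kernel class and estimates uniform over it\<close>

locale kernel_setting =
  fixes e :: "'a::euclidean_space" and \<theta> \<Theta> s :: real
  assumes e_Basis: "e \<in> Basis" and \<theta>_pos: "0 < \<theta>" and \<theta>_le: "\<theta> \<le> \<Theta>" and s_pos: "0 < s" and s_less: "s < 1"
begin

definition p :: real where "p = real DIM('a) + 2 * s"

text \<open>
  The last clause of \<open>kern\<close> comes from the identity
  $|A^{-1}(h + c e)|^2 = |A^{-1}h|^2 + ((h \cdot e + c)^2 - (h \cdot e)^2)/a^2$, valid when $A e = a e$.
\<close>

definition kern :: "('a \<Rightarrow> real) \<Rightarrow> bool" where
  "kern K \<longleftrightarrow> K \<in> borel_measurable borel \<and>
    (\<forall>h. \<theta> powr p * norm h powr - p \<le> K h \<and> K h \<le> \<Theta> powr p * norm h powr - p) \<and>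
    (\<forall>h. K (- h) = K h) \<and> (\<forall>h. K (mirror e 0 h) = K h) \<and>
    (\<forall>h c. h \<noteq> 0 \<longrightarrow> (h \<bullet> e)\<^sup>2 \<le> (h \<bullet> e + c)\<^sup>2 \<longrightarrow>
       K (h + c *\<^sub>R e) \<le> (1 + (\<theta> / \<Theta>)\<^sup>2 * (((h \<bullet> e + c)\<^sup>2 - (h \<bullet> e)\<^sup>2) / (norm h)\<^sup>2)) powr (- p / 2) * K h)"

text \<open>Fixed once by choice, with the factor \<open>\<Theta> powr p\<close> absorbed, so that
  the same constant serves every member of \<open>kern\<close> and every radius.\<close>

definition tail_bound :: real where
  "tail_bound = (SOME S. S > 0 \<and> (\<forall>r>0. integrable lebesgue (radial_kernel s r :: 'a \<Rightarrow> real) \<and>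
     \<Theta> powr p * (\<integral>h. radial_kernel s r (h::'a) \<partial>lebesgue) \<le> S * r powr (- 2 * s)))"

lemma \<Theta>_pos: "0 < \<Theta>" using \<theta>_pos \<theta>_le by simp

lemma p_pos: "0 < p" using s_pos by (simp add: p_def add_nonneg_pos)

lemma tail_bound: "tail_bound > 0" "\<And>r. r > 0 \<Longrightarrow> integrable lebesgue (radial_kernel s r :: 'a \<Rightarrow> real)"
  "\<And>r. r > 0 \<Longrightarrow> \<Theta> powr p * (\<integral>h. radial_kernel s r (h::'a) \<partial>lebesgue) \<le> tail_bound * r powr (- 2 * s)"
proof -
  obtain S where S: "S > 0" "\<And>r. 0 < r \<Longrightarrow> integrable lebesgue (radial_kernel s r :: 'a \<Rightarrow> real)"
    "\<And>r. 0 < r \<Longrightarrow> (\<integral>h. radial_kernel s r (h::'a) \<partial>lebesgue) \<le> S * r powr (- 2 * s)"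
    using radial_kernel_integral[OF s_pos s_less] by metis
  define P where "P S \<longleftrightarrow> S > 0 \<and> (\<forall>r>0. integrable lebesgue (radial_kernel s r :: 'a \<Rightarrow> real) \<and>
     \<Theta> powr p * (\<integral>h. radial_kernel s r (h::'a) \<partial>lebesgue) \<le> S * r powr (- 2 * s))" for S
  have "P (\<Theta> powr p * S)"
    using S \<Theta>_pos by (auto simp: P_def mult.assoc intro: mult_left_mono)
  then have "P (SOME S. P S)" by (rule someI)
  moreover have "tail_bound = (SOME S. P S)" unfolding tail_bound_def P_def ..
  ultimately have "P tail_bound" by simp
  then show "tail_bound > 0" "\<And>r. r > 0 \<Longrightarrow> integrable lebesgue (radial_kernel s r :: 'a \<Rightarrow> real)"
    "\<And>r. r > 0 \<Longrightarrow> \<Theta> powr p * (\<integral>h. radial_kernel s r (h::'a) \<partial>lebesgue) \<le> tail_bound * r powr (- 2 * s)"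
    by (simp_all add: P_def)
qed

lemma kern_measurable: "kern K \<Longrightarrow> K \<in> borel_measurable lebesgue"
  by (rule borel_lebesgue_measurable) (simp add: kern_def)

lemma kern_lower: "kern K \<Longrightarrow> \<theta> powr p * norm h powr - p \<le> K h"
  and kern_upper: "kern K \<Longrightarrow> K h \<le> \<Theta> powr p * norm h powr - p"
  and kern_uminus: "kern K \<Longrightarrow> K (- h) = K h"
  and kern_mirror0: "kern K \<Longrightarrow> K (mirror e 0 h) = K h"
  by (simp_all add: kern_def)

lemma kern_nonneg:
  assumes "kern K"
  shows "0 \<le> K h"
proof -
  have "0 \<le> \<theta> powr p * norm h powr - p" by simp
  also have "\<dots> \<le> K h" by (rule kern_lower[OF assms])
  finally show ?thesis .
qed

text \<open>The origin is excluded because \<open>0 powr - p\<close> is 0: the two-sided bound in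
  \<open>kern\<close> forces every kernel to vanish there.\<close>

lemma kern_lower_ball:
  assumes "kern K" "h \<noteq> 0" "norm h \<le> R"
  shows "\<theta> powr p * R powr - p \<le> K h"
proof -
  have "R powr - p \<le> norm h powr - p"
    using assms p_pos by (intro powr_mono2') auto
  then have "\<theta> powr p * R powr - p \<le> \<theta> powr p * norm h powr - p"
    by (intro mult_left_mono) auto
  also have "\<dots> \<le> K h" by (rule kern_lower[OF assms(1)])
  finally show ?thesis .
qed

lemma weighted_bound:
  assumes "kern K" "0 < r" "\<bar>F h\<bar> \<le> C * (min 1 (norm h / r))\<^sup>2"
  shows "\<bar>F h * K h\<bar> \<le> C * \<Theta> powr p * radial_kernel s r h"
proof -
  have "\<bar>F h * K h\<bar> = \<bar>F h\<bar> * K h" using kern_nonneg[OF assms(1)] by (simp add: abs_mult)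
  also have "\<dots> \<le> (C * (min 1 (norm h / r))\<^sup>2) * (\<Theta> powr p * norm h powr - p)"
    by (intro mult_mono assms(3) kern_upper[OF assms(1)] kern_nonneg[OF assms(1)] order_trans[OF abs_ge_zero assms(3)])
  also have "\<dots> = C * \<Theta> powr p * radial_kernel s r h" by (simp add: radial_kernel_def p_def)
  finally show ?thesis .
qed

lemma weighted_integrable:
  assumes K: "kern K" and r: "0 < r" and F: "F \<in> borel_measurable lebesgue"
    and bd: "\<And>h. \<bar>F h\<bar> \<le> C * (min 1 (norm h / r))\<^sup>2"
  shows "integrable lebesgue (\<lambda>h. F h * K h)"
    and "\<bar>\<integral>h. F h * K h \<partial>lebesgue\<bar> \<le> C * tail_bound * r powr (- 2 * s)"
proof -
  have I: "integrable lebesgue (\<lambda>h::'a. C * \<Theta> powr p * radial_kernel s r h)"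
    using tail_bound(2)[OF r] by simp
  show int: "integrable lebesgue (\<lambda>h. F h * K h)"
  proof (rule Bochner_Integration.integrable_bound[OF I])
    show "(\<lambda>h. F h * K h) \<in> borel_measurable lebesgue" using F kern_measurable[OF K] by measurable
    show "AE h in lebesgue. norm (F h * K h) \<le> norm (C * \<Theta> powr p * radial_kernel s r h)"
    proof (rule AE_I2)
      fix h
      show "norm (F h * K h) \<le> norm (C * \<Theta> powr p * radial_kernel s r h)"
        unfolding real_norm_def by (rule order_trans[OF weighted_bound[where F = F, OF K r bd] abs_ge_self])
    qed
  qed
  \<comment> \<open>Testing \<open>bd\<close> at a vector of length r shows that C is
    nonnegative.\<close>
  obtain x :: 'a where x: "norm x = r" using r vector_choose_size[of r] by auto
  have "0 \<le> C" using bd[of x] r x by (simp add: min_def)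
  have "\<bar>\<integral>h. F h * K h \<partial>lebesgue\<bar> \<le> (\<integral>h. \<bar>F h * K h\<bar> \<partial>lebesgue)"
    using integral_norm_bound[of lebesgue "\<lambda>h. F h * K h"] by simp
  also have "\<dots> \<le> (\<integral>h. C * \<Theta> powr p * radial_kernel s r (h::'a) \<partial>lebesgue)"
    using int I by (intro integral_mono weighted_bound[where F = F, OF K r bd]) auto
  also have "\<dots> = C * (\<Theta> powr p * (\<integral>h. radial_kernel s r (h::'a) \<partial>lebesgue))" by simp
  also have "\<dots> \<le> C * (tail_bound * r powr (- 2 * s))"
    using tail_bound(3)[OF r] \<open>0 \<le> C\<close> by (rule mult_left_mono)
  finally show "\<bar>\<integral>h. F h * K h \<partial>lebesgue\<bar> \<le> C * tail_bound * r powr (- 2 * s)" by simp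
qed

lemma remainder_integrable:
  assumes "kern K" "regular_at w x g" "0 < r"
  shows "integrable lebesgue (\<lambda>h. remainder w x g r h * K h)"
proof -
  obtain C where C: "\<And>h. \<bar>remainder w x g r h\<bar> \<le> C * (min 1 (norm h / r))\<^sup>2"
    using remainder_bound[OF assms(2,3)] by blast
  show ?thesis
    by (rule weighted_integrable(1)[OF assms(1,3) remainder_measurable[OF assms(2)] C])
qed

text \<open>One constant for all kernels: this later makes the family under the real infimum bounded
  below.\<close>

lemma lap_bounded:
  assumes "regular_at w x g"
  obtains C where "\<And>K. kern K \<Longrightarrow> \<bar>lap K w x g\<bar> \<le> C"
proof -
  obtain C where C: "\<And>h. \<bar>remainder w x g 1 h\<bar> \<le> C * (min 1 (norm h / 1))\<^sup>2"
    using remainder_bound[OF assms zero_less_one] by blast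
  show ?thesis
    by (rule that) (unfold lap_def, rule weighted_integrable(2)[OF _ zero_less_one remainder_measurable[OF assms] C])
qed

lemma odd_integral_zero:
  fixes F :: "'a \<Rightarrow> real"
  assumes F: "F \<in> borel_measurable lebesgue" and odd: "\<And>h. F (- h) = - F h"
  shows "(\<integral>h. F h \<partial>lebesgue) = 0"
proof -
  have "(\<integral>h. F h \<partial>lebesgue) = (\<integral>h. F (- h) \<partial>lebesgue)"
    using integral_preserving[OF uminus_preserving F] by simp
  then show ?thesis by (simp add: odd)
qed

lemma annulus_integrable:
  assumes K: "kern K" and r: "0 < r1"
  shows "integrable lebesgue (\<lambda>h. (if r1 \<le> norm h \<and> norm h < r2 then g \<bullet> h else 0) * K h)"
    and "(\<integral>h. (if r1 \<le> norm h \<and> norm h < r2 then g \<bullet> h else 0) * K h \<partial>lebesgue) = 0"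
proof -
  have F: "(\<lambda>h. if r1 \<le> norm h \<and> norm h < r2 then g \<bullet> h else 0) \<in> borel_measurable lebesgue"
    by (rule borel_lebesgue_measurable) measurable
  show "integrable lebesgue (\<lambda>h. (if r1 \<le> norm h \<and> norm h < r2 then g \<bullet> h else 0) * K h)"
  proof (rule weighted_integrable(1)[OF K r F])
    fix h
    have "\<bar>g \<bullet> h\<bar> \<le> norm g * r2" if "norm h < r2"
      using Cauchy_Schwarz_ineq2[of g h] mult_left_mono[of "norm h" r2 "norm g"] that by simp
    then show "\<bar>if r1 \<le> norm h \<and> norm h < r2 then g \<bullet> h else 0\<bar> \<le> (norm g * \<bar>r2\<bar>) * (min 1 (norm h / r1))\<^sup>2"
      using r by (auto simp: min_def)
  qed
  show "(\<integral>h. (if r1 \<le> norm h \<and> norm h < r2 then g \<bullet> h else 0) * K h \<partial>lebesgue) = 0"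
    by (rule odd_integral_zero) (use F kern_measurable[OF K] in \<open>auto simp: kern_uminus[OF K]\<close>)
qed

text \<open>Changing the cut-off radius alters the integrand by the odd function (g . h) K h on an
  annulus, which integrates to 0. Each estimate can therefore work at its own scale r.\<close>

lemma lap_eq:
  assumes K: "kern K" and w: "regular_at w x g" and r: "0 < r"
  shows "lap K w x g = (\<integral>h. remainder w x g r h * K h \<partial>lebesgue)"
proof -
  have gen: "(\<integral>h. remainder w x g r1 h * K h \<partial>lebesgue) = (\<integral>h. remainder w x g r2 h * K h \<partial>lebesgue)"
    if "0 < r1" "r1 \<le> r2" for r1 r2
  proof -
    have "(\<integral>h. remainder w x g r1 h * K h \<partial>lebesgue)
        = (\<integral>h. remainder w x g r2 h * K h + (if r1 \<le> norm h \<and> norm h < r2 then g \<bullet> h else 0) * K h \<partial>lebesgue)"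
      using that by (intro Bochner_Integration.integral_cong) (auto simp: remainder_def algebra_simps)
    also have "\<dots> = (\<integral>h. remainder w x g r2 h * K h \<partial>lebesgue)"
      using that by (subst Bochner_Integration.integral_add)
        (auto intro!: remainder_integrable[OF K w] annulus_integrable(1)[OF K] simp: annulus_integrable(2)[OF K])
    finally show ?thesis .
  qed
  show ?thesis
  proof (cases "1 \<le> r")
    case True
    then show ?thesis unfolding lap_def by (rule gen[OF zero_less_one])
  next
    case False
    then show ?thesis unfolding lap_def by (intro gen[OF r, symmetric]) simp
  qed
qed

lemma lap_diff:
  assumes K: "kern K" and "regular_at w1 x g1" "regular_at w2 x g2"
  shows "lap K (\<lambda>y. w1 y - w2 y) x (g1 - g2) = lap K w1 x g1 - lap K w2 x g2"
proof -
  have "lap K w1 x g1 - lap K w2 x g2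
      = (\<integral>h. remainder w1 x g1 1 h * K h - remainder w2 x g2 1 h * K h \<partial>lebesgue)"
    unfolding lap_def
    by (rule Bochner_Integration.integral_diff[symmetric]; rule remainder_integrable[OF K]; fact zero_less_one assms)
  also have "\<dots> = lap K (\<lambda>y. w1 y - w2 y) x (g1 - g2)"
    unfolding lap_def by (intro Bochner_Integration.integral_cong) (auto simp: remainder_def algebra_simps inner_diff_left)
  finally show ?thesis by simp
qed

lemma regular_at_diff:
  assumes "regular_at w1 x g1" "regular_at w2 x g2"
  shows "regular_at (\<lambda>y. w1 y - w2 y) x (g1 - g2)"
proof -
  from assms(1) obtain M1 r1 C1 where 1: "w1 \<in> borel_measurable lebesgue" "\<And>y. \<bar>w1 y\<bar> \<le> M1" "r1 > 0"
    "\<And>h. norm h < r1 \<Longrightarrow> \<bar>w1 (x + h) - w1 x - g1 \<bullet> h\<bar> \<le> C1 * (norm h)\<^sup>2"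
    unfolding regular_at_def by auto
  from assms(2) obtain M2 r2 C2 where 2: "w2 \<in> borel_measurable lebesgue" "\<And>y. \<bar>w2 y\<bar> \<le> M2" "r2 > 0"
    "\<And>h. norm h < r2 \<Longrightarrow> \<bar>w2 (x + h) - w2 x - g2 \<bullet> h\<bar> \<le> C2 * (norm h)\<^sup>2"
    unfolding regular_at_def by auto
  have "\<bar>w1 y - w2 y\<bar> \<le> M1 + M2" for y using 1(2)[of y] 2(2)[of y] by linarith
  moreover have "\<bar>w1 (x + h) - w2 (x + h) - (w1 x - w2 x) - (g1 - g2) \<bullet> h\<bar> \<le> (C1 + C2) * (norm h)\<^sup>2"
    if "norm h < min r1 r2" for h
  proof -
    have "\<bar>w1 (x + h) - w1 x - g1 \<bullet> h\<bar> \<le> C1 * (norm h)\<^sup>2" "\<bar>w2 (x + h) - w2 x - g2 \<bullet> h\<bar> \<le> C2 * (norm h)\<^sup>2"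
      using 1(4) 2(4) that by auto
    then show ?thesis unfolding inner_diff_left ring_distribs by linarith
  qed
  moreover have "(\<lambda>y. w1 y - w2 y) \<in> borel_measurable lebesgue" using 1(1) 2(1) by measurable
  moreover have "0 < min r1 r2" using 1(3) 2(3) by simp
  ultimately show ?thesis unfolding regular_at_def by blast
qed

section \<open>Reflections and the loss of a kernel under them\<close>

lemma mirror_simps:
  fixes x y g h :: 'a
  shows mirror_mirror: "mirror e l (mirror e l y) = y"
    and mirror_inner: "mirror e l y \<bullet> e = 2 * l - y \<bullet> e"
    and mirror_add: "mirror e l (x + h) = mirror e l x + mirror e 0 h"
    and norm_mirror0: "norm (mirror e 0 h) = norm h"
    and mirror0_inner: "mirror e 0 g \<bullet> h = g \<bullet> mirror e 0 h"
proof -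
  have ee: "e \<bullet> e = 1" using e_Basis by (simp add: inner_Basis)
  have m: "mirror e l y \<bullet> e = 2 * l - y \<bullet> e" for y l
    by (simp add: mirror_def inner_add_left ee)
  then show "mirror e l y \<bullet> e = 2 * l - y \<bullet> e" .
  show "mirror e l (mirror e l y) = y"
    unfolding mirror_def[of e l "mirror e l y"] m by (simp add: mirror_def algebra_simps)
  show "mirror e l (x + h) = mirror e l x + mirror e 0 h"
    by (simp add: mirror_def inner_add_left algebra_simps)
  show "mirror e 0 g \<bullet> h = g \<bullet> mirror e 0 h"
    by (simp add: mirror_def inner_diff_left inner_diff_right inner_commute[of e h])
  have "mirror e 0 h \<bullet> mirror e 0 h = h \<bullet> h"
    by (simp add: mirror_def inner_diff_left inner_diff_right inner_commute[of e h] ee)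
  then show "norm (mirror e 0 h) = norm h"
    unfolding norm_eq_sqrt_inner by simp
qed

lemma remainder_mirror:
  "remainder (\<lambda>y. w (mirror e l y)) x (mirror e 0 g) r h = remainder w (mirror e l x) g r (mirror e 0 h)"
  unfolding remainder_def mirror_add norm_mirror0 mirror0_inner ..

lemma regular_at_mirror:
  assumes "regular_at w (mirror e l x) g"
  shows "regular_at (\<lambda>y. w (mirror e l y)) x (mirror e 0 g)"
proof -
  have "(\<lambda>y. w (mirror e l y)) \<in> borel_measurable lebesgue"
    by (rule measurable_preserving[OF mirror_preserving[OF e_Basis]]) (rule regular_at_measurable[OF assms])
  moreover have "\<exists>r>0. \<exists>C. \<forall>h. norm h < r \<longrightarrow> \<bar>w (mirror e l (x + h)) - w (mirror e l x) - mirror e 0 g \<bullet> h\<bar> \<le> C * (norm h)\<^sup>2"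
    using assms unfolding regular_at_def mirror_add mirror0_inner by (metis norm_mirror0)
  moreover have "\<exists>M. \<forall>y. \<bar>w (mirror e l y)\<bar> \<le> M" using assms unfolding regular_at_def by blast
  ultimately show ?thesis unfolding regular_at_def by blast
qed

text \<open>Holds because a kernel does not change when the \<open>e\<close> component of its
  argument is reversed, so that reflecting the function and reflecting the increment
  compensate.\<close>

lemma lap_mirror:
  assumes K: "kern K" and w: "regular_at w (mirror e l x) g"
  shows "lap K (\<lambda>y. w (mirror e l y)) x (mirror e 0 g) = lap K w (mirror e l x) g"
proof -
  have "lap K (\<lambda>y. w (mirror e l y)) x (mirror e 0 g)
     = (\<integral>h. remainder w (mirror e l x) g 1 (mirror e 0 h) * K (mirror e 0 h) \<partial>lebesgue)"
    unfolding lap_def remainder_mirror kern_mirror0[OF K] ..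
  also have "\<dots> = lap K w (mirror e l x) g"
    unfolding lap_def
    by (rule integral_preserving[OF mirror_preserving[OF e_Basis], where f = "\<lambda>h. remainder w (mirror e l x) g 1 h * K h"])
       (use remainder_measurable[OF w] kern_measurable[OF K] in measurable)
  finally show ?thesis .
qed

text \<open>The fraction of a kernel value that is certainly lost when the kernel is multiplied by a
  factor of at most \<open>(1 + q) powr (- p / 2)\<close>.\<close>

definition gap :: "real \<Rightarrow> real" where "gap q = 1 - (1 + q) powr (- p / 2)"

lemma gap_pos: "0 < q \<Longrightarrow> 0 < gap q"
  using powr_less_mono[of "- p / 2" 0 "1 + q"] p_pos by (simp add: gap_def)

text \<open>Reflecting y adds 2 (l - y . e) e to y - x, and the square of the \<open>e\<close>
  component then grows by exactly 4 (l - y . e) (l - x . e). This is positive for two points below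
  the plane, so the last clause of \<open>kern\<close> applies.\<close>

lemma kern_mirror_gap:
  assumes K: "kern K" and y: "y \<bullet> e < l" "x \<bullet> e < l" "y \<noteq> x"
    and q: "0 \<le> q" "q * (norm (y - x))\<^sup>2 \<le> 4 * (\<theta> / \<Theta>)\<^sup>2 * ((l - y \<bullet> e) * (l - x \<bullet> e))"
  shows "gap q * K (y - x) \<le> K (y - x) - K (mirror e l y - x)"
proof -
  define c where "c = 2 * (l - y \<bullet> e)"
  have n: "norm (y - x) > 0" using y by simp
  have eq: "mirror e l y - x = (y - x) + c *\<^sub>R e" by (simp add: mirror_def c_def)
  have sq: "((y - x) \<bullet> e + c)\<^sup>2 - ((y - x) \<bullet> e)\<^sup>2 = 4 * ((l - y \<bullet> e) * (l - x \<bullet> e))"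
    by (simp add: c_def inner_diff_left power2_eq_square algebra_simps)
  have "0 \<le> (l - y \<bullet> e) * (l - x \<bullet> e)" using y by simp
  then have le: "((y - x) \<bullet> e)\<^sup>2 \<le> ((y - x) \<bullet> e + c)\<^sup>2" using sq by linarith
  have "K (mirror e l y - x) \<le>
     (1 + (\<theta> / \<Theta>)\<^sup>2 * ((((y - x) \<bullet> e + c)\<^sup>2 - ((y - x) \<bullet> e)\<^sup>2) / (norm (y - x))\<^sup>2)) powr (- p / 2) * K (y - x)"
    unfolding eq using K le y unfolding kern_def by auto
  also have "\<dots> \<le> (1 + q) powr (- p / 2) * K (y - x)"
  proof (intro mult_right_mono powr_mono2')
    have "q \<le> 4 * (\<theta> / \<Theta>)\<^sup>2 * ((l - y \<bullet> e) * (l - x \<bullet> e)) / (norm (y - x))\<^sup>2"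
      using q(2) n by (simp add: pos_le_divide_eq)
    also have "\<dots> = (\<theta> / \<Theta>)\<^sup>2 * ((((y - x) \<bullet> e + c)\<^sup>2 - ((y - x) \<bullet> e)\<^sup>2) / (norm (y - x))\<^sup>2)"
      unfolding sq by simp
    finally show "1 + q \<le> 1 + \<dots>" by simp
  qed (use q p_pos kern_nonneg[OF K] in auto)
  finally show ?thesis by (simp add: gap_def algebra_simps)
qed

lemma kern_mirror_le:
  assumes "kern K" "y \<bullet> e < l" "x \<bullet> e < l" "y \<noteq> x"
  shows "K (mirror e l y - x) \<le> K (y - x)"
  using kern_mirror_gap[OF assms, of 0] assms by (simp add: gap_def)

section \<open>One-sided bounds for the operator and principal values\<close>

lemma AE_avoid:
  fixes x :: 'a
  shows "AE y in lebesgue. y \<noteq> x \<and> y \<bullet> e \<noteq> l"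
proof -
  have "negligible ({x} \<union> {y. y \<bullet> e = l})"
    using negligible_standard_hyperplane[OF e_Basis] by (intro negligible_Un) auto
  then have "{x} \<union> {y. y \<bullet> e = l} \<in> null_sets lebesgue" by (simp add: negligible_iff_null_sets)
  then show ?thesis by (rule AE_I') auto
qed

lemma integral_translate:
  fixes F :: "'a \<Rightarrow> real"
  assumes "F \<in> borel_measurable lebesgue"
  shows "(\<lambda>y. F (y - x)) \<in> borel_measurable lebesgue"
    and "integrable lebesgue (\<lambda>y. F (y - x)) \<longleftrightarrow> integrable lebesgue F"
    and "(\<integral>y. F (y - x) \<partial>lebesgue) = (\<integral>y. F y \<partial>lebesgue)"
  using measurable_preserving[OF translation_preserving[of "- x"] assms]
    integrable_preserving[OF translation_preserving[of "- x"] assms]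
    integral_preserving[OF translation_preserving[of "- x"] assms] by simp_all

lemma cutoff_integral:
  assumes K: "kern K" and r: "0 < r"
  shows "integrable lebesgue (\<lambda>h. (min 1 (norm h / r))\<^sup>2 * K h)"
    and "(\<integral>h. (min 1 (norm h / r))\<^sup>2 * K h \<partial>lebesgue) \<le> tail_bound * r powr (- 2 * s)"
proof -
  have m: "(\<lambda>h::'a. (min 1 (norm h / r))\<^sup>2) \<in> borel_measurable lebesgue"
    by (rule borel_lebesgue_measurable) measurable
  show "integrable lebesgue (\<lambda>h. (min 1 (norm h / r))\<^sup>2 * K h)"
    by (rule weighted_integrable(1)[OF K r m, where C = 1]) simp
  have "\<bar>\<integral>h. (min 1 (norm h / r))\<^sup>2 * K h \<partial>lebesgue\<bar> \<le> 1 * tail_bound * r powr (- 2 * s)"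
    by (rule weighted_integrable(2)[OF K r m]) simp
  then show "(\<integral>h. (min 1 (norm h / r))\<^sup>2 * K h \<partial>lebesgue) \<le> tail_bound * r powr (- 2 * s)" by simp
qed

text \<open>Template for contact points: \<tau> records the gain, and b the amount by which the test
  function falls short at scale r, which is paid for through \<open>tail_bound\<close>.\<close>

lemma lap_lower:
  assumes K: "kern K" and w: "regular_at w x g" and r: "0 < r" and b: "0 \<le> b"
    and \<tau>: "integrable lebesgue \<tau>"
    and H: "\<And>h. h \<noteq> 0 \<Longrightarrow> \<tau> h - b * ((min 1 (norm h / r))\<^sup>2 * K h) \<le> remainder w x g r h * K h"
  shows "(\<integral>h. \<tau> h \<partial>lebesgue) - b * (tail_bound * r powr (- 2 * s)) \<le> lap K w x g"
proof -
  have "(\<integral>h. \<tau> h \<partial>lebesgue) - b * (tail_bound * r powr (- 2 * s))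
      \<le> (\<integral>h. \<tau> h \<partial>lebesgue) - b * (\<integral>h. (min 1 (norm h / r))\<^sup>2 * K h \<partial>lebesgue)"
    using cutoff_integral(2)[OF K r] b by (simp add: mult_left_mono)
  also have "\<dots> = (\<integral>h. \<tau> h - b * ((min 1 (norm h / r))\<^sup>2 * K h) \<partial>lebesgue)"
    using \<tau> cutoff_integral(1)[OF K r] by simp
  also have "\<dots> \<le> (\<integral>h. remainder w x g r h * K h \<partial>lebesgue)"
  proof (rule integral_mono_AE)
    show "AE h in lebesgue. \<tau> h - b * ((min 1 (norm h / r))\<^sup>2 * K h) \<le> remainder w x g r h * K h"
      using AE_avoid[of 0 0] H by auto
  qed (use \<tau> cutoff_integral(1)[OF K r] remainder_integrable[OF K w r] in auto)
  finally show ?thesis unfolding lap_eq[OF K w r] .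
qed

text \<open>The integral above the plane is folded onto the half-space below it, and antisymmetry
  replaces the value at the mirror point by \<open>- w y\<close>. Hence only values below the plane
  have to be estimated, although the kernel sees the whole space.\<close>

lemma antisymmetric_lap_lower:
  assumes K: "kern K" and w: "regular_at w x g" and anti: "\<And>y. w (mirror e l y) = - w y"
    and r: "0 < r" "r \<le> l - x \<bullet> e" and b: "0 \<le> b"
    and \<tau>: "integrable lebesgue \<tau>" and \<tau>0: "\<And>y. l \<le> y \<bullet> e \<Longrightarrow> \<tau> y = 0"
    and H: "\<And>y. y \<bullet> e < l \<Longrightarrow> y \<noteq> x \<Longrightarrow>
       \<tau> y - b * ((min 1 (norm (y - x) / r))\<^sup>2 * K (y - x)) \<le>
       remainder w x g r (y - x) * K (y - x) + (- w y - w x) * K (mirror e l y - x)"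
  shows "(\<integral>y. \<tau> y \<partial>lebesgue) - b * (tail_bound * r powr (- 2 * s)) \<le> lap K w x g"
proof -
  define G where "G y = remainder w x g r (y - x) * K (y - x)" for y
  define A where "A = {y::'a. y \<bullet> e < l}"
  define D where "D y = (min 1 (norm (y - x) / r))\<^sup>2 * K (y - x)" for y
  have A: "A \<in> sets lebesgue"
    unfolding A_def using borel_open[OF open_halfspace_component_lt[of e l]] by simp
  have RK: "(\<lambda>h. remainder w x g r h * K h) \<in> borel_measurable lebesgue"
    using remainder_measurable[OF w] kern_measurable[OF K] by measurable
  have G: "integrable lebesgue G" "(\<integral>y. G y \<partial>lebesgue) = lap K w x g"
    unfolding G_def integral_translate(2)[OF RK] integral_translate(3)[OF RK] using lap_eq[OF K w r(1)] remainder_integrable[OF K w r(1)] by auto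
  have DK: "(\<lambda>h. (min 1 (norm h / r))\<^sup>2 * K h) \<in> borel_measurable lebesgue"
    using cutoff_integral(1)[OF K r(1)] by auto
  have D: "integrable lebesgue D" "(\<integral>y. D y \<partial>lebesgue) \<le> tail_bound * r powr (- 2 * s)"
    unfolding D_def integral_translate(2)[OF DK] integral_translate(3)[OF DK] using cutoff_integral[OF K r(1)] by auto
  define G1 where "G1 y = indicator A y * G y" for y
  define G2 where "G2 y = indicator (- A) y * G y" for y
  have G1: "integrable lebesgue G1" unfolding G1_def
    using integrable_mult_indicator[OF A G(1)] by simp
  have G2: "integrable lebesgue G2" unfolding G2_def
    using integrable_mult_indicator[OF sets.compl_sets[OF A] G(1)] by (simp add: Compl_eq_Diff_UNIV)
  have G2': "integrable lebesgue (\<lambda>y. G2 (mirror e l y))" "(\<integral>y. G2 (mirror e l y) \<partial>lebesgue) = (\<integral>y. G2 y \<partial>lebesgue)"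
    using integrable_preserving[OF mirror_preserving[OF e_Basis], of G2 l]
      integral_preserving[OF mirror_preserving[OF e_Basis], of G2 l] G2 by auto
  have "lap K w x g = (\<integral>y. G1 y + G2 y \<partial>lebesgue)"
    unfolding G(2)[symmetric] by (intro Bochner_Integration.integral_cong) (auto simp: G1_def G2_def indicator_def)
  also have "\<dots> = (\<integral>y. G1 y + G2 (mirror e l y) \<partial>lebesgue)"
    using G1 G2 G2' by simp
  finally have lap: "lap K w x g = (\<integral>y. G1 y + G2 (mirror e l y) \<partial>lebesgue)" .
  have "(\<integral>y. \<tau> y \<partial>lebesgue) - b * (tail_bound * r powr (- 2 * s)) \<le> (\<integral>y. \<tau> y \<partial>lebesgue) - b * (\<integral>y. D y \<partial>lebesgue)"
    using D(2) b by (simp add: mult_left_mono)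
  also have "\<dots> = (\<integral>y. \<tau> y - b * D y \<partial>lebesgue)"
    using \<tau> D(1) by simp
  also have "\<dots> \<le> (\<integral>y. G1 y + G2 (mirror e l y) \<partial>lebesgue)"
  proof (rule integral_mono_AE)
    have pw: "\<tau> y - b * D y \<le> G1 y + G2 (mirror e l y)" if y: "y \<noteq> x" "y \<bullet> e \<noteq> l" for y
    proof (cases "y \<bullet> e < l")
      case True
      have m: "mirror e l y \<bullet> e = 2 * l - y \<bullet> e" by (rule mirror_inner)
      \<comment> \<open>The mirror point is at distance at least r from x, so its remainder carries
        no gradient term.\<close>
      have "r \<le> (mirror e l y - x) \<bullet> e" using r True by (simp add: inner_diff_left m)
      also have "\<dots> \<le> norm (mirror e l y - x)" using Basis_le_norm[OF e_Basis, of "mirror e l y - x"] by simp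
      finally have "G2 (mirror e l y) = (- w y - w x) * K (mirror e l y - x)"
        using True by (simp add: G2_def A_def m G_def remainder_def anti)
      then show ?thesis using H[OF True y(1)] True by (simp add: G1_def A_def D_def G_def)
    next
      case False
      then have "\<tau> y = 0" "G1 y = 0" "G2 (mirror e l y) = 0"
        using y \<tau>0[of y] by (auto simp: G1_def G2_def A_def mirror_inner)
      moreover have "0 \<le> b * D y" using b kern_nonneg[OF K] by (simp add: D_def)
      ultimately show ?thesis by simp
    qed
    show "AE y in lebesgue. \<tau> y - b * D y \<le> G1 y + G2 (mirror e l y)"
      using AE_avoid[of x l] pw by auto
  qed (use \<tau> D(1) G1 G2' in auto)
  finally show ?thesis unfolding lap .
qed

text \<open>What is left of the linear term after removing a ball of radius \<epsilon> < 1 lives on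
  an annulus and integrates to 0. The truncated integral is thus a truncation of an absolutely
  convergent one, and dominated convergence applies.\<close>

lemma principal_value_lap:
  assumes K: "kern K" and w: "regular_at w x g"
  shows "((\<lambda>\<epsilon>. LINT y:- ball x \<epsilon>|lebesgue. (w y - w x) * K (y - x)) \<longlongrightarrow> lap K w x g) (at_right 0)"
proof (rule tendsto_at_right_sequentially[where b = 1])
  fix S :: "nat \<Rightarrow> real"
  assume S: "\<And>n. 0 < S n" "\<And>n. S n < 1" "S \<longlonglongrightarrow> 0"
  let ?R = "\<lambda>h. remainder w x g 1 h * K h"
  have R: "integrable lebesgue ?R" by (rule remainder_integrable[OF K w zero_less_one])
  have sets: "- ball (0::'a) \<epsilon> \<in> sets lebesgue" for \<epsilon>
    using borel_closed[of "- ball (0::'a) \<epsilon>"] by auto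
  have eq: "(LINT y:- ball x \<epsilon>|lebesgue. (w y - w x) * K (y - x))
      = (\<integral>h. indicator (- ball 0 \<epsilon>) h * ?R h \<partial>lebesgue)" if \<epsilon>: "0 < \<epsilon>" "\<epsilon> < 1" for \<epsilon>
  proof -
    define F where "F h = indicator (- ball 0 \<epsilon>) h * ((w (x + h) - w x) * K h)" for h :: 'a
    have [measurable]: "(\<lambda>h. w (x + h)) \<in> borel_measurable lebesgue" "K \<in> borel_measurable lebesgue"
      "- ball (0::'a) \<epsilon> \<in> sets lebesgue"
      using measurable_translation[OF regular_at_measurable[OF w]] kern_measurable[OF K] sets by auto
    have F: "F \<in> borel_measurable lebesgue" unfolding F_def[abs_def] by measurable
    have "(LINT y:- ball x \<epsilon>|lebesgue. (w y - w x) * K (y - x)) = (\<integral>y. F (y - x) \<partial>lebesgue)"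
      unfolding set_lebesgue_integral_def F_def
      by (intro Bochner_Integration.integral_cong) (auto simp: indicator_def dist_norm norm_minus_commute)
    also have "\<dots> = (\<integral>h. F h \<partial>lebesgue)" by (rule integral_translate(3)[OF F])
    also have "\<dots> = (\<integral>h. indicator (- ball 0 \<epsilon>) h * ?R h + (if \<epsilon> \<le> norm h \<and> norm h < 1 then g \<bullet> h else 0) * K h \<partial>lebesgue)"
      by (intro Bochner_Integration.integral_cong) (auto simp: F_def indicator_def remainder_def algebra_simps)
    also have "\<dots> = (\<integral>h. indicator (- ball 0 \<epsilon>) h * ?R h \<partial>lebesgue)"
      using integrable_mult_indicator[OF sets R, of \<epsilon>] annulus_integrable[OF K \<epsilon>(1)] by simp
    finally show ?thesis .
  qed
  have "(\<lambda>n. \<integral>h. indicator (- ball 0 (S n)) h * ?R h \<partial>lebesgue) \<longlonglongrightarrow> (\<integral>h. ?R h \<partial>lebesgue)"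
  proof (rule integral_dominated_convergence[where w = "\<lambda>h. \<bar>?R h\<bar>"])
    show "(\<lambda>h. indicator (- ball 0 (S n)) h * ?R h) \<in> borel_measurable lebesgue" for n
      using integrable_mult_indicator[OF sets R, of "S n"] by auto
    show "AE h in lebesgue. (\<lambda>n. indicator (- ball 0 (S n)) h * ?R h) \<longlonglongrightarrow> ?R h"
    proof (rule AE_I2)
      fix h :: 'a
      show "(\<lambda>n. indicator (- ball 0 (S n)) h * ?R h) \<longlonglongrightarrow> ?R h"
      proof (cases "h = 0")
        case True
        then show ?thesis by (simp add: remainder_def)
      next
        case False
        then have "\<forall>\<^sub>F n in sequentially. S n < norm h"
          using S(3) by (simp add: order_tendstoD(2))
        then have "\<forall>\<^sub>F n in sequentially. indicator (- ball 0 (S n)) h * ?R h = ?R h"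
          by eventually_elim auto
        then show ?thesis by (rule tendsto_eventually)
      qed
    qed
  qed (use R in \<open>auto simp: indicator_def\<close>)
  then show "(\<lambda>n. LINT y:- ball x (S n)|lebesgue. (w y - w x) * K (y - x)) \<longlonglongrightarrow> lap K w x g"
    using eq[OF S(1,2)] by (simp add: lap_def)
qed simp

end

section \<open>Nondegeneracy of solutions\<close>

lemma small_powr:
  fixes a c C x0 :: real
  assumes "0 < a" "0 < c" "0 < x0"
  obtains x where "0 < x" "x \<le> x0" "C * x powr a < c"
proof -
  define d where "d = c / (\<bar>C\<bar> + 1)"
  define x where "x = min x0 (d powr (1 / a))"
  have d: "0 < d" using assms by (simp add: d_def add_nonneg_pos)
  then have x: "0 < x" using assms by (simp add: x_def)
  have "x powr a \<le> (d powr (1 / a)) powr a" using x assms by (intro powr_mono2) (auto simp: x_def)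
  also have "\<dots> = d" using d assms by (simp add: powr_powr)
  finally have xa: "x powr a \<le> d" .
  have "C * x powr a \<le> \<bar>C\<bar> * x powr a" by (intro mult_right_mono) auto
  also have "\<dots> \<le> \<bar>C\<bar> * d" using xa by (intro mult_left_mono) auto
  also have "\<dots> < (\<bar>C\<bar> + 1) * d" using d by (intro mult_strict_right_mono) auto
  also have "\<dots> = c" by (simp add: d_def)
  finally show ?thesis using that[of x] x by (auto simp: x_def)
qed

lemma large_powr:
  fixes a c C :: real
  assumes "0 < a" "0 < c"
  obtains R where "0 < R" "C * R powr (- a) < c"
proof -
  obtain x where x: "0 < x" "x \<le> 1" "C * x powr a < c" by (rule small_powr[OF assms zero_less_one])
  then have "C * (1 / x) powr (- a) < c" by (simp add: powr_divide powr_minus_divide)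
  then show ?thesis using that[of "1 / x"] x by simp
qed

lemma integrable_on_ball:
  fixes F :: "'a::euclidean_space \<Rightarrow> real"
  assumes F: "F \<in> borel_measurable lebesgue" and bd: "\<And>y. \<bar>F y\<bar> \<le> C"
  shows "integrable lebesgue (\<lambda>y. indicator (ball z r) y * F y)"
proof -
  have "emeasure lebesgue (ball z r) < \<infinity>" by (simp add: emeasure_lebesgue_ball)
  then have "integrable lebesgue (\<lambda>y. indicator (ball z r) y *\<^sub>R F y)"
    using F bd by (intro integrableI_bounded_set_indicator[where B = C]) auto
  then show ?thesis by simp
qed

lemma integral_const_ball:
  fixes z :: "'a::euclidean_space"
  shows "integrable lebesgue (\<lambda>y. indicator (ball z r) y * (c::real))"
    and "(\<integral>y. indicator (ball z r) y * c \<partial>lebesgue) = c * measure lebesgue (ball z r)"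
  using integrable_on_ball[of "\<lambda>_. c" "\<bar>c\<bar>" z r] by (auto simp: mult.commute)

lemma regular_at_isCont:
  assumes "regular_at w x g"
  shows "isCont w x"
proof -
  from assms obtain r C where r: "r > 0"
    and C: "\<And>h. norm h < r \<Longrightarrow> \<bar>w (x + h) - w x - g \<bullet> h\<bar> \<le> C * (norm h)\<^sup>2"
    unfolding regular_at_def by auto
  have "((\<lambda>h. w (x + h) - w x - g \<bullet> h) \<longlongrightarrow> 0) (at 0)"
  proof (rule Lim_null_comparison)
    show "\<forall>\<^sub>F h in at 0. norm (w (x + h) - w x - g \<bullet> h) \<le> C * (norm h)\<^sup>2"
      unfolding eventually_at using r C by (auto simp: dist_norm)
    show "((\<lambda>h. C * (norm h)\<^sup>2) \<longlongrightarrow> 0) (at (0::'a))" by (auto intro!: tendsto_eq_intros)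
  qed
  moreover have "((\<lambda>h. w x + g \<bullet> h) \<longlongrightarrow> w x) (at 0)" by (auto intro!: tendsto_eq_intros)
  ultimately have "((\<lambda>h. (w (x + h) - w x - g \<bullet> h) + (w x + g \<bullet> h)) \<longlongrightarrow> 0 + w x) (at 0)"
    by (rule tendsto_add)
  then show ?thesis by (simp add: isCont_iff)
qed

lemma regular_at_minus:
  assumes "regular_at w x g"
  shows "regular_at (\<lambda>y. - w y) x (- g)"
proof -
  have "\<bar>- w (x + h) - - w x - - g \<bullet> h\<bar> = \<bar>w (x + h) - w x - g \<bullet> h\<bar>" for h by simp
  then show ?thesis using assms unfolding regular_at_def by (simp add: borel_measurable_uminus)
qed

lemma lap_minus: "lap K (\<lambda>y. - w y) x (- g) = - lap K w x g"
proof -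
  have "remainder (\<lambda>y. - w y) x (- g) 1 h * K h = - (remainder w x g 1 h * K h)" for h
    by (simp add: remainder_def algebra_simps)
  then show ?thesis by (simp add: lap_def)
qed

section \<open>Truncated paraboloids as test functions\<close>

definition bump :: "'a::euclidean_space \<Rightarrow> real \<Rightarrow> 'a \<Rightarrow> real" where
  "bump z R y = max 0 (1 - (norm (y - z))\<^sup>2 / R\<^sup>2)"

lemma bump_nonneg: "0 \<le> bump z R y" and bump_le_one: "bump z R y \<le> 1"
  by (simp_all add: bump_def)

lemma bump_center: "bump z R z = 1"
  by (simp add: bump_def)

lemma bump_outside:
  assumes "0 < R" "R \<le> norm (y - z)"
  shows "bump z R y = 0"
proof -
  have "R\<^sup>2 \<le> (norm (y - z))\<^sup>2" using assms by (intro power_mono) auto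
  then show ?thesis using assms(1) by (simp add: bump_def pos_le_divide_eq)
qed

text \<open>Where the bump is positive it coincides with its paraboloid, and truncation at 0 only
  raises it elsewhere. The expansion of the paraboloid is therefore a lower bound for every h,
  across the edge of the support as well.\<close>

lemma bump_tangent:
  assumes "0 < bump z R y0"
  shows "(- (2 / R\<^sup>2) *\<^sub>R (y0 - z)) \<bullet> h - (norm h)\<^sup>2 / R\<^sup>2 \<le> bump z R (y0 + h) - bump z R y0"
proof -
  have sq: "(norm (y0 + h - z))\<^sup>2 = (norm (y0 - z))\<^sup>2 + 2 * ((y0 - z) \<bullet> h) + (norm h)\<^sup>2"
    using dot_norm[of "y0 - z" h] by (simp add: algebra_simps)
  have "bump z R y0 = 1 - (norm (y0 - z))\<^sup>2 / R\<^sup>2"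
    using assms by (simp add: bump_def max_def split: if_splits)
  moreover have "1 - (norm (y0 + h - z))\<^sup>2 / R\<^sup>2 \<le> bump z R (y0 + h)" by (simp add: bump_def)
  ultimately show ?thesis unfolding sq by (simp add: add_divide_distrib)
qed

lemma continuous_bump: "R \<noteq> 0 \<Longrightarrow> continuous_on S (bump z R)"
  unfolding bump_def by (intro continuous_intros) auto

text \<open>
  The assumptions \<open>eq_lower\<close>, \<open>eq_upper\<close> and \<open>eq_compare\<close> are all that is used of the equation
  $-\inf_K \mathrm{lap}_K\, u = f(u)$; they hide which kernels the infimum ranges over.
\<close>

locale half_space_solution = kernel_setting e \<theta> \<Theta> s
  for e :: "'a::euclidean_space" and \<theta> \<Theta> s +
  fixes u :: "'a \<Rightarrow> real" and f :: "real \<Rightarrow> real" and G :: "'a \<Rightarrow> 'a" and L M :: real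
  assumes u_measurable: "u \<in> borel_measurable lebesgue"
    and u_nonneg: "\<And>x. 0 \<le> u x" and u_le: "\<And>x. u x \<le> M"
    and u_outside: "\<And>x. x \<bullet> e \<le> 0 \<Longrightarrow> u x = 0"
    and u_nontrivial: "\<exists>x. u x \<noteq> 0"
    and u_regular: "\<And>x. 0 < x \<bullet> e \<Longrightarrow> regular_at u x (G x)"
    and L_nonneg: "0 \<le> L" and f_lipschitz: "\<And>x y. \<bar>f (u x) - f (u y)\<bar> \<le> L * \<bar>u x - u y\<bar>"
    and eq_lower: "\<And>x B. 0 < x \<bullet> e \<Longrightarrow> (\<And>K. kern K \<Longrightarrow> B \<le> lap K u x (G x)) \<Longrightarrow> f (u x) \<le> - B"
    and eq_upper: "\<And>x B. 0 < x \<bullet> e \<Longrightarrow> (\<And>K. kern K \<Longrightarrow> lap K u x (G x) \<le> B) \<Longrightarrow> - B \<le> f (u x)"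
    and eq_compare: "\<And>x y B. 0 < x \<bullet> e \<Longrightarrow> 0 < y \<bullet> e \<Longrightarrow>
       (\<And>K. kern K \<Longrightarrow> lap K u x (G x) + B \<le> lap K u y (G y)) \<Longrightarrow> f (u y) + B \<le> f (u x)"
    and f_zero: "f 0 \<noteq> 0 \<or> (\<exists>c>0. \<exists>\<delta>>0. \<forall>t\<in>{0..\<delta>}. c * t \<le> f t)"
begin

lemma M_pos: "0 < M"
proof -
  obtain x where "u x \<noteq> 0" using u_nontrivial by blast
  then show ?thesis using u_nonneg[of x] u_le[of x] by linarith
qed

lemma u_continuous: "0 < x \<bullet> e \<Longrightarrow> isCont u x"
  by (rule regular_at_isCont[OF u_regular])

lemma u_integrable_ball: "integrable lebesgue (\<lambda>y. indicator (ball z r) y * u y)"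
  using u_nonneg u_le by (intro integrable_on_ball[OF u_measurable, where C = M]) simp

lemma f_zero_bound: "\<bar>f (u x) - f 0\<bar> \<le> L * u x"
  using f_lipschitz[of x 0] u_outside[of 0] u_nonneg[of x] by simp

lemma cball_half_space:
  assumes "y \<in> cball z R"
  shows "z \<bullet> e - R \<le> y \<bullet> e"
proof -
  have "(z - y) \<bullet> e \<le> norm (z - y)" using Basis_le_norm[OF e_Basis, of "z - y"] by simp
  then show ?thesis using assms by (simp add: inner_diff_left dist_norm)
qed

lemma ball_integral_mono:
  assumes "ball z1 r1 \<subseteq> ball z2 r2"
  shows "(\<integral>y. indicator (ball z1 r1) y * u y \<partial>lebesgue) \<le> (\<integral>y. indicator (ball z2 r2) y * u y \<partial>lebesgue)"
  using assms u_nonneg by (intro integral_mono u_integrable_ball) (auto simp: indicator_def)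

text \<open>
  Touch \<open>u\<close> from above by a paraboloid with opening $R^{-2}$: at the contact point \<open>f (u y0)\<close> is almost
  nonnegative, so \<open>u y0\<close> is bounded below, and the mass missing near \<open>y0\<close> is controlled by \<open>f (u y0)\<close>.
\<close>

lemma nondegenerate_negative:
  assumes "f 0 < 0"
  shows "\<exists>\<rho>>0. \<exists>c>0. \<forall>z. \<rho> \<le> z \<bullet> e \<longrightarrow> c \<le> (\<integral>y. indicator (ball z \<rho>) y * u y \<partial>lebesgue)"
proof -
  let ?w = "measure lebesgue (ball (0::'a) 1)"
  have w: "?w > 0" by (rule unit_ball_measure_pos)
  \<comment> \<open>The paraboloid below has coefficient 2 M / R^2 and costs 2 M tail_bound R^(-2s);
    this may use up half of \<open>- f 0\<close>.\<close>
  obtain R where R: "0 < R" "(2 * M * tail_bound) * R powr (- (2 * s)) < - f 0 / 2"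
    using large_powr[of "2 * s" "- f 0 / 2" "2 * M * tail_bound"] s_pos assms by auto
  \<comment> \<open>The remaining half of \<open>- f 0\<close> is at most L times
    \<open>u y0\<close>, which gives \<open>u y0 >= \<delta>\<close>.\<close>
  define \<delta> where "\<delta> = - f 0 / (2 * (L + 1))"
  have \<delta>: "\<delta> > 0" using assms L_nonneg unfolding \<delta>_def by (intro divide_pos_pos) auto
  \<comment> \<open>The bound R \<delta> / (16 M) makes the tilt \<kappa> of the paraboloid over a
    ball of radius r at most \<delta> / 4; the last inequality makes the missing mass at most
    another \<delta> / 4 per unit volume. The average of \<open>u\<close> near \<open>y0\<close>
    then keeps \<delta> / 2.\<close>
  obtain r where r: "0 < r" "r \<le> min R (R * \<delta> / (16 * M))" "(L * M / (\<theta> powr p * ?w)) * r powr (2 * s) < \<delta> / 4"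
    by (rule small_powr[of "2 * s" "\<delta> / 4" "min R (R * \<delta> / (16 * M))" "L * M / (\<theta> powr p * ?w)"]) (use s_pos \<delta> R M_pos in auto)
  define \<kappa> where "\<kappa> = 4 * M * r / R"
  have "r * (16 * M) \<le> R * \<delta>" using r(2) M_pos by (simp add: pos_le_divide_eq)
  then have \<kappa>: "\<kappa> \<le> \<delta> / 4" using R(1) by (simp add: \<kappa>_def pos_divide_le_eq mult_ac)
  let ?c = "measure lebesgue (ball (0::'a) r) * (\<delta> / 2)"
  have c: "?c > 0" using measure_ball_scale[of r "0::'a"] w \<delta> r(1) by simp
  have "?c \<le> (\<integral>y. indicator (ball z (2 * R)) y * u y \<partial>lebesgue)" if z: "2 * R \<le> z \<bullet> e" for z
  proof -
    define \<Phi> where "\<Phi> y = 2 * M * (norm (y - z))\<^sup>2 / R\<^sup>2" for y :: 'a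
    have inside: "0 < y \<bullet> e" if "y \<in> cball z R" for y
      using cball_half_space[OF that] z R(1) by simp
    have cont: "continuous_on (cball z R) (\<lambda>y. u y - \<Phi> y)"
      unfolding \<Phi>_def using R(1) inside u_continuous
      by (intro continuous_intros continuous_at_imp_continuous_on ballI) auto
    obtain y0 where y0: "y0 \<in> cball z R" "\<And>y. y \<in> cball z R \<Longrightarrow> u y - \<Phi> y \<le> u y0 - \<Phi> y0"
      using continuous_attains_sup[OF compact_cball _ cont] R(1) by force
    have e0: "0 < y0 \<bullet> e" by (rule inside[OF y0(1)])
    have top: "0 \<le> u y0 - \<Phi> y0" using y0(2)[of z] R(1) u_nonneg[of z] by (simp add: \<Phi>_def)
    \<comment> \<open>From radius R on, the paraboloid exceeds every value of \<open>u\<close>, so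
      the maximum over the compact ball is interior and in fact global.\<close>
    have out: "2 * M \<le> \<Phi> y" if "R \<le> norm (y - z)" for y
    proof -
      have "R\<^sup>2 \<le> (norm (y - z))\<^sup>2" using that R(1) by (intro power_mono) auto
      then have "2 * M * R\<^sup>2 \<le> 2 * M * (norm (y - z))\<^sup>2" using M_pos by (intro mult_left_mono) auto
      then show ?thesis using R(1) by (simp add: \<Phi>_def pos_le_divide_eq)
    qed
    have y0R: "norm (y0 - z) < R"
      using out[of y0] top u_le[of y0] M_pos by linarith
    define v where "v = (4 * M / R\<^sup>2) *\<^sub>R (y0 - z)"
    have \<Phi>_diff: "\<Phi> (y0 + h) - \<Phi> y0 = v \<bullet> h + 2 * M * (norm h / R)\<^sup>2" for h
    proof -
      have "(norm (y0 + h - z))\<^sup>2 = (norm (y0 - z))\<^sup>2 + 2 * ((y0 - z) \<bullet> h) + (norm h)\<^sup>2"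
        using dot_norm[of "y0 - z" h] by (simp add: algebra_simps)
      then have "\<Phi> (y0 + h) = \<Phi> y0 + 2 * M * (2 * ((y0 - z) \<bullet> h) + (norm h)\<^sup>2) / R\<^sup>2"
        unfolding \<Phi>_def by (simp only: ring_distribs add_divide_distrib)
      also have "2 * M * (2 * ((y0 - z) \<bullet> h) + (norm h)\<^sup>2) / R\<^sup>2 = v \<bullet> h + 2 * M * (norm h / R)\<^sup>2"
        by (simp add: v_def power_divide add_divide_distrib ring_distribs)
      finally show ?thesis by simp
    qed
    have global: "u (y0 + h) \<le> u y0 + (v \<bullet> h + 2 * M * (norm h / R)\<^sup>2)" for h
    proof (cases "y0 + h \<in> cball z R")
      case True
      then show ?thesis using y0(2)[OF True] \<Phi>_diff[of h] by linarith
    next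
      case False
      then have "2 * M \<le> \<Phi> (y0 + h)" by (intro out) (simp add: dist_norm norm_minus_commute)
      then show ?thesis using u_le[of "y0 + h"] top \<Phi>_diff[of h] M_pos by linarith
    qed
    have reg: "regular_at (\<lambda>y. - u y) y0 (- G y0)" by (rule regular_at_minus[OF u_regular[OF e0]])
    have grad: "- G y0 = - v"
    proof (rule regular_at_gradient_unique[OF reg R(1)])
      fix h :: 'a
      have "2 * M * (norm h / R)\<^sup>2 = 2 * M / R\<^sup>2 * (norm h)\<^sup>2" by (simp add: power_divide)
      then show "- v \<bullet> h - 2 * M / R\<^sup>2 * (norm h)\<^sup>2 \<le> - u (y0 + h) - - u y0" using global[of h] by simp
    qed
    have vn: "norm v \<le> 4 * M / R"
    proof -
      have "norm v = 4 * M / R\<^sup>2 * norm (y0 - z)" using M_pos by (simp add: v_def)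
      also have "\<dots> \<le> 4 * M / R\<^sup>2 * R" using y0R M_pos by (intro mult_left_mono) auto
      also have "\<dots> = 4 * M / R" using R(1) by (simp add: power2_eq_square)
      finally show ?thesis .
    qed
    define k where "k = \<theta> powr p * r powr - p"
    have k: "k > 0" using \<theta>_pos r(1) by (simp add: k_def)
    \<comment> \<open>How far \<open>u\<close> falls below its contact value, where \<kappa> absorbs
      the linear term of the paraboloid on the ball of radius r.\<close>
    define E where "E h = max 0 (u y0 - u (y0 + h) - \<kappa>)" for h
    define \<tau> where "\<tau> h = indicator (ball 0 r) h * (k * E h)" for h
    have Em: "E \<in> borel_measurable lebesgue"
      unfolding E_def[abs_def] using measurable_translation[OF u_measurable, of y0] by measurable
    have \<kappa>0: "\<kappa> \<ge> 0" using M_pos r(1) R(1) by (simp add: \<kappa>_def)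
    have Eb: "\<bar>E h\<bar> \<le> M" for h
      using u_le[of y0] u_nonneg[of "y0 + h"] \<kappa>0 M_pos by (simp add: E_def)
    have Ei: "integrable lebesgue (\<lambda>h. indicator (ball 0 r) h * E h)"
      by (rule integrable_on_ball[OF Em Eb])
    have \<tau>_eq: "\<tau> = (\<lambda>h. k * (indicator (ball 0 r) h * E h))" by (auto simp: \<tau>_def)
    have \<tau>i: "integrable lebesgue \<tau>" unfolding \<tau>_eq using Ei by simp
    have low: "(\<integral>h. \<tau> h \<partial>lebesgue) - 2 * M * (tail_bound * R powr (- 2 * s)) \<le> - lap K u y0 (G y0)" if K: "kern K" for K
      unfolding lap_minus[symmetric]
    proof (rule lap_lower[OF K reg R(1) _ \<tau>i])
      show "0 \<le> 2 * M" using M_pos by simp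
      fix h :: 'a assume h: "h \<noteq> 0"
      show "\<tau> h - 2 * M * ((min 1 (norm h / R))\<^sup>2 * K h) \<le> remainder (\<lambda>y. - u y) y0 (- G y0) R h * K h"
      proof (cases "norm h < R")
        case True
        define E' where "E' = u y0 - u (y0 + h) + v \<bullet> h + 2 * M * (norm h / R)\<^sup>2"
        have E'0: "E' \<ge> 0" using global[of h] by (simp add: E'_def)
        have "\<tau> h \<le> E' * K h"
        proof (cases "norm h < r")
          case True
          have "\<bar>v \<bullet> h\<bar> \<le> norm v * norm h" by (rule Cauchy_Schwarz_ineq2)
          also have "\<dots> \<le> 4 * M / R * r" using vn True M_pos R(1) by (intro mult_mono) auto
          finally have "- \<kappa> \<le> v \<bullet> h" by (simp add: \<kappa>_def)
          moreover have "0 \<le> 2 * M * (norm h / R)\<^sup>2" using M_pos by simp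
          ultimately have "E h \<le> E'" using E'0 by (simp add: E_def E'_def)
          moreover have "k \<le> K h" unfolding k_def using True h by (intro kern_lower_ball[OF K]) auto
          ultimately have "k * E h \<le> K h * E'" using k by (intro mult_mono) (auto simp: E_def)
          then show ?thesis using True by (simp add: \<tau>_def mult.commute)
        next
          case False
          then show ?thesis using E'0 kern_nonneg[OF K] by (simp add: \<tau>_def)
        qed
        moreover have rem: "remainder (\<lambda>y. - u y) y0 (- G y0) R h = E' - 2 * M * (norm h / R)\<^sup>2"
          unfolding grad using True by (simp add: remainder_def E'_def)
        moreover have m: "min 1 (norm h / R) = norm h / R" using True R(1) by simp
        ultimately show ?thesis unfolding rem m left_diff_distrib by (simp only: mult.assoc)
      next
        case False
        then have "\<tau> h = 0" using r(2) by (simp add: \<tau>_def)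
        moreover have "min 1 (norm h / R) = 1" using False R(1) by simp
        moreover have "- (2 * M) * K h \<le> remainder (\<lambda>y. - u y) y0 (- G y0) R h * K h"
          using False u_le[of "y0 + h"] u_nonneg[of y0] M_pos
          by (intro mult_right_mono kern_nonneg[OF K]) (simp add: remainder_def)
        ultimately show ?thesis by simp
      qed
    qed
    define B where "B = 2 * M * (tail_bound * R powr (- 2 * s)) - (\<integral>h. \<tau> h \<partial>lebesgue)"
    have fB: "- B \<le> f (u y0)"
      by (rule eq_upper[OF e0]) (use low in \<open>force simp: B_def\<close>)
    have \<tau>0: "0 \<le> (\<integral>h. \<tau> h \<partial>lebesgue)"
      using k by (intro integral_nonneg_AE) (auto simp: \<tau>_def E_def)
    have Bs: "2 * M * (tail_bound * R powr (- 2 * s)) < - f 0 / 2" using R(2) by (simp add: mult.assoc)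
    have "- f 0 / 2 \<le> L * u y0" using fB \<tau>0 Bs f_zero_bound[of y0] by (simp add: B_def)
    also have "\<dots> \<le> (L + 1) * u y0" using u_nonneg[of y0] by (simp add: mult_right_mono)
    finally have uy0: "\<delta> \<le> u y0" using L_nonneg by (simp add: \<delta>_def field_simps)
    have "(\<integral>h. \<tau> h \<partial>lebesgue) \<le> L * M"
    proof -
      have "L * u y0 \<le> L * M" using u_le L_nonneg by (intro mult_left_mono)
      then show ?thesis using fB Bs f_zero_bound[of y0] assms by (simp add: B_def)
    qed
    then have Ei_le: "(\<integral>h. indicator (ball 0 r) h * E h \<partial>lebesgue) \<le> L * M / k"
      using k by (simp add: \<tau>_eq pos_le_divide_eq mult.commute)
    \<comment> \<open>\<open>r powr p\<close> is r^n times r^(2s): the ball volume accounts for r^n,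
      and the spare factor r^(2s) is small by the choice of r.\<close>
    have kk: "L * M / k \<le> measure lebesgue (ball (0::'a) r) * (\<delta> / 4)"
    proof -
      have "1 / k = r powr p / \<theta> powr p" by (simp add: k_def powr_minus_divide)
      also have "r powr p = r ^ DIM('a) * r powr (2 * s)"
        using r(1) by (simp add: p_def powr_add powr_realpow)
      finally have "L * M / k = r ^ DIM('a) * ?w * ((L * M / (\<theta> powr p * ?w)) * r powr (2 * s))"
        using w by (simp add: divide_inverse mult_ac)
      also have "\<dots> \<le> r ^ DIM('a) * ?w * (\<delta> / 4)"
        using r w by (intro mult_left_mono) auto
      finally show ?thesis using measure_ball_scale[of r "0::'a"] r(1) by simp
    qed
    have uB: "(\<integral>y. indicator (ball y0 r) y * u y \<partial>lebesgue) = (\<integral>h. indicator (ball 0 r) h * u (y0 + h) \<partial>lebesgue)"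
    proof -
      have "(\<lambda>y. indicator (ball y0 r) y * u y) \<in> borel_measurable lebesgue"
        using u_integrable_ball[of y0 r] by auto
      from integral_preserving[OF translation_preserving[of y0] this]
      show ?thesis by (simp add: indicator_def dist_norm)
    qed
    have ui: "integrable lebesgue (\<lambda>h. indicator (ball 0 r) h * u (y0 + h))"
      using u_nonneg u_le by (intro integrable_on_ball[OF measurable_translation[OF u_measurable], where C = M]) simp
    have "(u y0 - \<kappa>) * measure lebesgue (ball (0::'a) r) - (\<integral>h. indicator (ball 0 r) h * u (y0 + h) \<partial>lebesgue)
       = (\<integral>h. indicator (ball (0::'a) r) h * (u y0 - \<kappa>) - indicator (ball 0 r) h * u (y0 + h) \<partial>lebesgue)"
      using ui integral_const_ball[of "0::'a" r "u y0 - \<kappa>"] by simp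
    also have "\<dots> \<le> (\<integral>h. indicator (ball 0 r) h * E h \<partial>lebesgue)"
      using ui integral_const_ball(1)[of "0::'a" r "u y0 - \<kappa>"] Ei
      by (intro integral_mono) (auto simp: E_def indicator_def)
    also have "\<dots> \<le> measure lebesgue (ball (0::'a) r) * (\<delta> / 4)" using Ei_le kk by linarith
    finally have "(u y0 - \<kappa>) * measure lebesgue (ball (0::'a) r) - measure lebesgue (ball (0::'a) r) * (\<delta> / 4)
       \<le> (\<integral>y. indicator (ball y0 r) y * u y \<partial>lebesgue)" unfolding uB by linarith
    moreover have "(\<delta> - \<delta> / 4) * measure lebesgue (ball (0::'a) r) \<le> (u y0 - \<kappa>) * measure lebesgue (ball (0::'a) r)"
      using uy0 \<kappa> by (intro mult_right_mono) auto
    ultimately have "?c \<le> (\<integral>y. indicator (ball y0 r) y * u y \<partial>lebesgue)"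
      by (simp add: algebra_simps)
    also have "\<dots> \<le> (\<integral>y. indicator (ball z (2 * R)) y * u y \<partial>lebesgue)"
    proof (intro ball_integral_mono subsetI)
      fix y assume "y \<in> ball y0 r"
      then show "y \<in> ball z (2 * R)" using y0R r(2) dist_triangle[of z y y0] by (simp add: dist_norm norm_minus_commute)
    qed
    finally show ?thesis .
  qed
  then show ?thesis using R(1) c by (intro exI[of _ "2 * R"] conjI exI[of _ ?c]) auto
qed

text \<open>Strong maximum principle: at an interior zero the gradient vanishes, and the mass near a
  point where \<open>u\<close> is positive gives all kernels a common positive lower bound. The
  equation would then force \<open>f 0 < 0\<close>.\<close>

lemma positive_in_half_space:
  assumes "0 \<le> f 0" and x: "0 < x \<bullet> e"
  shows "0 < u x"
proof (rule ccontr)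
  assume "\<not> 0 < u x"
  then have ux: "u x = 0" using u_nonneg[of x] by simp
  obtain x1 where x1: "0 < u x1" using u_nontrivial u_nonneg by (metis less_eq_real_def)
  then have x1e: "0 < x1 \<bullet> e" using u_outside[of x1] by force
  have "\<forall>\<^sub>F y in at x1. u x1 / 2 < u y"
    by (rule order_tendstoD(1)[OF u_continuous[OF x1e, unfolded isCont_def]]) (use x1 in simp)
  then obtain r where r: "r > 0" "\<And>y. y \<noteq> x1 \<Longrightarrow> dist y x1 < r \<Longrightarrow> u x1 / 2 < u y"
    unfolding eventually_at by auto
  have big: "u x1 / 2 \<le> u y" if "dist y x1 < r" for y
    using r(2)[of y] that x1 by (cases "y = x1") auto
  define D where "D = norm (x1 - x) + r"
  define k where "k = u x1 / 2 * (\<theta> powr p * D powr - p)"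
  have D: "D > 0" using r(1) by (simp add: D_def add_nonneg_pos)
  have k: "k > 0" using x1 D \<theta>_pos by (simp add: k_def)
  define \<tau> where "\<tau> h = indicator (ball (x1 - x) r) h * k" for h
  have \<tau>: "integrable lebesgue \<tau>" "(\<integral>h. \<tau> h \<partial>lebesgue) = k * measure lebesgue (ball (x1 - x) r)"
    unfolding \<tau>_def[abs_def] by (rule integral_const_ball)+
  have reg: "regular_at u x (G x)" by (rule u_regular[OF x])
  have "G x = 0"
    by (rule regular_at_gradient_unique[OF reg zero_less_one, of _ 0]) (simp add: ux u_nonneg)
  then have rem: "remainder u x (G x) 1 h = u (x + h)" for h by (simp add: remainder_def ux)
  have "k * measure lebesgue (ball (x1 - x) r) \<le> lap K u x (G x)" if K: "kern K" for K
  proof -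
    have "(\<integral>h. \<tau> h \<partial>lebesgue) - 0 * (tail_bound * 1 powr (- 2 * s)) \<le> lap K u x (G x)"
    proof (rule lap_lower[OF K reg zero_less_one _ \<tau>(1)])
      fix h :: 'a assume h: "h \<noteq> 0"
      have "\<tau> h \<le> u (x + h) * K h"
      proof (cases "h \<in> ball (x1 - x) r")
        case True
        then have d: "norm (h - (x1 - x)) < r" by (simp add: dist_norm norm_minus_commute)
        have "norm h \<le> D" using norm_triangle_ineq[of "h - (x1 - x)" "x1 - x"] d by (simp add: D_def)
        then have "\<theta> powr p * D powr - p \<le> K h" by (rule kern_lower_ball[OF K h])
        moreover have "u x1 / 2 \<le> u (x + h)" using d by (intro big) (simp add: dist_norm algebra_simps)
        ultimately have "k \<le> u (x + h) * K h" unfolding k_def using u_nonneg by (intro mult_mono) auto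
        then show ?thesis using True by (simp add: \<tau>_def)
      next
        case False
        then show ?thesis using u_nonneg kern_nonneg[OF K] by (simp add: \<tau>_def)
      qed
      then show "\<tau> h - 0 * ((min 1 (norm h / 1))\<^sup>2 * K h) \<le> remainder u x (G x) 1 h * K h"
        unfolding rem by simp
    qed simp
    then show ?thesis using \<tau>(2) by simp
  qed
  then have "f (u x) \<le> - (k * measure lebesgue (ball (x1 - x) r))" by (rule eq_lower[OF x])
  moreover have "0 < k * measure lebesgue (ball (x1 - x) r)"
    using k content_ball_pos[OF r(1), of "x1 - x"] by simp
  ultimately show False using assms(1) ux by simp
qed

text \<open>
  In a ball of large radius $R$ the bump satisfies $\mathrm{lap}_K\, \varphi > - c_0 \varphi$, so no multiple
  \<open>t * \<phi>\<close> with \<open>t < \<delta>\<close> can touch \<open>u\<close> from below; the largest admissible \<open>t\<close> is found by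
  maximizing \<open>\<phi> / u\<close>.
\<close>

lemma nondegenerate_superlinear:
  assumes c0: "0 < c0" "0 < \<delta>" and fc: "\<And>x. u x \<le> \<delta> \<Longrightarrow> c0 * u x \<le> f (u x)"
  shows "\<exists>\<rho>>0. \<exists>c>0. \<forall>z. \<rho> \<le> z \<bullet> e \<longrightarrow> c \<le> (\<integral>y. indicator (ball z \<rho>) y * u y \<partial>lebesgue)"
proof -
  let ?w = "measure lebesgue (ball (0::'a) 1)" and ?n = "DIM('a)"
  have w: "?w > 0" by (rule unit_ball_measure_pos)
  have f0: "0 \<le> f 0" using fc[of 0] u_outside[of 0] c0(2) by simp
  \<comment> \<open>Gain from the half-radius ball: the bump is at least 3/4 there, half of the
    volume is kept, the distance to the contact point is at most 2 R, and (1/2)^n is the volume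
    scale of that ball.\<close>
  define c4 where "c4 = 3 / 8 * \<theta> powr p * 2 powr - p * (1 / 2) ^ ?n * ?w"
  have c4: "c4 > 0" using w \<theta>_pos by (simp add: c4_def)
  \<comment> \<open>The cut-off radius will be \<sigma> R. The curvature of the bump then costs t
    tail_bound \<sigma>^(2-2s) R^(-2s), which a small \<sigma> puts below the gain t c4 R^(-2s).
    With \<sigma> fixed, R is taken so large that the error from the value of the bump stays below
    c0 times that value.\<close>
  obtain \<sigma> where \<sigma>: "0 < \<sigma>" "\<sigma> \<le> 1 / 4" "tail_bound * \<sigma> powr (2 - 2 * s) < c4"
    by (rule small_powr[of "2 - 2 * s" c4 "1 / 4" tail_bound]) (use s_less c4 in auto)
  obtain R where R: "0 < R" "tail_bound * \<sigma> powr (- 2 * s) * R powr (- (2 * s)) < c0"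
    using large_powr[of "2 * s" c0 "tail_bound * \<sigma> powr (- 2 * s)"] s_pos c0 by auto
  define X where "X = R powr (- 2 * s)"
  have X: "X > 0" using R(1) by (simp add: X_def)
  define r where "r = \<sigma> * R"
  have r: "0 < r" "r \<le> R / 4" using \<sigma> R(1) by (simp_all add: r_def)
  let ?c = "3 / 4 * \<delta> * measure lebesgue (ball (0::'a) (R / 2))"
  have c: "?c > 0" using measure_ball_scale[of "R / 2" "0::'a"] w c0 R(1) by simp
  have "?c \<le> (\<integral>y. indicator (ball z (2 * R)) y * u y \<partial>lebesgue)" if z: "2 * R \<le> z \<bullet> e" for z
  proof -
    define \<phi> where "\<phi> = bump z R"
    have inside: "0 < y \<bullet> e" if "y \<in> cball z R" for y
      using cball_half_space[OF that] z R(1) by simp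
    have pos: "0 < u y" if "y \<in> cball z R" for y
      by (rule positive_in_half_space[OF f0 inside[OF that]])
    have cont: "continuous_on (cball z R) (\<lambda>y. \<phi> y / u y)"
      unfolding \<phi>_def
    proof (intro continuous_on_divide continuous_bump continuous_at_imp_continuous_on ballI u_continuous inside)
      show "R \<noteq> 0" using R(1) by simp
      show "u y \<noteq> 0" if "y \<in> cball z R" for y using pos[OF that] by simp
    qed
    obtain y0 where y0: "y0 \<in> cball z R" "\<And>y. y \<in> cball z R \<Longrightarrow> \<phi> y / u y \<le> \<phi> y0 / u y0"
      using continuous_attains_sup[OF compact_cball _ cont] R(1) by force
    have uy0: "0 < u y0" by (rule pos[OF y0(1)])
    have e0: "0 < y0 \<bullet> e" by (rule inside[OF y0(1)])
    have "0 < \<phi> z / u z" using pos[of z] R(1) by (simp add: \<phi>_def bump_center)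
    also have "\<dots> \<le> \<phi> y0 / u y0" using y0(2)[of z] R(1) by simp
    finally have \<phi>y0: "0 < \<phi> y0" using uy0 by (simp add: zero_less_divide_iff)
    \<comment> \<open>The minimum over the ball of the quotient of \<open>u\<close> by the bump:
      with this factor the bump lies below \<open>u\<close> and meets it at
      \<open>y0\<close>.\<close>
    define t where "t = u y0 / \<phi> y0"
    have t: "t > 0" using uy0 \<phi>y0 by (simp add: t_def)
    have ut: "u y0 = t * \<phi> y0" using \<phi>y0 by (simp add: t_def)
    have below: "t * \<phi> y \<le> u y" for y
    proof (cases "y \<in> cball z R")
      case True
      have "\<phi> y * u y0 \<le> \<phi> y0 * u y" using y0(2)[OF True] pos[OF True] uy0 by (simp add: field_simps)
      then show ?thesis using \<phi>y0 by (simp add: t_def field_simps)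
    next
      case False
      then have "\<phi> y = 0" unfolding \<phi>_def using R(1) by (intro bump_outside) (auto simp: dist_norm norm_minus_commute)
      then show ?thesis using u_nonneg by simp
    qed
    have \<phi>_half: "3 / 4 \<le> \<phi> y" if "y \<in> ball z (R / 2)" for y
    proof -
      have "norm (y - z) \<le> R / 2" using that by (simp add: dist_norm norm_minus_commute)
      then have "(norm (y - z))\<^sup>2 \<le> (R / 2)\<^sup>2" by (intro power_mono) auto
      then have "(norm (y - z))\<^sup>2 / R\<^sup>2 \<le> 1 / 4" using R(1) by (simp add: power_divide pos_divide_le_eq)
      then have "3 / 4 \<le> 1 - (norm (y - z))\<^sup>2 / R\<^sup>2" by linarith
      also have "\<dots> \<le> \<phi> y" by (simp add: \<phi>_def bump_def)
      finally show ?thesis .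
    qed
    have "\<delta> \<le> t"
    proof (rule ccontr)
      assume "\<not> \<delta> \<le> t"
      have "\<phi> y0 \<le> 1" unfolding \<phi>_def by (rule bump_le_one)
      then have "u y0 \<le> t * 1" unfolding ut using t by (intro mult_left_mono) auto
      then have fy: "c0 * (t * \<phi> y0) \<le> f (u y0)" using fc[of y0] ut \<open>\<not> \<delta> \<le> t\<close> by simp
      define v where "v = - (2 * t / R\<^sup>2) *\<^sub>R (y0 - z)"
      have touch: "v \<bullet> h - t / R\<^sup>2 * (norm h)\<^sup>2 \<le> u (y0 + h) - u y0" for h
      proof -
        have "t * ((- (2 / R\<^sup>2) *\<^sub>R (y0 - z)) \<bullet> h - (norm h)\<^sup>2 / R\<^sup>2) \<le> t * (\<phi> (y0 + h) - \<phi> y0)"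
          using t bump_tangent[of z R y0 h] \<phi>y0 unfolding \<phi>_def by (intro mult_left_mono) auto
        also have "\<dots> \<le> u (y0 + h) - u y0" using below[of "y0 + h"] by (simp add: ut algebra_simps)
        also have "t * ((- (2 / R\<^sup>2) *\<^sub>R (y0 - z)) \<bullet> h - (norm h)\<^sup>2 / R\<^sup>2) = v \<bullet> h - t / R\<^sup>2 * (norm h)\<^sup>2"
          by (simp add: v_def right_diff_distrib)
        finally show ?thesis .
      qed
      have reg: "regular_at u y0 (G y0)" by (rule u_regular[OF e0])
      have grad: "G y0 = v" by (rule regular_at_gradient_unique[OF reg zero_less_one touch])
      \<comment> \<open>\<open>t * \<sigma>^2\<close> pays for the curvature inside radius r, and
        \<open>t * \<phi> y0\<close> for subtracting the contact value outside it.\<close>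
      define b where "b = t * (\<sigma>\<^sup>2 + \<phi> y0)"
      have b: "b \<ge> 0" using t \<phi>y0 by (simp add: b_def)
      define k where "k = 3 / 4 * t * (\<theta> powr p * (2 * R) powr - p)"
      have k: "k \<ge> 0" using t by (simp add: k_def)
      \<comment> \<open>Inside the cut-off radius the remainder offers no gain, so that ball is
        excised. As r <= R / 4, it takes at most half of the volume of the half-radius ball.\<close>
      define \<tau> where "\<tau> h = indicator (ball (z - y0) (R / 2)) h * k - indicator (ball 0 r) h * k" for h
      have \<tau>: "integrable lebesgue \<tau>"
        "(\<integral>h. \<tau> h \<partial>lebesgue) = k * measure lebesgue (ball (0::'a) (R / 2)) - k * measure lebesgue (ball (0::'a) r)"
      proof -
        have I1: "integrable lebesgue (\<lambda>h. indicator (ball (z - y0) (R / 2)) h * k)"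
          and I2: "integrable lebesgue (\<lambda>h. indicator (ball (0::'a) r) h * k)"
          by (rule integral_const_ball(1))+
        show "integrable lebesgue \<tau>" unfolding \<tau>_def[abs_def] using I1 I2 by (rule Bochner_Integration.integrable_diff)
        show "(\<integral>h. \<tau> h \<partial>lebesgue) = k * measure lebesgue (ball (0::'a) (R / 2)) - k * measure lebesgue (ball (0::'a) r)"
          unfolding \<tau>_def Bochner_Integration.integral_diff[OF I1 I2] integral_const_ball(2)
          using measure_ball_scale[of "R / 2" "z - y0"] measure_ball_scale[of "R / 2" "0::'a"] R(1) by simp
      qed
      have "(\<integral>h. \<tau> h \<partial>lebesgue) - b * (tail_bound * r powr (- 2 * s)) \<le> lap K u y0 (G y0)" if K: "kern K" for K
      proof (rule lap_lower[OF K reg r(1) b \<tau>(1)])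
        fix h :: 'a assume h: "h \<noteq> 0"
        show "\<tau> h - b * ((min 1 (norm h / r))\<^sup>2 * K h) \<le> remainder u y0 (G y0) r h * K h"
        proof (cases "norm h < r")
          case True
          have "\<tau> h \<le> 0" using True k by (simp add: \<tau>_def indicator_def)
          moreover have "- (b * (norm h / r)\<^sup>2) * K h \<le> remainder u y0 (G y0) r h * K h"
          proof (intro mult_right_mono kern_nonneg[OF K])
            have "t / R\<^sup>2 * (norm h)\<^sup>2 = (t * \<sigma>\<^sup>2) * (norm h / r)\<^sup>2"
              using \<sigma>(1) by (simp add: r_def power_divide power_mult_distrib)
            also have "\<dots> \<le> b * (norm h / r)\<^sup>2" unfolding b_def using t \<phi>y0 by (intro mult_right_mono) (auto simp: algebra_simps)
            finally show "- (b * (norm h / r)\<^sup>2) \<le> remainder u y0 (G y0) r h"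
              using touch[of h] True by (simp add: remainder_def grad)
          qed
          moreover have "min 1 (norm h / r) = norm h / r" using True r(1) by simp
          ultimately show ?thesis by simp
        next
          case False
          have nr: "indicator (ball 0 r) h = (0::real)" using False by simp
          have m: "min 1 (norm h / r) = 1" using False r(1) by simp
          have rem: "remainder u y0 (G y0) r h = u (y0 + h) - t * \<phi> y0" using False by (simp add: remainder_def ut)
          have "\<tau> h \<le> u (y0 + h) * K h"
          proof (cases "h \<in> ball (z - y0) (R / 2)")
            case True
            then have yb: "y0 + h \<in> ball z (R / 2)" by (simp add: dist_norm algebra_simps)
            have "norm h \<le> norm (y0 + h - z) + norm (z - y0)" using norm_triangle_ineq[of "y0 + h - z" "z - y0"] by simp
            also have "\<dots> \<le> 2 * R" using yb y0(1) R(1) by (simp add: dist_norm norm_minus_commute)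
            finally have "\<theta> powr p * (2 * R) powr - p \<le> K h" by (rule kern_lower_ball[OF K h])
            moreover have "3 / 4 * t \<le> u (y0 + h)"
              using below[of "y0 + h"] mult_left_mono[OF \<phi>_half[OF yb], of t] t by linarith
            ultimately have "k \<le> u (y0 + h) * K h"
              unfolding k_def using t by (intro mult_mono) (auto simp: u_nonneg)
            then show ?thesis using True by (simp add: \<tau>_def nr)
          next
            case False
            then show ?thesis using u_nonneg kern_nonneg[OF K] by (simp add: \<tau>_def nr)
          qed
          moreover have "t * \<phi> y0 * K h \<le> b * K h"
            unfolding b_def using t by (intro mult_right_mono kern_nonneg[OF K]) (auto simp: algebra_simps)
          ultimately show ?thesis unfolding m rem by (simp add: algebra_simps)
        qed
      qed
      then have fl: "f (u y0) \<le> - ((\<integral>h. \<tau> h \<partial>lebesgue) - b * (tail_bound * r powr (- 2 * s)))"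
        by (rule eq_lower[OF e0])
      have Rn: "R powr - p * R ^ ?n = X"
        using R(1) by (simp add: X_def p_def powr_realpow[symmetric] powr_add[symmetric])
      have "t * X * c4 \<le> (\<integral>h. \<tau> h \<partial>lebesgue)"
      proof -
        have "r ^ ?n \<le> (R / 4) ^ ?n" using r by (intro power_mono) auto
        also have "\<dots> = (1 / 2) ^ ?n * (R / 2) ^ ?n" by (simp add: power_mult_distrib[symmetric])
        also have "\<dots> \<le> (1 / 2) ^ 1 * (R / 2) ^ ?n"
          using R(1) DIM_positive[where 'a = 'a] by (intro mult_right_mono power_decreasing) (auto simp: Suc_leI)
        finally have "1 / 2 * (R / 2) ^ ?n \<le> (R / 2) ^ ?n - r ^ ?n" by simp
        then have "k * ?w * (1 / 2 * (R / 2) ^ ?n) \<le> k * ?w * ((R / 2) ^ ?n - r ^ ?n)"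
          using k w by (intro mult_left_mono) auto
        also have "\<dots> = (\<integral>h. \<tau> h \<partial>lebesgue)"
          unfolding \<tau>(2) using measure_ball_scale[of "R / 2" "0::'a"] measure_ball_scale[of r "0::'a"] r(1) R(1)
          by (simp add: algebra_simps)
        also have "k * ?w * (1 / 2 * (R / 2) ^ ?n) = t * (R powr - p * R ^ ?n) * c4"
          using R(1) by (simp add: k_def c4_def powr_mult power_divide)
        finally show ?thesis unfolding Rn .
      qed
      moreover have "b * (tail_bound * r powr (- 2 * s)) = t * X * (tail_bound * \<sigma> powr (2 - 2 * s)) + t * \<phi> y0 * (tail_bound * \<sigma> powr (- 2 * s) * X)"
      proof -
        have "r powr (- 2 * s) = \<sigma> powr (- 2 * s) * X" using \<sigma>(1) R(1) by (simp add: r_def X_def powr_mult)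
        moreover have "\<sigma> powr (2 - 2 * s) = \<sigma>\<^sup>2 * \<sigma> powr (- 2 * s)"
          using \<sigma>(1) by (simp add: powr_diff powr_minus_divide powr_numeral)
        ultimately show ?thesis by (simp add: b_def algebra_simps)
      qed
      moreover have "t * X * (tail_bound * \<sigma> powr (2 - 2 * s)) < t * X * c4"
        using \<sigma>(3) t X by (intro mult_strict_left_mono) auto
      moreover have "t * \<phi> y0 * (tail_bound * \<sigma> powr (- 2 * s) * X) \<le> t * \<phi> y0 * c0"
        using R(2) t \<phi>y0 by (intro mult_left_mono) (auto simp: X_def)
      ultimately show False using fl fy by (simp add: mult_ac)
    qed
    have "?c = (\<integral>y. indicator (ball z (R / 2)) y * (3 / 4 * \<delta>) \<partial>lebesgue)"
      using integral_const_ball(2)[of z "R / 2" "3 / 4 * \<delta>"] measure_ball_scale[of "R / 2" z]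
        measure_ball_scale[of "R / 2" "0::'a"] R(1) by simp
    also have "\<dots> \<le> (\<integral>y. indicator (ball z (R / 2)) y * u y \<partial>lebesgue)"
    proof (intro integral_mono u_integrable_ball integral_const_ball(1))
      fix y
      show "indicator (ball z (R / 2)) y * (3 / 4 * \<delta>) \<le> indicator (ball z (R / 2)) y * u y"
      proof (cases "y \<in> ball z (R / 2)")
        case True
        have "\<delta> * (3 / 4) \<le> t * \<phi> y" using \<open>\<delta> \<le> t\<close> \<phi>_half[OF True] t by (intro mult_mono) auto
        then show ?thesis using below[of y] True by simp
      qed simp
    qed
    also have "\<dots> \<le> (\<integral>y. indicator (ball z (2 * R)) y * u y \<partial>lebesgue)"
      using R(1) by (intro ball_integral_mono subset_ball) simp
    finally show ?thesis .
  qed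
  then show ?thesis using R(1) c by (intro exI[of _ "2 * R"] conjI exI[of _ ?c]) auto
qed

lemma nondegenerate:
  obtains \<rho> c where "0 < \<rho>" "0 < c"
    "\<And>z. \<rho> \<le> z \<bullet> e \<Longrightarrow> c \<le> (\<integral>y. indicator (ball z \<rho>) y * u y \<partial>lebesgue)"
proof -
  have "f 0 < 0 \<or> f 0 > 0 \<or> (\<exists>c>0. \<exists>\<delta>>0. \<forall>t\<in>{0..\<delta>}. c * t \<le> f t)"
    using f_zero neq_iff[of "f 0" 0] by blast
  then consider "f 0 < 0" | "f 0 > 0" | "\<exists>c>0. \<exists>\<delta>>0. \<forall>t\<in>{0..\<delta>}. c * t \<le> f t"
    by blast
  then have "\<exists>\<rho>>0. \<exists>c>0. \<forall>z. \<rho> \<le> z \<bullet> e \<longrightarrow> c \<le> (\<integral>y. indicator (ball z \<rho>) y * u y \<partial>lebesgue)"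
  proof cases
    case 1
    then show ?thesis by (rule nondegenerate_negative)
  next
    case 2
    \<comment> \<open>For t <= \<delta> both L t and (L + 1) t are at most f 0 / 2, so f 0 - L t >=
      (L + 1) t and the superlinear case applies with constant L + 1.\<close>
    define \<delta> where "\<delta> = f 0 / (2 * (L + 1))"
    have \<delta>: "\<delta> > 0" using 2 L_nonneg unfolding \<delta>_def by (intro divide_pos_pos) auto
    have L1: "0 < L + 1" using L_nonneg by simp
    show ?thesis
    proof (rule nondegenerate_superlinear[OF L1 \<delta>])
      fix x assume "u x \<le> \<delta>"
      then have "(L + 1) * u x \<le> f 0 / 2" using L1 by (simp add: \<delta>_def field_simps)
      moreover have "L * u x \<le> (L + 1) * u x" using u_nonneg[of x] by (simp add: mult_right_mono)
      ultimately show "(L + 1) * u x \<le> f (u x)" using f_zero_bound[of x] by linarith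
    qed
  next
    case 3
    then obtain c \<delta> where c: "0 < c" "0 < \<delta>" "\<forall>t\<in>{0..\<delta>}. c * t \<le> f t" by blast
    show ?thesis by (rule nondegenerate_superlinear[OF c(1,2)]) (use c(3) u_nonneg in simp)
  qed
  then show ?thesis using that by blast
qed

section \<open>Moving planes\<close>

definition W :: "real \<Rightarrow> 'a \<Rightarrow> real" where "W l y = u (mirror e l y) - u y"

text \<open>The gradient of \<open>W l\<close> by the chain rule; \<open>mirror e 0\<close> is the
  linear part of the reflection and is self-adjoint.\<close>

definition GW :: "real \<Rightarrow> 'a \<Rightarrow> 'a" where "GW l x = mirror e 0 (G (mirror e l x)) - G x"

definition ordered_at :: "real \<Rightarrow> bool" where "ordered_at l \<longleftrightarrow> (\<forall>y. y \<bullet> e < l \<longrightarrow> 0 \<le> W l y)"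

lemma W_mirror: "W l (mirror e l y) = - W l y"
  by (simp add: W_def mirror_mirror)

lemma W_outside: "y \<bullet> e \<le> 0 \<Longrightarrow> W l y = u (mirror e l y)"
  by (simp add: W_def u_outside)

lemma W_bounds: "- M \<le> W l y" "W l y \<le> M"
  using u_nonneg[of y] u_nonneg[of "mirror e l y"] u_le[of y] u_le[of "mirror e l y"] unfolding W_def by linarith+

lemma mirrored_measurable: "(\<lambda>y. u (mirror e l y)) \<in> borel_measurable lebesgue"
  by (rule measurable_preserving[OF mirror_preserving[OF e_Basis] u_measurable])

lemma W_measurable: "W l \<in> borel_measurable lebesgue"
  unfolding W_def[abs_def] using mirrored_measurable[of l] u_measurable by measurable

lemma W_regular:
  assumes "0 < x \<bullet> e" "x \<bullet> e < l"
  shows "regular_at (W l) x (GW l x)"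
  unfolding W_def[abs_def] GW_def
  by (intro regular_at_diff regular_at_mirror u_regular) (use assms in \<open>auto simp: mirror_inner\<close>)

text \<open>Substitute for a linear equation. Each single kernel operator is linear and commutes
  with reflection, so B bounds from below the increase of \<open>lap K u\<close> from x to its
  mirror image. \<open>eq_compare\<close> carries this through the infimum, and the Lipschitz bound
  for \<open>f\<close> finishes.\<close>

lemma W_compare:
  assumes x: "0 < x \<bullet> e" "x \<bullet> e < l" and B: "\<And>K. kern K \<Longrightarrow> B \<le> lap K (W l) x (GW l x)"
  shows "B \<le> L * \<bar>W l x\<bar>"
proof -
  have m: "0 < mirror e l x \<bullet> e" using x by (simp add: mirror_inner)
  have "f (u (mirror e l x)) + B \<le> f (u x)"
  proof (rule eq_compare[OF x(1) m])
    fix K assume K: "kern K"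
    have "lap K (W l) x (GW l x) = lap K u (mirror e l x) (G (mirror e l x)) - lap K u x (G x)"
      unfolding W_def[abs_def] GW_def lap_mirror[OF K u_regular[OF m], symmetric]
      by (rule lap_diff[OF K regular_at_mirror[OF u_regular[OF m]] u_regular[OF x(1)]])
    then show "lap K u x (G x) + B \<le> lap K u (mirror e l x) (G (mirror e l x))" using B[OF K] by linarith
  qed
  then show ?thesis using f_lipschitz[of x "mirror e l x"] unfolding W_def by (simp add: abs_minus_commute)
qed

text \<open>After subtracting a bump of height \<open>\<epsilon> * m\<close>, x lies below every
  point outside the ball, so the minimum falls inside it and is a minimum over the whole half-space
  below the plane. The second conclusion is the equation at that minimum in dual form: any \<tau>
  below the folded integrand for every kernel has its integral bounded by the Lipschitz term plus
  the cost of the bump.\<close>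

lemma bump_touching:
  assumes m: "0 < m" and low: "\<And>y. y \<bullet> e < l \<Longrightarrow> - m \<le> W l y"
    and x: "W l x < - ((1 - \<epsilon>) * m)" and \<epsilon>: "0 < \<epsilon>" "\<epsilon> \<le> 1 / 2"
    and r: "0 < r" "2 * r \<le> x \<bullet> e" "2 * r \<le> l - x \<bullet> e"
  obtains x0 where "norm (x0 - x) < r"
    "\<And>\<tau>. integrable lebesgue \<tau> \<Longrightarrow> (\<And>y. l \<le> y \<bullet> e \<Longrightarrow> \<tau> y = 0) \<Longrightarrow>
       (\<And>K y. kern K \<Longrightarrow> y \<bullet> e < l \<Longrightarrow> y \<noteq> x0 \<Longrightarrow>
          \<tau> y \<le> max 0 (W l y + (1 - \<epsilon>) * m) * (K (y - x0) - K (mirror e l y - x0)) + m * K (mirror e l y - x0)) \<Longrightarrow>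
       (\<integral>y. \<tau> y \<partial>lebesgue) \<le> m * (L + \<epsilon> * (tail_bound * r powr (- 2 * s)))"
proof -
  define b where "b = \<epsilon> * m"
  have b: "0 < b" "b \<le> m / 2" using \<epsilon> m by (simp_all add: b_def)
  define z where "z y = W l y - b * bump x r y" for y
  have strip: "r \<le> y \<bullet> e \<and> r \<le> l - y \<bullet> e" if "y \<in> cball x r" for y
  proof -
    have "(y - x) \<bullet> e \<le> norm (y - x)" using Basis_le_norm[OF e_Basis, of "y - x"] by simp
    then show ?thesis using cball_half_space[OF that] that r by (simp add: inner_diff_left dist_norm norm_minus_commute)
  qed
  have cont: "continuous_on (cball x r) z"
    unfolding z_def
  proof (intro continuous_intros continuous_bump)
    show "continuous_on (cball x r) (W l)"
    proof (intro continuous_at_imp_continuous_on ballI)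
      fix y assume "y \<in> cball x r"
      then show "isCont (W l) y" using strip[of y] r(1) by (intro regular_at_isCont[OF W_regular]) auto
    qed
  qed (use r in simp)
  obtain x0 where x0: "x0 \<in> cball x r" "\<And>y. y \<in> cball x r \<Longrightarrow> z x0 \<le> z y"
    using continuous_attains_inf[OF compact_cball _ cont] r(1) by force
  have zx: "z x < - m" using x by (simp add: z_def b_def bump_center algebra_simps)
  then have zx0: "z x0 < - m" using x0(2)[of x] r(1) by simp
  have x0r: "norm (x0 - x) < r"
  proof (rule ccontr)
    assume "\<not> norm (x0 - x) < r"
    then have "z x0 = W l x0" using r(1) by (simp add: z_def bump_outside)
    moreover have "x0 \<bullet> e < l" using strip[OF x0(1)] r(1) by simp
    ultimately show False using low[of x0] zx0 by simp
  qed
  have zmin: "z x0 \<le> z y" if "y \<bullet> e < l" for y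
  proof (cases "y \<in> cball x r")
    case False
    then have "z y = W l y" using r(1) by (simp add: z_def bump_outside dist_norm norm_minus_commute)
    then show ?thesis using low[OF that] zx0 by simp
  qed (rule x0(2))
  have e0: "0 < x0 \<bullet> e" "x0 \<bullet> e < l" and rl: "r \<le> l - x0 \<bullet> e" using strip[OF x0(1)] r(1) by auto
  have bx0: "0 < bump x r x0"
  proof -
    have "(norm (x0 - x))\<^sup>2 < r\<^sup>2" using x0r by (intro power_strict_mono) auto
    then show ?thesis using r(1) by (simp add: bump_def)
  qed
  define v where "v = b *\<^sub>R (- (2 / r\<^sup>2) *\<^sub>R (x0 - x))"
  have tangent: "v \<bullet> h - b * (norm h / r)\<^sup>2 \<le> b * (bump x r (x0 + h) - bump x r x0)" for h
    using mult_left_mono[OF bump_tangent[OF bx0, of h], of b] b(1)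
    by (simp only: v_def inner_scaleR_left power_divide right_diff_distrib less_imp_le)
  have near: "(x0 + h) \<bullet> e < l" if "norm h < r" for h
    using Basis_le_norm[OF e_Basis, of h] that rl by (simp add: inner_add_left)
  have reg: "regular_at (W l) x0 (GW l x0)" by (rule W_regular[OF e0])
  have grad: "GW l x0 = v"
  proof (rule regular_at_gradient_unique[OF reg r(1)])
    fix h :: 'a assume h: "norm h < r"
    have "b * (norm h / r)\<^sup>2 = b / r\<^sup>2 * (norm h)\<^sup>2" by (simp add: power_divide)
    then show "v \<bullet> h - b / r\<^sup>2 * (norm h)\<^sup>2 \<le> W l (x0 + h) - W l x0"
      using tangent[of h] zmin[OF near[OF h]] by (simp add: z_def algebra_simps)
  qed
  have Wx0: "\<bar>W l x0\<bar> \<le> m"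
  proof -
    have "b * bump x r x0 \<le> b * 1" using b by (intro mult_left_mono bump_le_one) auto
    then have "W l x0 \<le> 0" using zx0 b m unfolding z_def by linarith
    then show ?thesis using low[OF e0(2)] by simp
  qed
  show ?thesis
  proof (rule that[OF x0r])
    fix \<tau> :: "'a \<Rightarrow> real"
    assume \<tau>: "integrable lebesgue \<tau>" and \<tau>0: "\<And>y. l \<le> y \<bullet> e \<Longrightarrow> \<tau> y = 0"
      and H: "\<And>K y. kern K \<Longrightarrow> y \<bullet> e < l \<Longrightarrow> y \<noteq> x0 \<Longrightarrow>
          \<tau> y \<le> max 0 (W l y + (1 - \<epsilon>) * m) * (K (y - x0) - K (mirror e l y - x0)) + m * K (mirror e l y - x0)"
    have "(\<integral>y. \<tau> y \<partial>lebesgue) - b * (tail_bound * r powr (- 2 * s)) \<le> lap K (W l) x0 (GW l x0)" if K: "kern K" for K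
    proof (rule antisymmetric_lap_lower[OF K reg W_mirror r(1) rl _ \<tau> \<tau>0])
      show "0 \<le> b" using b by simp
      fix y assume y: "y \<bullet> e < l" "y \<noteq> x0"
      define h where "h = y - x0"
      have yh: "y = x0 + h" by (simp add: h_def)
      define q where "q = (min 1 (norm h / r))\<^sup>2"
      define \<rho> where "\<rho> = (if norm h < r then v \<bullet> h else 0) - b * q"
      \<comment> \<open>Excess of \<open>W l\<close> over the cut-off tangent paraboloid of the bump
        at the contact point; minimality makes it nonnegative.\<close>
      define E where "E = W l y - W l x0 - \<rho>"
      define Ky where "Ky = K (y - x0)"
      define Km where "Km = K (mirror e l y - x0)"
      have rem: "remainder (W l) x0 (GW l x0) r h = E - b * q"
        by (simp add: remainder_def E_def \<rho>_def grad yh)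
      have \<rho>: "\<rho> \<le> b * (bump x r y - bump x r x0)"
      proof (cases "norm h < r")
        case True
        then show ?thesis using tangent[of h] r(1) by (simp add: \<rho>_def q_def yh min_def)
      next
        case False
        have "b * (bump x r x0 - bump x r y) \<le> b * 1"
          using b bump_le_one[of x r x0] bump_nonneg[of x r y] by (intro mult_left_mono) auto
        then show ?thesis using False r(1) by (simp add: \<rho>_def q_def min_def algebra_simps)
      qed
      have by1: "b * bump x r y \<le> b" "b * bump x r x0 \<le> b"
        using b bump_le_one mult_left_mono[of _ 1 b] by auto
      have E1: "max 0 (W l y + (1 - \<epsilon>) * m) \<le> E"
        using zmin[OF y(1)] zx0 \<rho> by1 unfolding E_def z_def b_def by (simp add: algebra_simps)
      \<comment> \<open>The value \<open>z x0 < - m\<close> enters twice and the bump terms cost at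
        most 2 b, so b <= m / 2 is exactly what is required; hence the condition \<epsilon> <=
        1/2.\<close>
      have E2: "m - E \<le> - W l y - W l x0"
        using zx0 \<rho> by1 b unfolding E_def z_def right_diff_distrib by linarith
      have Km: "0 \<le> Km" "Km \<le> Ky" unfolding Km_def Ky_def
        using kern_nonneg[OF K] kern_mirror_le[OF K y(1) e0(2) y(2)] by auto
      have "\<tau> y \<le> max 0 (W l y + (1 - \<epsilon>) * m) * (Ky - Km) + m * Km"
        unfolding Ky_def Km_def by (rule H[OF K y])
      also have "\<dots> \<le> E * (Ky - Km) + m * Km" using E1 Km by (intro add_right_mono mult_right_mono) auto
      also have "\<dots> = E * Ky + (m - E) * Km" by (simp add: algebra_simps)
      also have "\<dots> \<le> E * Ky + (- W l y - W l x0) * Km" using E2 Km by (intro add_left_mono mult_right_mono) auto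
      finally have "\<tau> y - b * (q * Ky) \<le> (E - b * q) * Ky + (- W l y - W l x0) * Km" by (simp add: algebra_simps)
      then show "\<tau> y - b * ((min 1 (norm (y - x0) / r))\<^sup>2 * K (y - x0))
          \<le> remainder (W l) x0 (GW l x0) r (y - x0) * K (y - x0) + (- W l y - W l x0) * K (mirror e l y - x0)"
        unfolding rem[unfolded h_def] unfolding Ky_def Km_def q_def h_def .
    qed
    then have "(\<integral>y. \<tau> y \<partial>lebesgue) - b * (tail_bound * r powr (- 2 * s)) \<le> L * \<bar>W l x0\<bar>"
      by (rule W_compare[OF e0])
    also have "\<dots> \<le> L * m" using Wx0 L_nonneg by (rule mult_left_mono)
    finally show "(\<integral>y. \<tau> y \<partial>lebesgue) \<le> m * (L + \<epsilon> * (tail_bound * r powr (- 2 * s)))"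
      by (simp add: b_def algebra_simps)
  qed
qed

section \<open>Location of the contact point, and mass beyond the boundary\<close>

lemma norm_mirror_diff: "norm (mirror e l y - mirror e l z) = norm (y - z)"
  using mirror_add[of l z "y - z"] norm_mirror0[of "y - z"] by simp

lemma inner_e_le: "\<bar>h \<bullet> e\<bar> \<le> norm h"
  by (rule Basis_le_norm[OF e_Basis])

lemma inner_ee: "e \<bullet> e = 1"
  using e_Basis by (simp add: inner_Basis)

text \<open>With a bump of radius d/2, where d is the distance to the nearer hyperplane, a ball of
  radius d yields the gain. It lies either below the boundary, where \<open>W l\<close> is
  nonnegative, or above the plane, where antisymmetry supplies the sign. Gain and bump cost both
  scale like m d^(-2s), which leaves L to bound d from below, uniformly in l and m.\<close>

lemma distance_bound:
  obtains d0 \<epsilon> where "0 < d0" "0 < \<epsilon>" "\<epsilon> \<le> 1 / 2"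
    "\<And>l m x. 0 < m \<Longrightarrow> (\<And>y. y \<bullet> e < l \<Longrightarrow> - m \<le> W l y) \<Longrightarrow> x \<bullet> e < l \<Longrightarrow> W l x < - ((1 - \<epsilon>) * m) \<Longrightarrow>
       d0 \<le> x \<bullet> e \<and> d0 \<le> l - x \<bullet> e"
proof -
  let ?w = "measure lebesgue (ball (0::'a) 1)" and ?n = "DIM('a)"
  have w: "?w > 0" by (rule unit_ball_measure_pos)
  \<comment> \<open>The kernel is at least \<theta>^p (4 d)^(-p) on the ball used below, whose
    volume is d^n \<open>?w\<close>; the factor 1/2 comes from m / 2.\<close>
  define c2 where "c2 = \<theta> powr p * 4 powr - p * ?w / 2"
  have c2: "c2 > 0" using w \<theta>_pos by (simp add: c2_def)
  \<comment> \<open>Limits the cost of the bump of radius d/2 to half of the gain, for all d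
    simultaneously.\<close>
  define \<epsilon> where "\<epsilon> = min (1 / 2) (c2 / 2 / (tail_bound * (1 / 2) powr (- 2 * s)))"
  have tp: "0 < tail_bound * (1 / 2) powr (- 2 * s)" using tail_bound(1) by simp
  have \<epsilon>: "0 < \<epsilon>" "\<epsilon> \<le> 1 / 2" using c2 tp by (simp_all add: \<epsilon>_def)
  have \<epsilon>c: "\<epsilon> * (tail_bound * (1 / 2) powr (- 2 * s)) \<le> c2 / 2"
    unfolding pos_le_divide_eq[OF tp, symmetric] by (simp add: \<epsilon>_def)
  obtain d0 where d0: "0 < d0" "d0 \<le> 1" "L * d0 powr (2 * s) < c2 / 2"
    by (rule small_powr[of "2 * s" "c2 / 2" 1 L]) (use s_pos c2 in auto)
  show ?thesis
  proof (rule that[OF d0(1) \<epsilon>])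
    fix l m :: real and x :: 'a
    assume m: "0 < m" and low: "\<And>y. y \<bullet> e < l \<Longrightarrow> - m \<le> W l y"
      and xl: "x \<bullet> e < l" and x: "W l x < - ((1 - \<epsilon>) * m)"
    have "(1 - \<epsilon>) * m > 0" using \<epsilon> m by simp
    then have xe: "0 < x \<bullet> e" using x W_outside[of x l] u_nonneg[of "mirror e l x"] by (cases "x \<bullet> e \<le> 0") auto
    define d where "d = min (x \<bullet> e) (l - x \<bullet> e)"
    have d: "0 < d" using xe xl by (simp add: d_def)
    have "0 < d / 2" "2 * (d / 2) \<le> x \<bullet> e" "2 * (d / 2) \<le> l - x \<bullet> e" using d by (auto simp: d_def)
    from bump_touching[OF m low x \<epsilon> this] obtain x0 where x0: "norm (x0 - x) < d / 2" and
      T: "\<And>\<tau>. integrable lebesgue \<tau> \<Longrightarrow> (\<And>y. l \<le> y \<bullet> e \<Longrightarrow> \<tau> y = 0) \<Longrightarrow>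
       (\<And>K y. kern K \<Longrightarrow> y \<bullet> e < l \<Longrightarrow> y \<noteq> x0 \<Longrightarrow>
          \<tau> y \<le> max 0 (W l y + (1 - \<epsilon>) * m) * (K (y - x0) - K (mirror e l y - x0)) + m * K (mirror e l y - x0)) \<Longrightarrow>
       (\<integral>y. \<tau> y \<partial>lebesgue) \<le> m * (L + \<epsilon> * (tail_bound * (d / 2) powr (- 2 * s)))"
      by blast
    have "\<bar>(x0 - x) \<bullet> e\<bar> < d / 2" using inner_e_le[of "x0 - x"] x0 by linarith
    then have x0e: "x0 \<bullet> e < x \<bullet> e + d / 2" "x \<bullet> e - d / 2 < x0 \<bullet> e"
      unfolding inner_diff_left by linarith+
    have "d \<le> l - x \<bullet> e" by (simp add: d_def)
    then have x0l: "x0 \<bullet> e < l" using d x0e by linarith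
    define k where "k = m / 2 * (\<theta> powr p * (4 * d) powr - p)"
    have "\<exists>S. (\<exists>c. S = ball c d) \<and> (\<forall>y\<in>S. y \<bullet> e < l \<and> (\<forall>K. kern K \<longrightarrow> y \<noteq> x0 \<longrightarrow>
       k \<le> max 0 (W l y + (1 - \<epsilon>) * m) * (K (y - x0) - K (mirror e l y - x0)) + m * K (mirror e l y - x0)))"
    proof (cases "x \<bullet> e \<le> l - x \<bullet> e")
      case True
      then have dx: "d = x \<bullet> e" by (simp add: d_def)
      \<comment> \<open>Since x0 has height less than 3d/2, the ball of radius d about c lies below
        the boundary and within 4d of x0.\<close>
      define c where "c = x0 - (3 * d) *\<^sub>R e"
      have "y \<bullet> e < l \<and> (\<forall>K. kern K \<longrightarrow> y \<noteq> x0 \<longrightarrow>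
         k \<le> max 0 (W l y + (1 - \<epsilon>) * m) * (K (y - x0) - K (mirror e l y - x0)) + m * K (mirror e l y - x0))"
        if "y \<in> ball c d" for y
      proof -
        have yc: "norm (y - c) < d" using that by (simp add: dist_norm norm_minus_commute)
        have "(y - c) \<bullet> e \<le> norm (y - c)" using inner_e_le[of "y - c"] by simp
        then have ye: "y \<bullet> e < 0" using yc x0e dx unfolding c_def by (simp add: inner_diff_left inner_ee)
        then have yl: "y \<bullet> e < l" using xe xl by simp
        have eq: "y - x0 = (y - c) - (3 * d) *\<^sub>R e" by (simp add: c_def)
        have "norm (y - x0) \<le> norm (y - c) + 3 * d"
          unfolding eq using norm_triangle_ineq4[of "y - c" "(3 * d) *\<^sub>R e"] d e_Basis by simp
        then have n: "norm (y - x0) \<le> 4 * d" using yc by simp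
        have W0: "0 \<le> W l y" using W_outside[of y l] ye u_nonneg by simp
        have "k \<le> max 0 (W l y + (1 - \<epsilon>) * m) * (K (y - x0) - K (mirror e l y - x0)) + m * K (mirror e l y - x0)"
          if K: "kern K" and yx: "y \<noteq> x0" for K
        proof -
          have "m / 2 \<le> (1 - \<epsilon>) * m" using \<epsilon>(2) m mult_right_mono[of "1 / 2" "1 - \<epsilon>" m] by simp
          then have "m / 2 \<le> W l y + (1 - \<epsilon>) * m" using W0 by linarith
          then have "m / 2 \<le> max 0 (W l y + (1 - \<epsilon>) * m)" by (rule max.coboundedI2)
          \<comment> \<open>The extra term \<open>m * K (mirror e l y - x0)\<close> more than
            restores what the reflected kernel subtracts, so the full value m/2 K (y - x0) survives
            without any quantitative gap.\<close>
          then have 1: "m / 2 * (K (y - x0) - K (mirror e l y - x0))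
             \<le> max 0 (W l y + (1 - \<epsilon>) * m) * (K (y - x0) - K (mirror e l y - x0))"
            using kern_mirror_le[OF K yl x0l yx] by (intro mult_right_mono) auto
          have 2: "0 \<le> m / 2 * K (mirror e l y - x0)" using m kern_nonneg[OF K] by simp
          have "k \<le> m / 2 * K (y - x0)"
            unfolding k_def using m yx n by (intro mult_left_mono kern_lower_ball[OF K]) auto
          then show ?thesis using 1 2 by (simp add: algebra_simps)
        qed
        then show ?thesis using yl by blast
      qed
      then show ?thesis by blast
    next
      case False
      then have dx: "d = l - x \<bullet> e" by (simp add: d_def)
      \<comment> \<open>x0 is less than 3d/2 below the plane, so this ball lies above it.
        Integration runs over its mirror image, with the gain carried by the kernel at the mirrored
        point.\<close>
      define c where "c = x0 + (3 * d) *\<^sub>R e"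
      have "y \<bullet> e < l \<and> (\<forall>K. kern K \<longrightarrow> y \<noteq> x0 \<longrightarrow>
         k \<le> max 0 (W l y + (1 - \<epsilon>) * m) * (K (y - x0) - K (mirror e l y - x0)) + m * K (mirror e l y - x0))"
        if y: "y \<in> ball (mirror e l c) d" for y
      proof -
        have yc: "norm (mirror e l y - c) < d"
          using y norm_mirror_diff[of l y "mirror e l c"] by (simp add: dist_norm norm_minus_commute mirror_mirror)
        have ce: "c \<bullet> e = x0 \<bullet> e + 3 * d" by (simp add: c_def inner_add_left inner_ee)
        have "- norm (mirror e l y - c) \<le> (mirror e l y - c) \<bullet> e" using inner_e_le[of "mirror e l y - c"] by linarith
        then have "l < mirror e l y \<bullet> e" using yc x0e dx d unfolding inner_diff_left ce by linarith
        then have yl: "y \<bullet> e < l" by (simp add: mirror_inner)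
        have eq: "mirror e l y - x0 = (mirror e l y - c) + (3 * d) *\<^sub>R e" by (simp add: c_def)
        have "norm (mirror e l y - x0) \<le> norm (mirror e l y - c) + 3 * d"
          unfolding eq using norm_triangle_ineq[of "mirror e l y - c" "(3 * d) *\<^sub>R e"] d e_Basis by simp
        then have n: "norm (mirror e l y - x0) \<le> 4 * d" using yc by simp
        have ne: "mirror e l y - x0 \<noteq> 0" using \<open>l < mirror e l y \<bullet> e\<close> x0l by auto
        have "k \<le> max 0 (W l y + (1 - \<epsilon>) * m) * (K (y - x0) - K (mirror e l y - x0)) + m * K (mirror e l y - x0)"
          if K: "kern K" and yx: "y \<noteq> x0" for K
        proof -
          have 1: "0 \<le> max 0 (W l y + (1 - \<epsilon>) * m) * (K (y - x0) - K (mirror e l y - x0))"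
            using kern_mirror_le[OF K yl x0l yx] by (intro mult_nonneg_nonneg) auto
          have "k \<le> m * K (mirror e l y - x0)"
            unfolding k_def using m n ne by (intro mult_mono kern_lower_ball[OF K]) auto
          then show ?thesis using 1 by simp
        qed
        then show ?thesis using yl by blast
      qed
      then show ?thesis by blast
    qed
    then obtain c where S: "\<And>y. y \<in> ball c d \<Longrightarrow> y \<bullet> e < l"
      and Sk: "\<And>y K. y \<in> ball c d \<Longrightarrow> kern K \<Longrightarrow> y \<noteq> x0 \<Longrightarrow>
        k \<le> max 0 (W l y + (1 - \<epsilon>) * m) * (K (y - x0) - K (mirror e l y - x0)) + m * K (mirror e l y - x0)"
      by blast
    define \<tau> where "\<tau> y = indicator (ball c d) y * k" for y
    have \<tau>i: "integrable lebesgue \<tau>" and \<tau>I: "(\<integral>y. \<tau> y \<partial>lebesgue) = k * measure lebesgue (ball c d)"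
      unfolding \<tau>_def[abs_def] by (rule integral_const_ball)+
    have "k * measure lebesgue (ball c d) \<le> m * (L + \<epsilon> * (tail_bound * (d / 2) powr (- 2 * s)))"
      unfolding \<tau>I[symmetric]
    proof (rule T[OF \<tau>i])
      show "\<tau> y = 0" if "l \<le> y \<bullet> e" for y
        using S[of y] that by (auto simp: \<tau>_def indicator_def)
      fix K y assume K: "kern K" and y: "y \<bullet> e < l" "y \<noteq> x0"
      show "\<tau> y \<le> max 0 (W l y + (1 - \<epsilon>) * m) * (K (y - x0) - K (mirror e l y - x0)) + m * K (mirror e l y - x0)"
      proof (cases "y \<in> ball c d")
        case True
        then show ?thesis using Sk[OF True K y(2)] by (simp add: \<tau>_def)
      next
        case False
        then show ?thesis using kern_mirror_le[OF K y(1) x0l y(2)] kern_nonneg[OF K] m by (simp add: \<tau>_def)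
      qed
    qed
    moreover have "k * measure lebesgue (ball c d) = m * (c2 * d powr (- 2 * s))"
    proof -
      have "d powr - p * d ^ ?n = d powr (- 2 * s)"
        using d by (simp add: p_def powr_realpow[symmetric] powr_add[symmetric])
      moreover have "k * measure lebesgue (ball c d) = m * (c2 * (d powr - p * d ^ ?n))"
        using measure_ball_scale[of d c] d by (simp add: k_def c2_def powr_mult)
      ultimately show ?thesis by simp
    qed
    moreover have "(d / 2) powr (- 2 * s) = (1 / 2) powr (- 2 * s) * d powr (- 2 * s)"
      using powr_mult[of "1 / 2" d "- 2 * s"] d by simp
    ultimately have "m * (c2 * d powr (- 2 * s)) \<le> m * (L + \<epsilon> * (tail_bound * (1 / 2) powr (- 2 * s)) * d powr (- 2 * s))"
      by (simp add: mult.assoc)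
    then have "c2 * d powr (- 2 * s) \<le> L + \<epsilon> * (tail_bound * (1 / 2) powr (- 2 * s)) * d powr (- 2 * s)"
      using m by simp
    also have "\<dots> \<le> L + c2 / 2 * d powr (- 2 * s)"
      using \<epsilon>c by (intro add_left_mono mult_right_mono) auto
    finally have "c2 / 2 * d powr (- 2 * s) \<le> L" by (simp add: algebra_simps)
    then have "c2 / 2 * d powr (- 2 * s) * d powr (2 * s) \<le> L * d powr (2 * s)"
      by (intro mult_right_mono) auto
    moreover have "d powr (- 2 * s) * d powr (2 * s) = 1" using d by (simp add: powr_add[symmetric])
    ultimately have "c2 / 2 \<le> L * d powr (2 * s)" by (simp only: mult.assoc mult_1_right)
    moreover have "L * d powr (2 * s) \<le> L * d0 powr (2 * s)" if "d < d0"
      using that d L_nonneg s_pos by (intro mult_left_mono powr_mono2) auto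
    ultimately have "d0 \<le> d" using d0(3) by force
    then show "d0 \<le> x \<bullet> e \<and> d0 \<le> l - x \<bullet> e" by (simp add: d_def)
  qed
qed

lemma mirrored_ball_integral:
  "(\<integral>y. indicator (ball c r) y * u (mirror e l y) \<partial>lebesgue) = (\<integral>y. indicator (ball (mirror e l c) r) y * u y \<partial>lebesgue)"
proof -
  have "(\<lambda>y. indicator (ball (mirror e l c) r) y * u y) \<in> borel_measurable lebesgue"
    using u_integrable_ball by blast
  from integral_preserving[OF mirror_preserving[OF e_Basis] this]
  have "(\<integral>y. indicator (ball (mirror e l c) r) (mirror e l y) * u (mirror e l y) \<partial>lebesgue)
     = (\<integral>y. indicator (ball (mirror e l c) r) y * u y \<partial>lebesgue)" .
  moreover have "indicator (ball (mirror e l c) r) (mirror e l y) = (indicator (ball c r) y :: real)" for y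
    by (simp add: indicator_def dist_norm norm_mirror_diff)
  ultimately show ?thesis by simp
qed

lemma mirrored_integrable_ball: "integrable lebesgue (\<lambda>y. indicator (ball c r) y * u (mirror e l y))"
  using u_nonneg u_le by (intro integrable_on_ball[OF mirrored_measurable, where C = M]) simp

text \<open>Directly below x, at depth 2 \<rho> under the boundary, lies a ball whose mirror image
  has centre at height at least \<rho>, where \<open>nondegenerate\<close> bounds the integral of
  \<open>u\<close>. The resulting \<tau> works for all kernels, and its mass depends on r and
  \<Lambda> but not on l or x.\<close>

lemma far_mass:
  assumes r: "0 < r" and \<Lambda>: "0 < \<Lambda>"
  obtains k where "0 < k" "\<And>l x. l \<le> \<Lambda> \<Longrightarrow> 0 < x \<bullet> e \<Longrightarrow> r \<le> l - x \<bullet> e \<Longrightarrow>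
    \<exists>\<tau>. integrable lebesgue \<tau> \<and> k \<le> (\<integral>y. \<tau> y \<partial>lebesgue) \<and> (\<forall>y. 0 \<le> y \<bullet> e \<longrightarrow> \<tau> y = 0) \<and>
      (\<forall>K y. kern K \<longrightarrow> y \<bullet> e < 0 \<longrightarrow> \<tau> y \<le> u (mirror e l y) * (K (y - x) - K (mirror e l y - x)))"
proof -
  obtain \<rho> c where \<rho>: "0 < \<rho>" and c: "0 < c"
    and nd: "\<And>z. \<rho> \<le> z \<bullet> e \<Longrightarrow> c \<le> (\<integral>y. indicator (ball z \<rho>) y * u y \<partial>lebesgue)"
    by (rule nondegenerate) blast
  define D where "D = \<Lambda> + 3 * \<rho>"
  have D: "D > 0" using \<Lambda> \<rho> by (simp add: D_def)
  \<comment> \<open>On that ball l - y . e is at least \<rho>, l - x . e is at least r, and |y - x|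
    is at most D, as \<open>kern_mirror_gap\<close> requires.\<close>
  define q where "q = 4 * (\<theta> / \<Theta>)\<^sup>2 * (\<rho> * r) / D\<^sup>2"
  have q: "q > 0" using \<theta>_pos \<Theta>_pos \<rho> r D by (simp add: q_def)
  define k where "k = gap q * (\<theta> powr p * D powr - p)"
  have k: "k > 0" using gap_pos[OF q] \<theta>_pos D by (simp add: k_def)
  show ?thesis
  proof (rule that[of "k * c"])
    show "0 < k * c" using k c by simp
    fix l x assume l: "l \<le> \<Lambda>" and x: "0 < x \<bullet> e" "r \<le> l - x \<bullet> e"
    define z where "z = x - (x \<bullet> e + 2 * \<rho>) *\<^sub>R e"
    have ze: "z \<bullet> e = - 2 * \<rho>" by (simp add: z_def inner_diff_left inner_ee)
    define \<tau> where "\<tau> y = k * (indicator (ball z \<rho>) y * u (mirror e l y))" for y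
    have mz: "\<rho> \<le> mirror e l z \<bullet> e" using ze x r \<rho> by (simp add: mirror_inner)
    have yz: "y \<bullet> e < - \<rho>" if "y \<in> ball z \<rho>" for y
    proof -
      have "norm (y - z) < \<rho>" using that by (simp add: dist_norm norm_minus_commute)
      then show ?thesis using inner_e_le[of "y - z"] ze unfolding inner_diff_left by linarith
    qed
    have "integrable lebesgue \<tau>" unfolding \<tau>_def[abs_def] using mirrored_integrable_ball by simp
    moreover have "k * c \<le> (\<integral>y. \<tau> y \<partial>lebesgue)"
      unfolding \<tau>_def using nd[OF mz] k by (simp add: mirrored_ball_integral)
    moreover have "\<tau> y = 0" if "0 \<le> y \<bullet> e" for y
      using yz[of y] that \<rho> by (auto simp: \<tau>_def indicator_def)
    moreover have "\<tau> y \<le> u (mirror e l y) * (K (y - x) - K (mirror e l y - x))"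
      if K: "kern K" and ye: "y \<bullet> e < 0" for K y
    proof -
      have yl: "y \<bullet> e < l" "x \<bullet> e < l" "y \<noteq> x" using ye x r by auto
      show ?thesis
      proof (cases "y \<in> ball z \<rho>")
        case True
        have eq: "y - x = (y - z) - (x \<bullet> e + 2 * \<rho>) *\<^sub>R e" by (simp add: z_def)
        have "norm (y - x) \<le> norm (y - z) + (x \<bullet> e + 2 * \<rho>)"
          unfolding eq using norm_triangle_ineq4[of "y - z" "(x \<bullet> e + 2 * \<rho>) *\<^sub>R e"] x \<rho> e_Basis by simp
        also have "\<dots> \<le> D" using True l x r by (simp add: D_def dist_norm norm_minus_commute)
        finally have n: "norm (y - x) \<le> D" .
        have "gap q * K (y - x) \<le> K (y - x) - K (mirror e l y - x)"
        proof (rule kern_mirror_gap[OF K yl])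
          have "q * (norm (y - x))\<^sup>2 \<le> q * D\<^sup>2" using n q by (intro mult_left_mono power_mono) auto
          also have "\<dots> = 4 * (\<theta> / \<Theta>)\<^sup>2 * (\<rho> * r)" using D by (simp add: q_def)
          also have "\<dots> \<le> 4 * (\<theta> / \<Theta>)\<^sup>2 * ((l - y \<bullet> e) * (l - x \<bullet> e))"
            using yz[OF True] x r \<rho> by (intro mult_left_mono mult_mono) auto
          finally show "q * (norm (y - x))\<^sup>2 \<le> 4 * (\<theta> / \<Theta>)\<^sup>2 * ((l - y \<bullet> e) * (l - x \<bullet> e))" .
        qed (use q in simp)
        moreover have "k \<le> gap q * K (y - x)"
          unfolding k_def using gap_pos[OF q] n yl by (intro mult_left_mono kern_lower_ball[OF K]) auto
        ultimately have "u (mirror e l y) * k \<le> u (mirror e l y) * (K (y - x) - K (mirror e l y - x))"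
          using u_nonneg by (intro mult_left_mono) auto
        then show ?thesis using True by (simp add: \<tau>_def mult.commute)
      next
        case False
        then show ?thesis using u_nonneg kern_mirror_le[OF K yl] by (simp add: \<tau>_def)
      qed
    qed
    ultimately show "\<exists>\<tau>. integrable lebesgue \<tau> \<and> k * c \<le> (\<integral>y. \<tau> y \<partial>lebesgue) \<and> (\<forall>y. 0 \<le> y \<bullet> e \<longrightarrow> \<tau> y = 0) \<and>
      (\<forall>K y. kern K \<longrightarrow> y \<bullet> e < 0 \<longrightarrow> \<tau> y \<le> u (mirror e l y) * (K (y - x) - K (mirror e l y - x)))"
      by blast
  qed
qed

text \<open>The slightly smaller ball about b is contained in the ball about a, so at most a thin
  shell weighted by M is lost. This modulus of continuity involves \<open>u\<close> only through its
  bound.\<close>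

lemma ball_integral_shift:
  assumes t: "0 < t" and \<eta>: "0 < \<eta>"
  obtains \<kappa> where "0 < \<kappa>" "\<And>a b. norm (a - b) \<le> \<kappa> \<Longrightarrow>
    (\<integral>y. indicator (ball b t) y * u y \<partial>lebesgue) - \<eta> < (\<integral>y. indicator (ball a t) y * u y \<partial>lebesgue)"
proof -
  let ?m = "\<lambda>r. measure lebesgue (ball (0::'a) r)"
  let ?w = "?m 1" and ?n = "DIM('a)"
  have "((\<lambda>d. M * (t ^ ?n * ?w - (t - d) ^ ?n * ?w)) \<longlongrightarrow> M * (t ^ ?n * ?w - (t - 0) ^ ?n * ?w)) (at_right 0)"
    by (intro tendsto_intros)
  then have "\<forall>\<^sub>F d in at_right 0. M * (t ^ ?n * ?w - (t - d) ^ ?n * ?w) < \<eta>"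
    using \<eta> by (intro order_tendstoD(2)) auto
  moreover have "\<forall>\<^sub>F d in at_right (0::real). d < t" by (rule order_tendstoD(2)[OF tendsto_ident_at t])
  ultimately have "\<forall>\<^sub>F d in at_right 0. 0 < d \<and> d < t \<and> M * (t ^ ?n * ?w - (t - d) ^ ?n * ?w) < \<eta>"
    using eventually_at_right_less[of "0::real"] by eventually_elim auto
  then obtain d where d: "0 < d" "d < t" "M * (t ^ ?n * ?w - (t - d) ^ ?n * ?w) < \<eta>"
    using eventually_happens[of _ "at_right (0::real)"] by auto
  show ?thesis
  proof (rule that[OF d(1)])
    fix a b :: 'a assume ab: "norm (a - b) \<le> d"
    let ?I = "\<lambda>z r. (\<integral>y. indicator (ball z r) y * u y \<partial>lebesgue)"
    have "?I b t - ?I b (t - d) = (\<integral>y. indicator (ball b t) y * u y - indicator (ball b (t - d)) y * u y \<partial>lebesgue)"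
      by (rule Bochner_Integration.integral_diff[symmetric]; rule u_integrable_ball)
    also have "\<dots> \<le> (\<integral>y. indicator (ball b t) y * M - indicator (ball b (t - d)) y * M \<partial>lebesgue)"
      using d u_le u_nonneg by (intro integral_mono Bochner_Integration.integrable_diff u_integrable_ball integral_const_ball(1))
        (auto simp: indicator_def)
    also have "\<dots> = M * measure lebesgue (ball b t) - M * measure lebesgue (ball b (t - d))"
      unfolding integral_const_ball(2)[symmetric]
      by (rule Bochner_Integration.integral_diff; rule integral_const_ball(1))
    also have "\<dots> = M * (t ^ ?n * ?w - (t - d) ^ ?n * ?w)"
      using measure_ball_scale[of t b] measure_ball_scale[of "t - d" b] t d by (simp add: right_diff_distrib)
    finally have "?I b t - ?I b (t - d) < \<eta>" using d(3) by simp
    moreover have "?I b (t - d) \<le> ?I a t"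
    proof (intro ball_integral_mono subsetI)
      fix y assume "y \<in> ball b (t - d)"
      then show "y \<in> ball a t" using ab dist_triangle[of a y b] by (simp add: dist_norm)
    qed
    ultimately show "?I b t - \<eta> < ?I a t" by linarith
  qed
qed

text \<open>The displacement \<kappa> does not depend on the plane from which the step starts, which
  is what allows iteration. At one contact point the inequality of \<open>bump_touching\<close> is
  used with two choices of \<tau>: mass beyond the boundary bounds m from below, and the excess near
  the contact point bounds the local average of \<open>W l\<close> from above.\<close>

lemma ordered_step:
  assumes \<Lambda>: "0 < \<Lambda>"
  obtains \<kappa> where "0 < \<kappa>"
    "\<And>l0 l. ordered_at l0 \<Longrightarrow> l0 \<le> l \<Longrightarrow> l \<le> l0 + \<kappa> \<Longrightarrow> l \<le> \<Lambda> \<Longrightarrow> ordered_at l"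
proof -
  let ?w = "measure lebesgue (ball (0::'a) 1)" and ?n = "DIM('a)"
  have w: "?w > 0" by (rule unit_ball_measure_pos)
  obtain d0 \<epsilon>1 where d0: "0 < d0" and \<epsilon>1: "0 < \<epsilon>1" "\<epsilon>1 \<le> 1 / 2"
    and dist: "\<And>l m x. 0 < m \<Longrightarrow> (\<And>y. y \<bullet> e < l \<Longrightarrow> - m \<le> W l y) \<Longrightarrow> x \<bullet> e < l \<Longrightarrow>
       W l x < - ((1 - \<epsilon>1) * m) \<Longrightarrow> d0 \<le> x \<bullet> e \<and> d0 \<le> l - x \<bullet> e"
    by (rule distance_bound) blast
  \<comment> \<open>Fits points within r/2 of x0 when x0 is at least r below the plane: the product
    of the two depths is then at least r^2 / 2.\<close>
  define q where "q = 8 * (\<theta> / \<Theta>)\<^sup>2"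
  have q: "q > 0" using \<theta>_pos \<Theta>_pos by (simp add: q_def)
  \<comment> \<open>Normalised so that \<open>k5 * ?B\<close> below equals
    \<open>8 * c6 * r powr (- 2 * s)\<close>. As L r^(2s) and \<epsilon> tail_bound are each at most
    c6, the quotient A / k5 is at most a quarter of the volume of the small ball.\<close>
  define c6 where "c6 = gap q * \<theta> powr p * ?w * (1 / 2) powr (- 2 * s) / 8"
  have c6: "c6 > 0" using gap_pos[OF q] \<theta>_pos w by (simp add: c6_def)
  obtain r where r: "0 < r" "r \<le> d0 / 2" "L * r powr (2 * s) < c6"
    by (rule small_powr[of "2 * s" c6 "d0 / 2" L]) (use s_pos c6 d0 in auto)
  \<comment> \<open>\<open>\<epsilon>1\<close> gives access to the distance bound, 1/4 yields 1/4 -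
    (1 - \<epsilon>) <= -1/2 in the final average, and the last entry limits the cost of the
    bump.\<close>
  define \<epsilon> where "\<epsilon> = min (min \<epsilon>1 (1 / 4)) (c6 / tail_bound)"
  have \<epsilon>: "0 < \<epsilon>" "\<epsilon> \<le> \<epsilon>1" "\<epsilon> \<le> 1 / 4" "\<epsilon> * tail_bound \<le> c6"
  proof -
    show "0 < \<epsilon>" using \<epsilon>1 c6 tail_bound(1) by (simp add: \<epsilon>_def)
    show "\<epsilon> \<le> \<epsilon>1" "\<epsilon> \<le> 1 / 4" unfolding \<epsilon>_def by linarith+
    show "\<epsilon> * tail_bound \<le> c6" unfolding pos_le_divide_eq[OF tail_bound(1), symmetric] by (simp add: \<epsilon>_def)
  qed
  have \<epsilon>2: "\<epsilon> \<le> 1 / 2" using \<epsilon> by simp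
  obtain k where k: "0 < k" and far: "\<And>l x. l \<le> \<Lambda> \<Longrightarrow> 0 < x \<bullet> e \<Longrightarrow> r \<le> l - x \<bullet> e \<Longrightarrow>
    \<exists>\<tau>. integrable lebesgue \<tau> \<and> k \<le> (\<integral>y. \<tau> y \<partial>lebesgue) \<and> (\<forall>y. 0 \<le> y \<bullet> e \<longrightarrow> \<tau> y = 0) \<and>
      (\<forall>K y. kern K \<longrightarrow> y \<bullet> e < 0 \<longrightarrow> \<tau> y \<le> u (mirror e l y) * (K (y - x) - K (mirror e l y - x)))"
    by (rule far_mass[OF r(1) \<Lambda>]) blast
  define A where "A = L + \<epsilon> * (tail_bound * r powr (- 2 * s))"
  have A: "A > 0" using L_nonneg \<epsilon>(1) tail_bound(1) r(1) by (simp add: A_def add_nonneg_pos)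
  define c1 where "c1 = k / A"
  have c1: "c1 > 0" using k A by (simp add: c1_def)
  let ?B = "measure lebesgue (ball (0::'a) (r / 2))"
  have B: "?B > 0" using measure_ball_scale[of "r / 2" "0::'a"] w r(1) by simp
  have "0 < c1 * ?B / 2" using c1 B by simp
  obtain \<kappa>1 where \<kappa>1: "0 < \<kappa>1" and shift: "\<And>a b. norm (a - b) \<le> \<kappa>1 \<Longrightarrow>
    (\<integral>y. indicator (ball b (r / 2)) y * u y \<partial>lebesgue) - c1 * ?B / 2 < (\<integral>y. indicator (ball a (r / 2)) y * u y \<partial>lebesgue)"
    by (rule ball_integral_shift[of "r / 2" "c1 * ?B / 2"]) (use r(1) \<open>0 < c1 * ?B / 2\<close> in auto)
  \<comment> \<open>The reflected centre moves twice as far as the plane, hence \<kappa>1 / 2; the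
    entry r / 2 keeps the ball about x0 below the old plane too.\<close>
  define \<kappa> where "\<kappa> = min (\<kappa>1 / 2) (r / 2)"
  have \<kappa>: "0 < \<kappa>" "2 * \<kappa> \<le> \<kappa>1" "\<kappa> \<le> r / 2" using \<kappa>1 r(1) by (auto simp: \<kappa>_def)
  show ?thesis
  proof (rule that[OF \<kappa>(1)])
    fix l0 l assume P0: "ordered_at l0" and l: "l0 \<le> l" "l \<le> l0 + \<kappa>" "l \<le> \<Lambda>"
    show "ordered_at l"
    proof (rule ccontr)
      assume "\<not> ordered_at l"
      then obtain y1 where y1: "y1 \<bullet> e < l" "W l y1 < 0" unfolding ordered_at_def by force
      define V where "V = W l ` {y. y \<bullet> e < l}"
      have bb: "bdd_below V" using W_bounds(1) by (intro bdd_belowI[of _ "- M"]) (auto simp: V_def)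
      have ne: "V \<noteq> {}" using y1 by (auto simp: V_def)
      define m where "m = - Inf V"
      have low: "- m \<le> W l y" if "y \<bullet> e < l" for y
        unfolding m_def using cInf_lower[OF _ bb] that by (simp add: V_def)
      have m: "0 < m" using low[OF y1(1)] y1(2) by simp
      have "0 < \<epsilon> * m" using \<epsilon>(1) m by simp
      then have "Inf V < - ((1 - \<epsilon>) * m)" unfolding left_diff_distrib by (simp add: m_def)
      then obtain x where xl: "x \<bullet> e < l" and x: "W l x < - ((1 - \<epsilon>) * m)"
        using cInf_lessD[OF ne] by (auto simp: V_def)
      have "(1 - \<epsilon>1) * m \<le> (1 - \<epsilon>) * m" using \<epsilon>(2) m by (intro mult_right_mono) auto
      then have "W l x < - ((1 - \<epsilon>1) * m)" using x by linarith
      from dist[OF m low xl this] have xd: "2 * r \<le> x \<bullet> e" "2 * r \<le> l - x \<bullet> e" using r(2) by auto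
      obtain x0 where x0: "norm (x0 - x) < r" and
        T: "\<And>\<tau>. integrable lebesgue \<tau> \<Longrightarrow> (\<And>y. l \<le> y \<bullet> e \<Longrightarrow> \<tau> y = 0) \<Longrightarrow>
         (\<And>K y. kern K \<Longrightarrow> y \<bullet> e < l \<Longrightarrow> y \<noteq> x0 \<Longrightarrow>
            \<tau> y \<le> max 0 (W l y + (1 - \<epsilon>) * m) * (K (y - x0) - K (mirror e l y - x0)) + m * K (mirror e l y - x0)) \<Longrightarrow>
         (\<integral>y. \<tau> y \<partial>lebesgue) \<le> m * A"
        using bump_touching[OF m low x \<epsilon>(1) \<epsilon>2 r(1) xd] unfolding A_def by blast
      have "\<bar>x0 \<bullet> e - x \<bullet> e\<bar> < r" using inner_e_le[of "x0 - x"] x0 unfolding inner_diff_left by linarith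
      then have x0e: "0 < x0 \<bullet> e" "r \<le> l - x0 \<bullet> e" using xd r(1) by linarith+
      have x0l: "x0 \<bullet> e < l" using x0e r(1) by simp
      have nonneg: "0 \<le> max 0 (W l y + (1 - \<epsilon>) * m) * (K (y - x0) - K (mirror e l y - x0)) + m * K (mirror e l y - x0)"
        if "kern K" "y \<bullet> e < l" "y \<noteq> x0" for K y
        using kern_mirror_le[OF that(1,2) x0l that(3)] kern_nonneg[OF that(1)] m
        by (intro add_nonneg_nonneg mult_nonneg_nonneg) auto
      \<comment> \<open>First use of the contact inequality. The resulting lower bound c1 for m does
        not involve l or l0, so the tolerance for the shift could be fixed in advance.\<close>
      have "k \<le> m * A"
      proof -
        obtain \<tau> where \<tau>: "integrable lebesgue \<tau>" "k \<le> (\<integral>y. \<tau> y \<partial>lebesgue)" "\<And>y. 0 \<le> y \<bullet> e \<Longrightarrow> \<tau> y = 0"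
          and \<tau>K: "\<And>K y. kern K \<Longrightarrow> y \<bullet> e < 0 \<Longrightarrow> \<tau> y \<le> u (mirror e l y) * (K (y - x0) - K (mirror e l y - x0))"
          using far[OF l(3) x0e] by blast
        have "(\<integral>y. \<tau> y \<partial>lebesgue) \<le> m * A"
        proof (rule T[OF \<tau>(1)])
          show "\<tau> y = 0" if "l \<le> y \<bullet> e" for y using that \<tau>(3)[of y] x0e x0l by simp
          fix K y assume K: "kern K" and y: "y \<bullet> e < l" "y \<noteq> x0"
          show "\<tau> y \<le> max 0 (W l y + (1 - \<epsilon>) * m) * (K (y - x0) - K (mirror e l y - x0)) + m * K (mirror e l y - x0)"
          proof (cases "y \<bullet> e < 0")
            case True
            have "0 \<le> (1 - \<epsilon>) * m" using \<epsilon>2 m by simp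
            then have "u (mirror e l y) \<le> max 0 (W l y + (1 - \<epsilon>) * m)" using W_outside[of y l] True by simp
            then have "u (mirror e l y) * (K (y - x0) - K (mirror e l y - x0))
               \<le> max 0 (W l y + (1 - \<epsilon>) * m) * (K (y - x0) - K (mirror e l y - x0))"
              using kern_mirror_le[OF K y(1) x0l y(2)] by (intro mult_right_mono) auto
            moreover have "0 \<le> m * K (mirror e l y - x0)" using m kern_nonneg[OF K] by simp
            ultimately show ?thesis using \<tau>K[OF K True] by linarith
          next
            case False
            then show ?thesis using \<tau>(3)[of y] nonneg[OF K y] by simp
          qed
        qed
        then show ?thesis using \<tau>(2) by linarith
      qed
      then have mc: "c1 \<le> m" using A by (simp add: c1_def pos_divide_le_eq)
      \<comment> \<open>Second use: the integral of this positive part is controlled, and it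
        dominates \<open>W l + (1 - \<epsilon>) * m\<close>; a small integral thus keeps
        \<open>W l\<close> near - m on average.\<close>
      define E where "E y = max 0 (W l y + (1 - \<epsilon>) * m)" for y
      have Em: "E \<in> borel_measurable lebesgue" unfolding E_def[abs_def] using W_measurable[of l] by measurable
      have Eb: "\<bar>E y\<bar> \<le> M + \<bar>(1 - \<epsilon>) * m\<bar>" for y using W_bounds[of l y] M_pos unfolding E_def by auto
      have Ei: "integrable lebesgue (\<lambda>y. indicator (ball x0 (r / 2)) y * E y)" by (rule integrable_on_ball[OF Em Eb])
      have inball: "y \<bullet> e < l - r / 2 \<and> norm (y - x0) \<le> r / 2" if "y \<in> ball x0 (r / 2)" for y
      proof -
        have "norm (y - x0) < r / 2" using that by (simp add: dist_norm norm_minus_commute)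
        then show ?thesis using inner_e_le[of "y - x0"] x0e unfolding inner_diff_left by linarith
      qed
      define k5 where "k5 = gap q * (\<theta> powr p * (r / 2) powr - p)"
      have k5: "k5 > 0" using gap_pos[OF q] \<theta>_pos r(1) by (simp add: k5_def)
      have "(\<integral>y. k5 * (indicator (ball x0 (r / 2)) y * E y) \<partial>lebesgue) \<le> m * A"
      proof (rule T)
        show "integrable lebesgue (\<lambda>y. k5 * (indicator (ball x0 (r / 2)) y * E y))" using Ei by simp
        show "k5 * (indicator (ball x0 (r / 2)) y * E y) = 0" if "l \<le> y \<bullet> e" for y
          using inball[of y] that r(1) by (auto simp: indicator_def)
        fix K y assume K: "kern K" and y: "y \<bullet> e < l" "y \<noteq> x0"
        show "k5 * (indicator (ball x0 (r / 2)) y * E y)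
           \<le> max 0 (W l y + (1 - \<epsilon>) * m) * (K (y - x0) - K (mirror e l y - x0)) + m * K (mirror e l y - x0)"
        proof (cases "y \<in> ball x0 (r / 2)")
          case True
          have "gap q * K (y - x0) \<le> K (y - x0) - K (mirror e l y - x0)"
          proof (rule kern_mirror_gap[OF K y(1) x0l y(2)])
            have "q * (norm (y - x0))\<^sup>2 \<le> q * (r / 2)\<^sup>2" using inball[OF True] q by (intro mult_left_mono power_mono) auto
            also have "\<dots> = 4 * (\<theta> / \<Theta>)\<^sup>2 * ((r / 2) * r)" by (simp add: q_def power2_eq_square)
            also have "\<dots> \<le> 4 * (\<theta> / \<Theta>)\<^sup>2 * ((l - y \<bullet> e) * (l - x0 \<bullet> e))"
              using inball[OF True] x0e r(1) by (intro mult_left_mono mult_mono) auto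
            finally show "q * (norm (y - x0))\<^sup>2 \<le> 4 * (\<theta> / \<Theta>)\<^sup>2 * ((l - y \<bullet> e) * (l - x0 \<bullet> e))" .
          qed (use q in simp)
          moreover have "k5 \<le> gap q * K (y - x0)"
            unfolding k5_def using gap_pos[OF q] inball[OF True] y by (intro mult_left_mono kern_lower_ball[OF K]) auto
          ultimately have "k5 \<le> K (y - x0) - K (mirror e l y - x0)" by linarith
          then have "E y * k5 \<le> E y * (K (y - x0) - K (mirror e l y - x0))"
            by (intro mult_left_mono) (auto simp: E_def)
          moreover have "0 \<le> m * K (mirror e l y - x0)" using m kern_nonneg[OF K] by simp
          ultimately have "E y * k5 \<le> E y * (K (y - x0) - K (mirror e l y - x0)) + m * K (mirror e l y - x0)" by linarith
          then show ?thesis using True by (simp add: E_def mult.commute)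
        next
          case False
          then show ?thesis using nonneg[OF K y] by simp
        qed
      qed
      then have E_le: "(\<integral>y. indicator (ball x0 (r / 2)) y * E y \<partial>lebesgue) \<le> m * A / k5"
        using k5 by (simp add: pos_le_divide_eq mult.commute)
      have Ak: "A / k5 \<le> ?B / 4"
      proof -
        have "A * r powr (2 * s) = L * r powr (2 * s) + \<epsilon> * tail_bound * (r powr (- 2 * s) * r powr (2 * s))"
          by (simp add: A_def algebra_simps)
        also have "r powr (- 2 * s) * r powr (2 * s) = 1" using r(1) by (simp add: powr_add[symmetric])
        finally have A1: "A * r powr (2 * s) \<le> 2 * c6" using r(3) \<epsilon>(4) by simp
        have "k5 * ?B = gap q * \<theta> powr p * ?w * ((r / 2) powr - p * (r / 2) ^ ?n)"
          using measure_ball_scale[of "r / 2" "0::'a"] r(1) by (simp add: k5_def)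
        also have "(r / 2) powr - p * (r / 2) ^ ?n = (r / 2) powr (- 2 * s)"
          using r(1) powr_realpow[of "r / 2" ?n] powr_add[of "r / 2" "- p" "real ?n"] by (simp add: p_def)
        also have "(r / 2) powr (- 2 * s) = (1 / 2) powr (- 2 * s) * r powr (- 2 * s)"
          using powr_mult[of "1 / 2" r "- 2 * s"] r(1) by simp
        finally have kB: "k5 * ?B = 8 * c6 * r powr (- 2 * s)" by (simp add: c6_def)
        have "A = A * r powr (2 * s) * r powr (- 2 * s)"
          using r(1) by (simp add: mult.assoc powr_add[symmetric])
        also have "\<dots> \<le> 2 * c6 * r powr (- 2 * s)" using A1 by (intro mult_right_mono) auto
        also have "\<dots> = k5 * ?B / 4" unfolding kB by simp
        finally show ?thesis using k5 by (simp add: pos_divide_le_eq mult.commute)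
      qed
      have "(\<integral>y. indicator (ball x0 (r / 2)) y * W l y \<partial>lebesgue) + (1 - \<epsilon>) * m * ?B
          = (\<integral>y. indicator (ball x0 (r / 2)) y * W l y + indicator (ball x0 (r / 2)) y * ((1 - \<epsilon>) * m) \<partial>lebesgue)"
      proof -
        have "\<bar>W l y\<bar> \<le> M" for y using W_bounds[of l y] by linarith
        then have "integrable lebesgue (\<lambda>y. indicator (ball x0 (r / 2)) y * W l y)"
          by (rule integrable_on_ball[OF W_measurable])
        moreover have "measure lebesgue (ball x0 (r / 2)) = ?B"
          using measure_ball_scale[of "r / 2" "0::'a"] measure_ball_scale[of "r / 2" x0] r(1) by simp
        ultimately show ?thesis
          using integral_const_ball[of x0 "r / 2" "(1 - \<epsilon>) * m"] by simp
      qed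
      also have "\<dots> \<le> (\<integral>y. indicator (ball x0 (r / 2)) y * E y \<partial>lebesgue)"
      proof (intro integral_mono Bochner_Integration.integrable_add integral_const_ball(1) Ei)
        have "\<bar>W l y\<bar> \<le> M" for y using W_bounds[of l y] by linarith
        then show "integrable lebesgue (\<lambda>y. indicator (ball x0 (r / 2)) y * W l y)"
          by (rule integrable_on_ball[OF W_measurable])
      qed (auto simp: E_def indicator_def)
      also have "\<dots> \<le> m * (?B / 4)"
        using E_le mult_left_mono[OF Ak, of m] m unfolding times_divide_eq_right by linarith
      finally have Wavg: "(\<integral>y. indicator (ball x0 (r / 2)) y * W l y \<partial>lebesgue) \<le> m * (?B / 4) - (1 - \<epsilon>) * m * ?B" by linarith
      have "m * ?B * (1 / 4 - (1 - \<epsilon>)) \<le> m * ?B * (- (1 / 2))"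
        using \<epsilon>(3) m B by (intro mult_left_mono) auto
      then have "m * (?B / 4) - (1 - \<epsilon>) * m * ?B \<le> - (m * ?B / 2)" by (simp add: algebra_simps)
      moreover have "c1 * ?B / 2 \<le> m * ?B / 2" using mc B by (simp add: mult_right_mono)
      ultimately have neg: "(\<integral>y. indicator (ball x0 (r / 2)) y * W l y \<partial>lebesgue) \<le> - (c1 * ?B / 2)"
        using Wavg by linarith
      \<comment> \<open>The integral of \<open>u\<close> over the ball about x0 is common to both
        planes and cancels, leaving two reflected balls that nearly coincide.\<close>
      have split: "(\<integral>y. indicator (ball x0 (r / 2)) y * W t y \<partial>lebesgue)
         = (\<integral>y. indicator (ball (mirror e t x0) (r / 2)) y * u y \<partial>lebesgue) - (\<integral>y. indicator (ball x0 (r / 2)) y * u y \<partial>lebesgue)" for t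
        unfolding mirrored_ball_integral[symmetric] W_def right_diff_distrib
        by (rule Bochner_Integration.integral_diff[OF mirrored_integrable_ball u_integrable_ball])
      have "0 \<le> (\<integral>y. indicator (ball x0 (r / 2)) y * W l0 y \<partial>lebesgue)"
      proof (intro integral_nonneg_AE AE_I2)
        fix y
        show "0 \<le> indicator (ball x0 (r / 2)) y * W l0 y"
        proof (cases "y \<in> ball x0 (r / 2)")
          case True
          then have "y \<bullet> e < l0" using inball[OF True] l(2) \<kappa>(3) by linarith
          then show ?thesis using P0 by (simp add: ordered_at_def)
        qed simp
      qed
      moreover have "mirror e l x0 - mirror e l0 x0 = (2 * (l - l0)) *\<^sub>R e"
        by (simp add: mirror_def algebra_simps)
      then have "norm (mirror e l x0 - mirror e l0 x0) \<le> \<kappa>1" using l \<kappa>(2) e_Basis by simp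
      ultimately show False using shift neg unfolding split by fastforce
    qed
  qed
qed

lemma ordered_everywhere: "0 \<le> l \<Longrightarrow> ordered_at l"
proof -
  assume l: "0 \<le> l"
  obtain \<kappa> where \<kappa>: "0 < \<kappa>"
    and step: "\<And>l0 l'. ordered_at l0 \<Longrightarrow> l0 \<le> l' \<Longrightarrow> l' \<le> l0 + \<kappa> \<Longrightarrow> l' \<le> l + 1 \<Longrightarrow> ordered_at l'"
    using ordered_step[of "l + 1"] l by (metis add_nonneg_pos zero_less_one)
  \<comment> \<open>The minimum truncates the last step so that the iteration ends exactly at l; the
    height passed to \<open>ordered_step\<close> is l + 1, which is positive also for l = 0.\<close>
  have "ordered_at (min (real k * \<kappa>) l)" for k
  proof (induction k)
    case 0
    then show ?case using l W_outside u_nonneg by (simp add: ordered_at_def)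
  next
    case (Suc k)
    then show ?case by (rule step) (use \<kappa> in \<open>auto simp: min_def algebra_simps\<close>)
  qed
  moreover obtain k where "l < real k * \<kappa>" using reals_Archimedean3[OF \<kappa>] by blast
  ultimately show ?thesis by (metis min.absorb4 min.commute min.absorb3)
qed

text \<open>Strong maximum principle for \<open>W l\<close>: at a zero below the plane the gradient
  vanishes, so \<open>far_mass\<close> makes every kernel operator at least k > 0, whereas
  \<open>W_compare\<close> allows at most L times 0.\<close>

lemma strictly_ordered:
  assumes x: "0 < x \<bullet> e" "x \<bullet> e < l"
  shows "0 < W l x"
proof (rule ccontr)
  assume "\<not> 0 < W l x"
  have ge: "0 \<le> W l y" if "y \<bullet> e < l" for y using ordered_everywhere[of l] x that by (simp add: ordered_at_def)
  have Wx: "W l x = 0" using \<open>\<not> 0 < W l x\<close> ge[OF x(2)] by simp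
  define r where "r = l - x \<bullet> e"
  have r: "0 < r" "r \<le> l - x \<bullet> e" using x by (simp_all add: r_def)
  have l: "0 < l" using x by simp
  obtain k where k: "0 < k" and far: "\<And>l' x. l' \<le> l \<Longrightarrow> 0 < x \<bullet> e \<Longrightarrow> r \<le> l' - x \<bullet> e \<Longrightarrow>
    \<exists>\<tau>. integrable lebesgue \<tau> \<and> k \<le> (\<integral>y. \<tau> y \<partial>lebesgue) \<and> (\<forall>y. 0 \<le> y \<bullet> e \<longrightarrow> \<tau> y = 0) \<and>
      (\<forall>K y. kern K \<longrightarrow> y \<bullet> e < 0 \<longrightarrow> \<tau> y \<le> u (mirror e l' y) * (K (y - x) - K (mirror e l' y - x)))"
    by (rule far_mass[OF r(1) l]) blast
  obtain \<tau> where \<tau>: "integrable lebesgue \<tau>" "k \<le> (\<integral>y. \<tau> y \<partial>lebesgue)" "\<And>y. 0 \<le> y \<bullet> e \<Longrightarrow> \<tau> y = 0"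
    and \<tau>K: "\<And>K y. kern K \<Longrightarrow> y \<bullet> e < 0 \<Longrightarrow> \<tau> y \<le> u (mirror e l y) * (K (y - x) - K (mirror e l y - x))"
    using far[OF order_refl x(1) r(2)] by blast
  have reg: "regular_at (W l) x (GW l x)" by (rule W_regular[OF x])
  have "GW l x = 0"
  proof (rule regular_at_gradient_unique[OF reg r(1)])
    fix h :: 'a assume h: "norm h < r"
    have "(x + h) \<bullet> e < l" using inner_e_le[of h] h by (simp add: inner_add_left r_def)
    then show "0 \<bullet> h - 0 * (norm h)\<^sup>2 \<le> W l (x + h) - W l x" using ge Wx by simp
  qed
  then have rem: "remainder (W l) x (GW l x) r (y - x) = W l y" for y by (simp add: remainder_def Wx)
  have "k \<le> lap K (W l) x (GW l x)" if K: "kern K" for K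
  proof -
    have "(\<integral>y. \<tau> y \<partial>lebesgue) - 0 * (tail_bound * r powr (- 2 * s)) \<le> lap K (W l) x (GW l x)"
    proof (rule antisymmetric_lap_lower[OF K reg W_mirror r _ \<tau>(1)])
      show "\<tau> y = 0" if "l \<le> y \<bullet> e" for y using \<tau>(3)[of y] that l by simp
      fix y assume y: "y \<bullet> e < l" "y \<noteq> x"
      have "\<tau> y \<le> W l y * (K (y - x) - K (mirror e l y - x))"
      proof (cases "y \<bullet> e < 0")
        case True
        then show ?thesis using \<tau>K[OF K True] W_outside[of y l] by simp
      next
        case False
        then show ?thesis using \<tau>(3)[of y] ge[OF y(1)] kern_mirror_le[OF K y(1) x(2) y(2)] by simp
      qed
      then show "\<tau> y - 0 * ((min 1 (norm (y - x) / r))\<^sup>2 * K (y - x))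
         \<le> remainder (W l) x (GW l x) r (y - x) * K (y - x) + (- W l y - W l x) * K (mirror e l y - x)"
        unfolding rem Wx by (simp add: algebra_simps)
    qed simp
    then show ?thesis using \<tau>(2) by simp
  qed
  then have "k \<le> L * \<bar>W l x\<bar>" by (rule W_compare[OF x])
  then show False using k Wx by simp
qed

text \<open>The plane half way between the two points reflects one into the other.\<close>

theorem strictly_increasing:
  assumes "0 < x \<bullet> e" "0 < t"
  shows "u x < u (x + t *\<^sub>R e)"
  using strictly_ordered[of x "x \<bullet> e + t / 2"] assms by (simp add: W_def mirror_def)

text \<open>Strict increase from the point at half the height, where \<open>u\<close> is
  nonnegative.\<close>

theorem positive:
  assumes "0 < x \<bullet> e"
  shows "0 < u x"
proof -
  define y where "y = x - (x \<bullet> e / 2) *\<^sub>R e"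
  have "0 < y \<bullet> e" using assms by (simp add: y_def inner_diff_left inner_ee)
  then have "u y < u (y + (x \<bullet> e / 2) *\<^sub>R e)" using assms by (intro strictly_increasing) auto
  then show ?thesis using u_nonneg[of y] by (simp add: y_def)
qed

end

section \<open>Admissible matrices and the Bellman operator\<close>

lemma mat_vector_mult: "mat c *v v = c *\<^sub>R (v :: real ^ 'n)"
  by (simp add: vec_eq_iff matrix_vector_mult_def mat_def if_distrib[of "\<lambda>t. t * _"] cong: if_cong)

lemma symmetric_matrix_inner:
  fixes A :: "real ^ 'n ^ 'n"
  assumes "transpose A = A"
  shows "(A *v x) \<bullet> y = x \<bullet> (A *v y)"
  by (metis assms dot_lmul_matrix transpose_matrix_vector)

text \<open>Form bounds become norm bounds without diagonalisation. The lower one is Cauchy-Schwarz;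
  for the upper one, polarise with the image of v rescaled to the length of v, where the subtracted
  form value is nonnegative.\<close>

lemma symmetric_matrix_bounds:
  fixes A :: "real ^ 'n ^ 'n"
  assumes sym: "transpose A = A" and lower: "loewner_le (mat a) A" and upper: "loewner_le A (mat b)" and a: "0 < a"
  shows "a * norm v \<le> norm (A *v v)" "norm (A *v v) \<le> b * norm v"
proof -
  have lo: "a * (x \<bullet> x) \<le> x \<bullet> (A *v x)" and up: "x \<bullet> (A *v x) \<le> b * (x \<bullet> x)" for x
    using lower upper by (simp_all add: loewner_le_def mat_vector_mult)
  have "a * (norm v * norm v) \<le> norm v * norm (A *v v)"
    using lo[of v] norm_cauchy_schwarz[of v "A *v v"] by (simp add: dot_square_norm power2_eq_square)
  then show "a * norm v \<le> norm (A *v v)"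
    by (cases "norm v = 0") (auto simp: mult.left_commute)
  show "norm (A *v v) \<le> b * norm v"
  proof (cases "A *v v = 0 \<or> v = 0")
    case True
    have "0 \<le> a * (v \<bullet> v)" using a by simp
    then have "0 \<le> b * (v \<bullet> v)" using lo[of v] up[of v] by linarith
    then have "0 \<le> b" if "v \<noteq> 0" using that inner_gt_zero_iff[of v] by (simp add: zero_le_mult_iff not_le[symmetric])
    then show ?thesis using True by (cases "v = 0") auto
  next
    case False
    define w where "w = A *v v"
    define t where "t = norm v / norm w"
    have w: "norm w > 0" and v: "norm v > 0" using False by (auto simp: w_def)
    have nt: "norm (t *\<^sub>R w) = norm v" using w by (simp add: t_def)
    let ?z = "t *\<^sub>R w"
    have "4 * (t * (w \<bullet> w)) = (v + ?z) \<bullet> (A *v (v + ?z)) - (v - ?z) \<bullet> (A *v (v - ?z))"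
    proof -
      have "v \<bullet> (A *v ?z) = ?z \<bullet> (A *v v)" using symmetric_matrix_inner[OF sym, of v ?z] by (simp add: inner_commute)
      moreover have "?z \<bullet> (A *v v) = t * (w \<bullet> w)" by (simp add: w_def)
      ultimately show ?thesis
        by (simp only: matrix_vector_right_distrib matrix_vector_mult_diff_distrib inner_add_left inner_add_right inner_diff_left inner_diff_right)
    qed
    also have "\<dots> \<le> b * ((v + ?z) \<bullet> (v + ?z))"
    proof -
      have "0 \<le> a * ((v - ?z) \<bullet> (v - ?z))" using a by simp
      then show ?thesis using lo[of "v - ?z"] up[of "v + ?z"] by linarith
    qed
    also have "\<dots> \<le> b * (4 * (v \<bullet> v))"
    proof (intro mult_left_mono)
      have "norm (v + ?z) \<le> 2 * norm v" using norm_triangle_ineq[of v ?z] nt by simp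
      then have "(norm (v + ?z))\<^sup>2 \<le> (2 * norm v)\<^sup>2" by (intro power_mono) auto
      then show "(v + ?z) \<bullet> (v + ?z) \<le> 4 * (v \<bullet> v)" by (simp add: power2_norm_eq_inner[symmetric] power_mult_distrib)
      have "0 < a * (v \<bullet> v)" using a v by simp
      then have "0 < b * (v \<bullet> v)" using lo[of v] up[of v] by linarith
      moreover have "0 < v \<bullet> v" using v by simp
      ultimately show "0 \<le> b" using zero_less_mult_pos2 less_imp_le by blast
    qed
    finally have "t * (norm w)\<^sup>2 \<le> b * (norm v)\<^sup>2" by (simp add: power2_norm_eq_inner)
    moreover have "t * (norm w)\<^sup>2 = norm w * norm v" using w by (simp add: t_def power2_eq_square)
    ultimately have "norm w * norm v \<le> b * (norm v)\<^sup>2" by linarith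
    then have "norm w * norm v \<le> b * norm v * norm v" by (simp only: power2_eq_square mult.assoc)
    then show ?thesis using v by (simp add: w_def)
  qed
qed

text \<open>The lower form bound makes A injective, hence invertible. Testing both form bounds on e
  places its eigenvalue a between \<theta> and \<Theta>. By symmetry the inverse divides the e
  component by a, and expanding the square gives the identity.\<close>

lemma admissible_inverse:
  fixes A :: "real ^ 'n ^ 'n" and e :: "real ^ 'n"
  assumes A: "A \<in> admissible_matrices \<theta> \<Theta> e" and \<theta>: "0 < \<theta>" and e: "norm e = 1"
  shows "norm h / \<Theta> \<le> norm (matrix_inv A *v h)" "norm (matrix_inv A *v h) \<le> norm h / \<theta>"
    and "\<exists>a. \<theta> \<le> a \<and> a \<le> \<Theta> \<and> (\<forall>h c. (norm (matrix_inv A *v (h + c *\<^sub>R e)))\<^sup>2 =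
      (norm (matrix_inv A *v h))\<^sup>2 + ((h \<bullet> e + c)\<^sup>2 - (h \<bullet> e)\<^sup>2) / a\<^sup>2)"
proof -
  from A have sym: "transpose A = A" and lower: "loewner_le (mat \<theta>) A" and upper: "loewner_le A (mat \<Theta>)"
    and ev: "is_eigenvector A e" by (auto simp: admissible_matrices_def)
  note bd = symmetric_matrix_bounds[OF sym lower upper \<theta>]
  have "\<forall>x. A *v x = 0 \<longrightarrow> x = 0"
    using bd(1) \<theta> by (metis mult_le_0_iff norm_le_zero_iff norm_zero not_le)
  then have "\<exists>B. B ** A = mat 1" by (simp add: matrix_left_invertible_ker)
  then have "\<exists>B. A ** B = mat 1 \<and> B ** A = mat 1" by (metis matrix_left_right_inverse)
  then have inv: "A ** matrix_inv A = mat 1 \<and> matrix_inv A ** A = mat 1"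
    unfolding matrix_inv_def by (rule someI_ex)
  define B where "B = matrix_inv A"
  have AB: "A *v (B *v h) = h" for h using inv by (simp add: B_def matrix_vector_mul_assoc)
  have BA: "B *v (A *v h) = h" for h using inv by (simp add: B_def matrix_vector_mul_assoc)
  obtain a where a: "A *v e = a *\<^sub>R e" using ev by (auto simp: is_eigenvector_def)
  have ee: "e \<bullet> e = 1" using e by (simp add: dot_square_norm)
  have a1: "\<theta> \<le> a" "a \<le> \<Theta>"
    using lower upper by (auto simp: loewner_le_def mat_vector_mult a ee dest!: spec[of _ e])
  have a0: "a > 0" and \<Theta>: "\<Theta> > 0" using a1 \<theta> by auto
  show "norm h / \<Theta> \<le> norm (matrix_inv A *v h)"
    using bd(2)[of "B *v h"] \<Theta> unfolding AB by (simp add: B_def pos_divide_le_eq mult.commute)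
  show "norm (matrix_inv A *v h) \<le> norm h / \<theta>"
    using bd(1)[of "B *v h"] \<theta> unfolding AB by (simp add: B_def pos_le_divide_eq mult.commute)
  have Be: "B *v e = (1 / a) *\<^sub>R e"
  proof -
    have "e = B *v (a *\<^sub>R e)" using BA[of e] by (simp add: a)
    also have "\<dots> = a *\<^sub>R (B *v e)" by (simp add: matrix_vector_mult_scaleR)
    finally have "(1 / a) *\<^sub>R e = (1 / a) *\<^sub>R (a *\<^sub>R (B *v e))" by simp
    then show ?thesis using a0 by simp
  qed
  have Bhe: "(B *v h) \<bullet> e = h \<bullet> e / a" for h
  proof -
    have "a * ((B *v h) \<bullet> e) = (B *v h) \<bullet> (A *v e)" by (simp add: a)
    also have "\<dots> = h \<bullet> e" using symmetric_matrix_inner[OF sym, of "B *v h" e] by (simp add: AB)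
    finally show ?thesis using a0 by (simp add: field_simps)
  qed
  have "(norm (B *v (h + c *\<^sub>R e)))\<^sup>2 = (norm (B *v h))\<^sup>2 + ((h \<bullet> e + c)\<^sup>2 - (h \<bullet> e)\<^sup>2) / a\<^sup>2" for h c
  proof -
    have "B *v (h + c *\<^sub>R e) = B *v h + (c / a) *\<^sub>R e"
      by (simp add: matrix_vector_right_distrib matrix_vector_mult_scaleR Be)
    then have "(norm (B *v (h + c *\<^sub>R e)))\<^sup>2 = (norm (B *v h))\<^sup>2 + 2 * ((B *v h) \<bullet> ((c / a) *\<^sub>R e)) + (norm ((c / a) *\<^sub>R e))\<^sup>2"
      by (simp only: power2_norm_eq_inner inner_add_left inner_add_right inner_commute[of e])
        (simp add: inner_commute)
    also have "(norm ((c / a) *\<^sub>R e))\<^sup>2 = c\<^sup>2 / a\<^sup>2" by (simp add: e power_divide)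
    also have "2 * ((B *v h) \<bullet> ((c / a) *\<^sub>R e)) = 2 * c * (h \<bullet> e) / a\<^sup>2" by (simp add: Bhe power2_eq_square)
    finally show ?thesis by (simp add: power2_sum add_divide_distrib diff_divide_distrib)
  qed
  then show "\<exists>a. \<theta> \<le> a \<and> a \<le> \<Theta> \<and> (\<forall>h c. (norm (matrix_inv A *v (h + c *\<^sub>R e)))\<^sup>2 =
      (norm (matrix_inv A *v h))\<^sup>2 + ((h \<bullet> e + c)\<^sup>2 - (h \<bullet> e)\<^sup>2) / a\<^sup>2)"
    using a1 unfolding B_def by blast
qed

lemma admissible_nonempty:
  assumes "\<theta> \<le> \<Theta>" "e \<noteq> 0"
  shows "mat \<theta> \<in> admissible_matrices \<theta> \<Theta> e"
  using assms by (auto simp: admissible_matrices_def loewner_le_def is_eigenvector_def mat_vector_mult mult_right_mono)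

lemma square_powr_half: "0 \<le> (t::real) \<Longrightarrow> (t\<^sup>2) powr (- q / 2) = t powr - q"
  by (cases "t = 0") (simp_all add: powr_powr flip: powr_numeral)

text \<open>Everything follows from the two-sided length bounds and the expansion along e. Reversing
  the e component is the case c = -2 (h . e), which leaves the squared component unchanged.\<close>

lemma admissible_kern:
  fixes A :: "real ^ 'n ^ 'n" and e :: "real ^ 'n"
  assumes ks: "kernel_setting e \<theta> \<Theta> s" and A: "A \<in> admissible_matrices \<theta> \<Theta> e"
  shows "kernel_setting.kern e \<theta> \<Theta> s (\<lambda>h. 1 / norm (matrix_inv A *v h) powr (real CARD('n) + 2 * s))"
proof -
  interpret kernel_setting e \<theta> \<Theta> s by (rule ks)
  define N where "N h = norm (matrix_inv A *v h)" for h
  have pp: "real CARD('n) + 2 * s = p" by (simp add: p_def)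
  note inv = admissible_inverse[OF A \<theta>_pos norm_Basis[OF e_Basis], folded N_def]
  obtain a where a: "\<theta> \<le> a" "a \<le> \<Theta>"
    and Na: "\<And>h c. (N (h + c *\<^sub>R e))\<^sup>2 = (N h)\<^sup>2 + ((h \<bullet> e + c)\<^sup>2 - (h \<bullet> e)\<^sup>2) / a\<^sup>2"
    using inv(3) by blast
  have a0: "a > 0" using a \<theta>_pos by simp
  have N0: "N h \<ge> 0" for h by (simp add: N_def)
  have "kern (\<lambda>h. N h powr - p)"
    unfolding kern_def
  proof (intro conjI allI impI)
    show "(\<lambda>h. N h powr - p) \<in> borel_measurable borel"
    proof -
      have "continuous_on UNIV (\<lambda>h. matrix_inv A *v h)" by (intro linear_continuous_on linear_conv_bounded_linear[THEN iffD1]) simp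
      then have [measurable]: "(\<lambda>h. matrix_inv A *v h) \<in> borel_measurable borel" by (rule borel_measurable_continuous_onI)
      show ?thesis unfolding N_def by measurable
    qed
    fix h :: "real ^ 'n"
    show "\<theta> powr p * norm h powr - p \<le> N h powr - p"
    proof (cases "h = 0")
      case False
      have "0 < norm h / \<Theta>" using False \<Theta>_pos by simp
      then have "0 < N h" using inv(1)[of h] by linarith
      then have "(norm h / \<theta>) powr - p \<le> N h powr - p" using inv(2)[of h] p_pos by (intro powr_mono2') auto
      moreover have "(norm h / \<theta>) powr - p = \<theta> powr p * norm h powr - p"
        using \<theta>_pos powr_divide[of "norm h" \<theta> "- p"] by (simp add: powr_minus_divide)
      ultimately show ?thesis by simp
    qed simp
    show "N h powr - p \<le> \<Theta> powr p * norm h powr - p"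
    proof (cases "h = 0")
      case False
      have "0 < norm h / \<Theta>" using False \<Theta>_pos by simp
      then have "N h powr - p \<le> (norm h / \<Theta>) powr - p" using inv(1)[of h] p_pos by (intro powr_mono2') auto
      moreover have "(norm h / \<Theta>) powr - p = \<Theta> powr p * norm h powr - p"
        using \<Theta>_pos powr_divide[of "norm h" \<Theta> "- p"] by (simp add: powr_minus_divide)
      ultimately show ?thesis by simp
    qed (simp add: N_def)
    have "N (- h) = N h" by (simp add: N_def linear_neg[OF matrix_vector_mul_linear])
    then show "N (- h) powr - p = N h powr - p" by simp
    have "(N (mirror e 0 h))\<^sup>2 = (N h)\<^sup>2" unfolding mirror_def Na by (simp add: power2_eq_square)
    then have "N (mirror e 0 h) = N h" using N0 by (simp add: power2_eq_iff_nonneg)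
    then show "N (mirror e 0 h) powr - p = N h powr - p" by simp
    fix c :: real
    assume h: "h \<noteq> 0" and le: "(h \<bullet> e)\<^sup>2 \<le> (h \<bullet> e + c)\<^sup>2"
    define \<Delta> where "\<Delta> = (h \<bullet> e + c)\<^sup>2 - (h \<bullet> e)\<^sup>2"
    have \<Delta>: "\<Delta> \<ge> 0" using le by (simp add: \<Delta>_def)
    \<comment> \<open>A lower bound for the relative growth of the squared length, because N h <=
      |h| / \<theta> and the eigenvalue a is at most \<Theta>.\<close>
    define x where "x = (\<theta> / \<Theta>)\<^sup>2 * (\<Delta> / (norm h)\<^sup>2)"
    have x: "x \<ge> 0" using \<Delta> by (simp add: x_def)
    have "0 < norm h / \<Theta>" using h \<Theta>_pos by simp
    then have Nh: "0 < N h" using inv(1)[of h] by linarith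
    have "x * (N h)\<^sup>2 \<le> x * (norm h / \<theta>)\<^sup>2" using x inv(2)[of h] N0 by (intro mult_left_mono power_mono) auto
    also have "\<dots> = \<Delta> / \<Theta>\<^sup>2" using h \<theta>_pos by (simp add: x_def power_divide)
    also have "\<dots> \<le> \<Delta> / a\<^sup>2" using \<Delta> a a0 by (intro divide_left_mono power_mono) auto
    finally have "(1 + x) * (N h)\<^sup>2 \<le> (N (h + c *\<^sub>R e))\<^sup>2" unfolding Na \<Delta>_def by (simp add: algebra_simps)
    then have "((N (h + c *\<^sub>R e))\<^sup>2) powr (- p / 2) \<le> ((1 + x) * (N h)\<^sup>2) powr (- p / 2)"
      using x Nh p_pos by (intro powr_mono2') (auto simp: add_nonneg_pos)
    also have "\<dots> = (1 + x) powr (- p / 2) * ((N h)\<^sup>2) powr (- p / 2)" using x by (simp add: powr_mult)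
    finally have "N (h + c *\<^sub>R e) powr - p \<le> (1 + x) powr (- p / 2) * N h powr - p"
      unfolding square_powr_half[OF N0] .
    then show "N (h + c *\<^sub>R e) powr - p \<le>
        (1 + (\<theta> / \<Theta>)\<^sup>2 * (((h \<bullet> e + c)\<^sup>2 - (h \<bullet> e)\<^sup>2) / (norm h)\<^sup>2)) powr (- p / 2) * N h powr - p"
      unfolding x_def \<Delta>_def .
  qed
  then show ?thesis unfolding pp N_def by (simp add: powr_minus_divide)
qed

text \<open>Mean value inequality for \<open>u\<close> minus its linear part at x, on the closed
  ball of radius |h|, where the derivative of the difference has norm at most L |h|.\<close>

lemma C11_loc_regular_at:
  fixes u :: "'a::euclidean_space \<Rightarrow> real"
  assumes u: "u \<in> C11_loc S" and S: "open S" "x \<in> S"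
    and meas: "u \<in> borel_measurable lebesgue" and bd: "\<And>y. \<bar>u y\<bar> \<le> M"
  shows "\<exists>g. regular_at u x g"
proof -
  from u obtain g where g: "\<And>y. y \<in> S \<Longrightarrow> GDERIV u y :> g y"
    and lip: "\<And>y. y \<in> S \<Longrightarrow> \<exists>r>0. \<exists>L. L-lipschitz_on (ball y r \<inter> S) g"
    unfolding C11_loc_def by blast
  obtain r1 L where r1: "r1 > 0" and L: "L-lipschitz_on (ball x r1 \<inter> S) g" using lip[OF S(2)] by blast
  obtain r2 where r2: "r2 > 0" "ball x r2 \<subseteq> S" using S openE by blast
  define r where "r = min r1 r2"
  have r: "r > 0" using r1 r2 by (simp add: r_def)
  have L0: "L \<ge> 0" using lipschitz_on_nonneg[OF L] .
  have est: "\<bar>u (x + h) - u x - g x \<bullet> h\<bar> \<le> L * (norm h)\<^sup>2" if h: "norm h < r" for h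
  proof -
    define C where "C = cball x (norm h)"
    have CS: "y \<in> ball x r1 \<inter> S" if "y \<in> C" for y using that h r2(2) by (auto simp: C_def r_def)
    have "norm ((u (x + h) - g x \<bullet> (x + h)) - (u x - g x \<bullet> x)) \<le> (L * norm h) * norm ((x + h) - x)"
    proof (rule differentiable_bound[where f = "\<lambda>y. u y - g x \<bullet> y" and S = C and f' = "\<lambda>y h. h \<bullet> g y - g x \<bullet> h"])
      show "convex C" by (simp add: C_def)
      show "x + h \<in> C" "x \<in> C" by (simp_all add: C_def dist_norm)
      fix y assume y: "y \<in> C"
      have "(u has_derivative (\<lambda>h. h \<bullet> g y)) (at y)" using g[of y] CS[OF y] by (simp add: gderiv_def)
      then have "((\<lambda>y. u y - g x \<bullet> y) has_derivative (\<lambda>h. h \<bullet> g y - g x \<bullet> h)) (at y)"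
        by (auto intro!: derivative_eq_intros)
      then show "((\<lambda>y. u y - g x \<bullet> y) has_derivative (\<lambda>h. h \<bullet> g y - g x \<bullet> h)) (at y within C)"
        by (rule has_derivative_at_withinI)
      have "norm (g y - g x) \<le> L * norm h"
      proof -
        have "x \<in> C" by (simp add: C_def)
        then have "dist (g y) (g x) \<le> L * dist y x" by (intro lipschitz_onD[OF L] CS y)
        also have "\<dots> \<le> L * norm h" using y L0 by (intro mult_left_mono) (auto simp: C_def dist_commute)
        finally show ?thesis by (simp add: dist_norm)
      qed
      show "onorm (\<lambda>h. h \<bullet> g y - g x \<bullet> h) \<le> L * norm h"
      proof (rule onorm_le)
        fix k
        have "norm (k \<bullet> g y - g x \<bullet> k) = \<bar>(g y - g x) \<bullet> k\<bar>" by (simp add: inner_diff_left inner_commute[of k])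
        also have "\<dots> \<le> norm (g y - g x) * norm k" by (rule Cauchy_Schwarz_ineq2)
        also have "\<dots> \<le> L * norm h * norm k" using \<open>norm (g y - g x) \<le> L * norm h\<close> by (rule mult_right_mono) simp
        finally show "norm (k \<bullet> g y - g x \<bullet> k) \<le> L * norm h * norm k" .
      qed
    qed
    then show ?thesis by (simp add: inner_add_right power2_eq_square algebra_simps)
  qed
  have "\<exists>M. \<forall>y. \<bar>u y\<bar> \<le> M" using bd by blast
  then have "regular_at u x (g x)" unfolding regular_at_def using meas r est by blast
  then show ?thesis ..
qed

theorem theorem4p13:
  fixes \<theta> \<Theta> s :: real
    and u :: "real ^ 'n::{finite,linorder} \<Rightarrow> real"
    and f :: "real \<Rightarrow> real"
  assumes "0 < \<theta>" and "\<theta> \<le> \<Theta>"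
    and "0 < s" and "s < 1"
    and "u \<in> L_space s" and "u \<in> C11_loc upper_half_space"
    and "\<forall>x. 0 \<le> u x" and "\<exists>x. u x \<noteq> 0" and "bounded (range u)"
    and "\<forall>x\<in>upper_half_space. - F_op \<theta> \<Theta> e_last s u x = f (u x)"
    and "\<forall>x. x \<notin> upper_half_space \<longrightarrow> u x = 0"
    and "\<exists>L. L-lipschitz_on (range u) f"
    and "f 0 \<noteq> 0 \<or> (\<exists>c\<^sub>0>0. \<exists>\<delta>\<^sub>0>0. \<forall>t\<in>{0..\<delta>\<^sub>0}. c\<^sub>0 * t \<le> f t)"
  shows "(\<forall>x\<in>upper_half_space. \<forall>t>0. u x < u (x + t *\<^sub>R e_last)) \<and>
         (\<forall>x\<in>upper_half_space. 0 < u x)"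
proof -
  define e :: "(real, 'n) vec" where "e = e_last"
  have e: "e \<in> Basis" by (simp add: e_def e_last_def)
  have half: "x \<in> upper_half_space \<longleftrightarrow> 0 < x \<bullet> e" for x :: "(real, 'n) vec"
    by (simp add: upper_half_space_def e_def e_last_def inner_axis)
  have open_half: "open (upper_half_space :: (real, 'n) vec set)"
  proof -
    have "upper_half_space = {x :: (real, 'n) vec. e \<bullet> x > 0}" using half by (auto simp: inner_commute)
    then show ?thesis using open_halfspace_gt[of 0 e] by simp
  qed
  interpret kernel_setting e \<theta> \<Theta> s by unfold_locales (use assms e in auto)
  have meas: "u \<in> borel_measurable lebesgue" using assms(5) by (simp add: L_space_def)
  obtain M where M: "\<And>x. \<bar>u x\<bar> \<le> M" using assms(9) by (auto simp: bounded_iff)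
  have "\<forall>x\<in>upper_half_space. \<exists>g. regular_at u x g"
    using C11_loc_regular_at[OF assms(6) open_half _ meas M] by blast
  then obtain G where G: "\<And>x. 0 < x \<bullet> e \<Longrightarrow> regular_at u x (G x)" using half by metis
  define KA where "KA A h = 1 / norm (matrix_inv A *v h) powr (real CARD('n) + 2 * s)" for A :: "((real, 'n) vec, 'n) vec" and h
  define Adm where "Adm = admissible_matrices \<theta> \<Theta> e"
  have KA: "kern (KA A)" if "A \<in> Adm" for A
    using admissible_kern[OF kernel_setting_axioms] that unfolding KA_def Adm_def .
  have "e \<noteq> 0" using e nonzero_Basis by blast
  then have ne: "Adm \<noteq> {}" using admissible_nonempty[OF assms(2)] by (auto simp: Adm_def)
  have F: "- f (u x) = (INF A\<in>Adm. lap (KA A) u x (G x))" if x: "0 < x \<bullet> e" for x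
  proof -
    have "principal_value (\<lambda>y. (u y - u x) / norm (matrix_inv A *v (y - x)) powr (real CARD('n) + 2 * s)) x
        = lap (KA A) u x (G x)" if "A \<in> Adm" for A
    proof -
      have "principal_value (\<lambda>y. (u y - u x) * KA A (y - x)) x = lap (KA A) u x (G x)"
        unfolding principal_value_def by (intro tendsto_Lim principal_value_lap KA that G x) simp
      then show ?thesis by (simp add: KA_def)
    qed
    then have "F_op \<theta> \<Theta> e s u x = (INF A\<in>Adm. lap (KA A) u x (G x))"
      unfolding F_op_def Adm_def[symmetric] by (intro INF_cong) auto
    moreover have "- F_op \<theta> \<Theta> e s u x = f (u x)" using assms(10) half x by (simp add: e_def)
    ultimately show ?thesis by linarith
  qed
  \<comment> \<open>A real infimum is a lower bound of its family only once the family is known to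
    be bounded below.\<close>
  have bb: "bdd_below ((\<lambda>A. lap (KA A) u x (G x)) ` Adm)" if x: "0 < x \<bullet> e" for x
  proof -
    obtain C where C: "\<And>K. kern K \<Longrightarrow> \<bar>lap K u x (G x)\<bar> \<le> C" by (rule lap_bounded[OF G[OF x]]) blast
    have "- C \<le> lap (KA A) u x (G x)" if "A \<in> Adm" for A using C[OF KA[OF that]] by linarith
    then show ?thesis by (intro bdd_belowI2)
  qed
  obtain L where L: "L-lipschitz_on (range u) f" using assms(12) by blast
  \<comment> \<open>The kernels \<open>KA A\<close> are particular members of \<open>kern\<close>.
    The three equation assumptions start from a bound over all of \<open>kern\<close>, so they
    follow from the infimum over these members.\<close>
  interpret half_space_solution e \<theta> \<Theta> s u f G L M
  proof unfold_locales
    show "u \<in> borel_measurable lebesgue" by (rule meas)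
    show "0 \<le> u x" for x using assms(7) by blast
    show "u x \<le> M" for x using M[of x] by linarith
    show "u x = 0" if "x \<bullet> e \<le> 0" for x using assms(11) half[of x] that by auto
    show "\<exists>x. u x \<noteq> 0" by (rule assms(8))
    show "regular_at u x (G x)" if "0 < x \<bullet> e" for x by (rule G[OF that])
    show "0 \<le> L" by (rule lipschitz_on_nonneg[OF L])
    show "\<bar>f (u x) - f (u y)\<bar> \<le> L * \<bar>u x - u y\<bar>" for x y
      using lipschitz_onD[OF L, of "u x" "u y"] by (simp add: dist_real_def)
    show "f 0 \<noteq> 0 \<or> (\<exists>c>0. \<exists>\<delta>>0. \<forall>t\<in>{0..\<delta>}. c * t \<le> f t)" by (rule assms(13))
  next
    fix x B assume x: "0 < x \<bullet> e" and B: "\<And>K. kern K \<Longrightarrow> B \<le> lap K u x (G x)"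
    have "B \<le> (INF A\<in>Adm. lap (KA A) u x (G x))" by (intro cINF_greatest ne B KA)
    then show "f (u x) \<le> - B" using F[OF x] by linarith
  next
    fix x B assume x: "0 < x \<bullet> e" and B: "\<And>K. kern K \<Longrightarrow> lap K u x (G x) \<le> B"
    obtain A where A: "A \<in> Adm" using ne by blast
    have "(INF A\<in>Adm. lap (KA A) u x (G x)) \<le> B" by (rule cINF_lower2[OF bb[OF x] A B[OF KA[OF A]]])
    then show "- B \<le> f (u x)" using F[OF x] by linarith
  next
    fix x y B assume x: "0 < x \<bullet> e" and y: "0 < y \<bullet> e"
      and B: "\<And>K. kern K \<Longrightarrow> lap K u x (G x) + B \<le> lap K u y (G y)"
    \<comment> \<open>Compared one matrix at a time, since the two infima may be approached along
      different matrices.\<close>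
    have "(INF A\<in>Adm. lap (KA A) u x (G x)) + B \<le> (INF A\<in>Adm. lap (KA A) u y (G y))"
    proof (rule cINF_greatest[OF ne])
      fix A assume A: "A \<in> Adm"
      have "(INF A\<in>Adm. lap (KA A) u x (G x)) \<le> lap (KA A) u x (G x)" by (rule cINF_lower[OF bb[OF x] A])
      then show "(INF A\<in>Adm. lap (KA A) u x (G x)) + B \<le> lap (KA A) u y (G y)" using B[OF KA[OF A]] by linarith
    qed
    then show "f (u y) + B \<le> f (u x)" using F[OF x] F[OF y] by linarith
  qed
  show ?thesis
    using strictly_increasing positive half unfolding e_def by blast
qed

end
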